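(* Let $(\bar x,\bar u)$ be a weak local minimizer for Problem (P). Let $\delta>0$ be such that hypotheses (H1)--(H7) listed in the context hold, and assume that there is an AWMP sequence $\{(x^k,u^k,\zeta^k,p^k,q^k,r^k,\lambda_k)\}$ (with this parameter $\delta$ and perturbations $(\varepsilon^k,\eta^k)$) associated with $(\bar x,\bar u)$, i.e. with $x^k\to\bar x$ uniformly and $u^k\to\bar u$ in $L^1_m$, satisfying: (H8) there exist integrable functions $c_\varepsilon,c_\eta$, depending only on $(\bar x,\bar u)$ and $\delta$, such that $|\varepsilon^k(t)|\le c_\varepsilon(t)$ and $|\eta^k(t)|\le c_\eta(t)$ a.e. in $[t_0,t_1]$ for all $k\in\mathbb N$; (H9) there exists an integrable function $c_\varphi$, depending only on $(\bar x,\bar u)$ and $\delta$, such that for all $k\in\mathbb N$ and a.e. $t\in[t_0,t_1]$ $$\Big|\sum_{i=1}^{m_b}q_i^k(t)\nabla_x b_i(t,x^k(t),u^k(t))+\sum_{j=1}^{m_g}r_j^k(t)\nabla_x g_j(t,x^k(t),u^k(t))\Big|\le c_\varphi(t).$$ If $(\bar x,\bar u)$ is an AWMP-regular process of (P) (with this $\delta$), then $(\bar x,\bar u)$ satisfies the conditions of the classical weak maximum principle, i.e. there exist $\lambda\in[0,+\infty)$, $p\in W^{1,1}_n$, $q\in L^1_{m_b}$, $r\in L^1_{m_g}$, $\zeta\in L^1_m$ such that \begin{align*} &\lambda+\|p\|_{L^\infty_n}\neq 0,\\ &(-\dot p(t),\zeta(t))\in \mathrm{co}\,\partial_{x,u}\mathcal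 H(t,\bar x(t),p(t),q(t),r(t),\bar u(t))\ \text{ a.e. in }[t_0,t_1],\\ &\zeta(t)\in \mathrm{co}\,\mathcal N_{U(t)}(\bar u(t))\ \text{ a.e. in }[t_0,t_1],\\ &r(t)\cdot g(t,\bar x(t),\bar u(t))=0\ \text{ and }\ r(t)\le 0\ \text{ a.e. in }[t_0,t_1],\\ &(p(t_0),-p(t_1))\in\lambda\,\partial\ell(\bar x(t_0),\bar x(t_1))+\mathcal N_C(\bar x(t_0),\bar x(t_1)). \end{align*}
   Context: Notation. $L^p_l:=L^p([t_0,t_1];\mathbb R^l)$, $W^{1,1}_n:=W^{1,1}([t_0,t_1];\mathbb R^n)$; $B$ is the closed unit ball; $|\cdot|$ is the Euclidean norm; $\to$, $\rightharpoonup$ are strong and weak convergence; $\mathrm{co}$ is the convex hull; $\mathcal N_S(x)$ is the limiting (Mordukhovich) normal cone to $S$ at $x\in S$ (and $\mathcal N_S(x)=\varnothing$ if $x\notin S$); $\partial$ is the limiting (Mordukhovich) subdifferential, $\partial_{x,u}$ being taken with respect to $(x,u)$. Vector inequalities are componentwise. Problem (P): minimize $\ell(x(t_0),x(t_1))$ over $(x,u)\in W^{1,1}_n\times L^1_m$ subject to $\dot x(t)=f(t,x(t),u(t))$, $0=b(t,x(t),u(t))$, $0\ge g(t,x(t),u(t))$, $u(t)\in U(t)$ a.e. in $[t_0,t_1]$, and $(x(t_0),x(t_1))\in C$. Here $\ell:\mathbb R^n\times\mathbb R^n\to\mathbb R$, and $f,b,g$ map $[t_0,t_1]\times\mathbb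 R^n\times\mathbb R^m$ to $\mathbb R^n,\mathbb R^{m_b},\mathbb R^{m_g}$ respectively; $U:[t_0,t_1]\rightsquigarrow\mathbb R^m$ is a nonempty set-valued map and $C\subset\mathbb R^n\times\mathbb R^n$. A process is a pair $(x,u)\in W^{1,1}_n\times L^1_m$ satisfying the dynamics; it is feasible if it satisfies all the other constraints. Set $g_j^-(t,x,u):=\max\{-g_j(t,x,u),0\}$ and $\mathcal H(t,x,p,q,r,u):=p\cdot f(t,x,u)+q\cdot b(t,x,u)+r\cdot g(t,x,u)$. For $\delta>0$ and $(\bar x,\bar u)$: $\Omega_\delta(t):=\{(y,z)\in\mathbb R^n\times\mathbb R^m:|(y,z)-(\bar x(t),\bar u(t))|\le\delta\}$, $\Omega_\delta:=\{(x,u)\in W^{1,1}_n\times L^1_m:(x(t),u(t))\in\Omega_\delta(t)\text{ a.e.}\}$, $U_\delta(t):=(\bar u(t)+\delta B)\cap U(t)$, $\mathscr C:=\{\phi\in L^1_1:\phi(t)\le 0\}$. A feasible process $(\bar x,\bar u)$ is a weak local minimizer if there is $\delta'>0$ such that $\ell(\bar x(t_0),\bar x(t_1))\le\ell(x(t_0),x(t_1))$ for all feasible processes $(x,u)$ with $(x(t),u(t))\in\Omega_{\delta'}(t)$ a.e. in $[t_0,t_1]$. Hypotheses (for a given $\delta>0$): (H1) $f(\cdot,x,u)$ is Lebesgue measurable for each $(x,u)$ and there is an integrable $k_f$ such that, for a.e. $t$, $|f(t,x,u)-f(t,x',u')|\le k_f(t)|(x,u)-(x',u')|$ for all $(x,u),(x',u')\in\Omega_\delta(t)$.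 (H2) The graph of $U$ is a Borel measurable set and $U_\delta(t)$ is closed and convex for a.e. $t$. (H3) $C$ is closed and $\ell$ is locally Lipschitz in a neighborhood of $(\bar x(t_0),\bar x(t_1))$. (H4) $(b,g)(\cdot,x,u)$ is Lebesgue measurable for each $(x,u)$. (H5) $(b,g)(t,\cdot,\cdot)$ is continuously differentiable on $(\bar x(t),\bar u(t))+\delta B$ for a.e. $t$ and there is an integrable $k_{bg}$ such that, for a.e. $t$, $|(b,g)(t,x,u)-(b,g)(t,x',u')|\le k_{bg}(t)|(x,u)-(x',u')|$ for all $(x,u),(x',u')\in\Omega_\delta(t)$. (H6) $K_f(t):=|f(t,\bar x(t),\bar u(t))|$ and $K_{bg}(t):=|(b,g)(t,\bar x(t),\bar u(t))|$ are integrable on $[t_0,t_1]$ and $\bar u\in L^\infty_m$. (H7) Let $D:=\{(x,v)\in W^{1,1}_n\times L^2_m:(x(t),v(t))\in\Omega_\delta(t)\text{ a.e. in }[t_0,t_1]\}$. The mapping $\mathcal F:D\to L^\infty_n$, $\mathcal F(x,v)(t):=\int_{t_0}^t f(s,x(s),v(s))\,ds$, is completely continuous, and $\mathcal P:D\to\mathbb R$, $\mathcal P(x,v):=\int_{t_0}^{t_1}\big[\sum_{i=1}^{m_b}(b_i(t,x(t),v(t)))^2+\sum_{j=1}^{m_g}(\max\{g_j(t,x(t),v(t)),0\})^2\big]dt$, is weakly sequentially lower semicontinuous. AWMP sequence. A sequence $\{(x^k,u^k,\zeta^k,p^k,q^k,r^k,\lambda_k)\}\subset W^{1,1}_n\times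 L^1_m\times L^1_m\times W^{1,1}_n\times L^1_{m_b}\times L^1_{m_g}\times[0,+\infty)$ is an AWMP sequence if there exist $\delta>0$ and sequences $\{(\varepsilon^k,\eta^k)\}\subset L^1_n\times L^1_m$, $\{\theta_j^k\}\subset\mathscr C$ ($j=1,\dots,m_g$), $\{(\vartheta^k,\nu^k)\}\subset\mathbb R^n\times\mathbb R^n$ such that for all $k\in\mathbb N$: (i) $\lambda_k+\|p^k\|_{L^\infty_n}=1$; (ii) $(-\dot p^k(t),\zeta^k(t))-(\varepsilon^k(t),\eta^k(t))\in\mathrm{co}\,\partial_{x,u}\mathcal H(t,x^k(t),p^k(t),q^k(t),r^k(t),u^k(t))$ a.e.; (iii) $\zeta^k(t)\in\mathcal N_{U_\delta(t)}(u^k(t))$ a.e.; (iv) $r_j^k(t)g_j^-(t,x^k(t),u^k(t))=\theta_j^k(t)$ and $r_j^k(t)\le0$ a.e., $j=1,\dots,m_g$; (v) $(p^k(t_0),-p^k(t_1))-(\vartheta^k,\nu^k)\in\lambda_k\partial\ell(x^k(t_0),x^k(t_1))+\mathcal N_C(x^k(t_0),x^k(t_1))$; with $(\varepsilon^k,\eta^k)\rightharpoonup(0,0)$ in $L^1_n\times L^1_m$, $\theta_j^k(t)\to0$ a.e. for each $j$, and $(\vartheta^k,\nu^k)\to(0,0)$. The set $\mathcal M_\delta$. For $(x,u)\in\Omega_\delta$ and $\theta=(\theta_1,\dots,\theta_{m_g})$ with $\theta_j\in\mathscr C$, $\mathcal M_\delta(x,u,\theta)$ is the set of all $(\varphi,\psi,\gamma,\xi)\in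 L^1_n\times L^1_m\times\mathbb R^n\times\mathbb R^n$ for which there are $(q,r,\zeta)\in L^1_{m_b}\times L^1_{m_g}\times L^1_m$ such that, a.e. in $[t_0,t_1]$, $(\varphi(t),\psi(t))=\sum_{i=1}^{m_b}q_i(t)\nabla_{x,u}b_i(t,x(t),u(t))+\sum_{j=1}^{m_g}r_j(t)\nabla_{x,u}g_j(t,x(t),u(t))+(0,-\zeta(t))$, $\zeta(t)\in\mathcal N_{U_\delta(t)}(u(t))$, $r_j(t)g_j^-(t,x(t),u(t))=\theta_j(t)$, $r_j(t)\le0$ ($j=1,\dots,m_g$), $|\psi(t)|\le k_\psi(t)$ for some integrable $k_\psi:[t_0,t_1]\to\mathbb R$ depending only on $(\bar x,\bar u)$ and $\delta$; and $(\gamma,\xi)\in\mathcal N_C(x(t_0),x(t_1))$. (Since $k_\psi$ does not depend on $(x,u,\theta)$, one and the same $k_\psi$ serves for all $k$ along a sequence as below.) The weak upper limit $\mathrm{w}\text{-}\limsup_{x\to\bar x,u\to\bar u,\theta\to0}\mathcal M_\delta(x,u,\theta)$ is the set of all $(\varphi,\psi,\gamma,\xi)\in L^1_n\times L^1_m\times\mathbb R^n\times\mathbb R^n$ for which there exist $\{(x^k,u^k,\theta^k)\}\subset W^{1,1}_n\times L^1_m\times\mathscr C^{m_g}$ and $(\varphi^k,\psi^k,\gamma^k,\xi^k)\in\mathcal M_\delta(x^k,u^k,\theta^k)$ for all $k$, with $x^k\to\bar x$ uniformly, $u^k\to\bar u$ in $L^1_m$, $\theta^k_j(t)\to0$ a.e.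 for each $j$, $(\varphi^k,\psi^k)\rightharpoonup(\varphi,\psi)$ in $L^1_n\times L^1_m$, $(\gamma^k,\xi^k)\to(\gamma,\xi)$. A feasible process $(\bar x,\bar u)$ is AWMP-regular if $\mathrm{w}\text{-}\limsup_{x\to\bar x,u\to\bar u,\theta\to0}\mathcal M_\delta(x,u,\theta)\subset\mathcal M_\delta(\bar x,\bar u,0)$ for some $\delta>0$; "with this $\delta$" means the inclusion holds for the indicated $\delta$.
   Formalization: Added assumption: for all large k, (x^k(t),u^k(t)) lies in the interior of Ω_δ(t) for a.e. t; without it the claim fails, since (H1) does not control f outside Ω_δ(t), where the AWMP sequence may go. *)

theory Defs
  imports "HOL-Analysis.Analysis" "HOL-Probability.Essential_Supremum"
begin

section \<open>Variational analysis\<close>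

text \<open>
  Limiting (Mordukhovich) normals and subgradients are limits of regular (Frechet) ones taken at
  nearby points; for subgradients, at nearby points with nearby values.
\<close>

definition regular_normal_cone :: "'a::euclidean_space set \<Rightarrow> 'a \<Rightarrow> 'a set" where
  "regular_normal_cone S x =
     {v. x \<in> S \<and> (\<forall>e>0. \<forall>\<^sub>F y in at x within S. v \<bullet> (y - x) \<le> e * norm (y - x))}"

definition limiting_normal_cone :: "'a::euclidean_space set \<Rightarrow> 'a \<Rightarrow> 'a set" where
  "limiting_normal_cone S x =
     {v. x \<in> S \<and> (\<exists>y w. (\<forall>k::nat. y k \<in> S \<and> w k \<in> regular_normal_cone S (y k)) \<and>
                      y \<longlonglongrightarrow> x \<and> w \<longlonglongrightarrow> v)}"

definition regular_subdiff :: "('a::euclidean_space \<Rightarrow> real) \<Rightarrow> 'a \<Rightarrow> 'a set" where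
  "regular_subdiff h x =
     {v. \<forall>e>0. \<forall>\<^sub>F y in at x. h y \<ge> h x + v \<bullet> (y - x) - e * norm (y - x)}"

definition limiting_subdiff :: "('a::euclidean_space \<Rightarrow> real) \<Rightarrow> 'a \<Rightarrow> 'a set" where
  "limiting_subdiff h x =
     {v. \<exists>y w. (\<forall>k::nat. w k \<in> regular_subdiff h (y k)) \<and>
               y \<longlonglongrightarrow> x \<and> (\<lambda>k. h (y k)) \<longlonglongrightarrow> h x \<and> w \<longlonglongrightarrow> v}"

definition gradient :: "('a::euclidean_space \<Rightarrow> real) \<Rightarrow> 'a \<Rightarrow> 'a" where
  "gradient h z = (THE D. GDERIV h z :> D)"


section \<open>Function spaces\<close>

text \<open>
  Elements of the Lebesgue spaces are represented by functions, so every condition on them is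
  imposed almost everywhere.  A vector-valued function is in \<open>L\<^sup>1\<close> iff it is Bochner
  \<^const>\<open>integrable\<close>.  Weak convergence is written out with the dual pairings of \<open>L\<^sup>1\<close> with
  \<open>L\<^sup>\<infinity>\<close> and of \<open>L\<^sup>2\<close> with itself.
\<close>

definition L2 :: "'t measure \<Rightarrow> ('t \<Rightarrow> 'a::euclidean_space) \<Rightarrow> bool" where
  "L2 M v \<longleftrightarrow> v \<in> borel_measurable M \<and> integrable M (\<lambda>t. (norm (v t))\<^sup>2)"

definition Linf :: "'t measure \<Rightarrow> ('t \<Rightarrow> 'a::euclidean_space) \<Rightarrow> bool" where
  "Linf M v \<longleftrightarrow> v \<in> borel_measurable M \<and> (\<exists>K. AE t in M. norm (v t) \<le> K)"

definition Linf_norm :: "'t measure \<Rightarrow> ('t \<Rightarrow> 'a::euclidean_space) \<Rightarrow> ereal" where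
  "Linf_norm M v = esssup M (\<lambda>t. ereal (norm (v t)))"

definition L1_tendsto ::
    "'t measure \<Rightarrow> (nat \<Rightarrow> 't \<Rightarrow> 'a::euclidean_space) \<Rightarrow> ('t \<Rightarrow> 'a) \<Rightarrow> bool" where
  "L1_tendsto M v w \<longleftrightarrow> (\<forall>k. integrable M (v k)) \<and> integrable M w \<and>
     (\<lambda>k. \<integral>t. norm (v k t - w t) \<partial>M) \<longlonglongrightarrow> 0"

definition weak_L1_tendsto ::
    "'t measure \<Rightarrow> (nat \<Rightarrow> 't \<Rightarrow> 'a::euclidean_space) \<Rightarrow> ('t \<Rightarrow> 'a) \<Rightarrow> bool" where
  "weak_L1_tendsto M v w \<longleftrightarrow> (\<forall>k. integrable M (v k)) \<and> integrable M w \<and>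
     (\<forall>\<phi>. Linf M \<phi> \<longrightarrow> (\<lambda>k. \<integral>t. v k t \<bullet> \<phi> t \<partial>M) \<longlonglongrightarrow> (\<integral>t. w t \<bullet> \<phi> t \<partial>M))"

definition weak_L2_tendsto ::
    "'t measure \<Rightarrow> (nat \<Rightarrow> 't \<Rightarrow> 'a::euclidean_space) \<Rightarrow> ('t \<Rightarrow> 'a) \<Rightarrow> bool" where
  "weak_L2_tendsto M v w \<longleftrightarrow> (\<forall>k. L2 M (v k)) \<and> L2 M w \<and>
     (\<forall>\<phi>. L2 M \<phi> \<longrightarrow> (\<lambda>k. \<integral>t. v k t \<bullet> \<phi> t \<partial>M) \<longlonglongrightarrow> (\<integral>t. w t \<bullet> \<phi> t \<partial>M))"

text \<open>
  An element of \<open>W\<^sup>1\<^sup>,\<^sup>1\<close> is represented by its absolutely continuous version, i.e. as an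
  indefinite integral of an integrable function; the derivative of that version is the integrand,
  which is unique up to null sets (lemma \<open>has_wderiv_unique\<close>).
\<close>

definition has_wderiv ::
    "real \<Rightarrow> real \<Rightarrow> (real \<Rightarrow> 'a::euclidean_space) \<Rightarrow> (real \<Rightarrow> 'a) \<Rightarrow> bool" where
  "has_wderiv a b x v \<longleftrightarrow> integrable (lebesgue_on {a..b}) v \<and>
     (\<forall>t\<in>{a..b}. x t = x a + (\<integral>s. v s \<partial>lebesgue_on {a..t}))"

definition W11 :: "real \<Rightarrow> real \<Rightarrow> (real \<Rightarrow> 'a::euclidean_space) set" where
  "W11 a b = {x. \<exists>v. has_wderiv a b x v}"

definition wderiv :: "real \<Rightarrow> real \<Rightarrow> (real \<Rightarrow> 'a::euclidean_space) \<Rightarrow> real \<Rightarrow> 'a" where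
  "wderiv a b x = (SOME v. has_wderiv a b x v)"

lemma has_wderiv_wderiv: "x \<in> W11 a b \<Longrightarrow> has_wderiv a b x (wderiv a b x)"
  using someI_ex[of "has_wderiv a b x"] by (simp add: W11_def wderiv_def)

lemma has_wderiv_unique:
  fixes x :: "real \<Rightarrow> 'a::euclidean_space"
  assumes v: "has_wderiv a b x v" and w: "has_wderiv a b x w"
  shows "AE t in lebesgue_on {a..b}. v t = w t"
proof -
  define h where "h t = (if t \<in> {a..b} then v t - w t else 0)" for t
  note v' = v[unfolded has_wderiv_def, THEN conjunct2, rule_format]
    and w' = w[unfolded has_wderiv_def, THEN conjunct2, rule_format]
  note iv = v[unfolded has_wderiv_def, THEN conjunct1]
    and iw = w[unfolded has_wderiv_def, THEN conjunct1]
  have ai: "(\<lambda>t. v t - w t) absolutely_integrable_on {a..b}"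
    using Bochner_Integration.integrable_diff[OF iv iw]
    by (simp add: integrable_restrict_space set_integrable_def)
  have hi: "h integrable_on UNIV"
    unfolding h_def Henstock_Kurzweil_Integration.integrable_restrict_UNIV
    by (rule set_lebesgue_integral_eq_integral(1)[OF ai])
  have int0: "integral {a..t} h = 0" if t: "t \<in> {a..b}" for t
  proof -
    have sub: "{a..t} \<subseteq> {a..b}" using t by auto
    have it: "integrable (lebesgue_on {a..t}) v" "integrable (lebesgue_on {a..t}) w"
      using integrable_subinterval[OF iv sub] integrable_subinterval[OF iw sub] by auto
    have "(\<integral>s. v s \<partial>lebesgue_on {a..t}) = (\<integral>s. w s \<partial>lebesgue_on {a..t})"
      by (rule add_left_imp_eq[OF trans[OF v'[OF t, symmetric] w'[OF t]]])
    then have "(\<integral>s. v s - w s \<partial>lebesgue_on {a..t}) = 0"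
      using it by simp
    moreover have "(\<integral>s. v s - w s \<partial>lebesgue_on {a..t}) = integral {a..t} (\<lambda>s. v s - w s)"
      using it by (intro lebesgue_integral_eq_integral) auto
    moreover have "integral {a..t} h = integral {a..t} (\<lambda>s. v s - w s)"
      using sub by (intro integral_cong) (auto simp: h_def)
    ultimately show ?thesis by simp
  qed
  have hc: "h integrable_on cbox c d" for c d
    by (rule integrable_on_subcbox[OF hi subset_UNIV])
  obtain N where N: "negligible N"
    and N': "\<And>t e. \<lbrakk>t \<notin> N; 0 < e\<rbrakk> \<Longrightarrow> \<exists>d>0. \<forall>k. 0 < k \<and> k < d \<longrightarrow>
               norm (integral (cbox t (t + k *\<^sub>R One)) h /\<^sub>R k ^ DIM(real) - h t) < e"
  proof (rule integrable_ccontinuous_explicit[OF hc])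
    fix N :: "real set"
    assume "negligible N"
      and "\<And>t e. \<lbrakk>t \<notin> N; 0 < e\<rbrakk> \<Longrightarrow> \<exists>d>0. \<forall>k. 0 < k \<and> k < d \<longrightarrow>
               norm (integral (cbox t (t + k *\<^sub>R One)) h /\<^sub>R k ^ DIM(real) - h t) < e"
    then show thesis by (rule that)
  qed
  have h0: "h t = 0" if t: "t \<notin> N \<union> {b}" for t
  proof (cases "t \<in> {a..b}")
    case True
    then have tb: "t < b" using t by auto
    have small: "norm (h t) < e" if "e > 0" for e
    proof -
      have "t \<notin> N" using t by simp
      from N'[OF this \<open>e > 0\<close>] obtain d where "d > 0" and d: "\<forall>k. 0 < k \<and> k < d \<longrightarrow>
          norm (integral (cbox t (t + k *\<^sub>R One)) h /\<^sub>R k ^ DIM(real) - h t) < e"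
        by (elim exE conjE)
      define k where "k = min (d / 2) (b - t)"
      have k: "0 < k" "k < d" "t + k \<le> b"
        using \<open>d > 0\<close> tb by (auto simp: k_def)
      have "integral {a..t} h + integral {t..t + k} h = integral {a..t + k} h"
        using True k hi by (intro Henstock_Kurzweil_Integration.integral_combine)
          (auto intro: integrable_on_subinterval[OF hi])
      moreover have "integral {a..t} h = 0" "integral {a..t + k} h = 0"
        using True k by (auto intro!: int0)
      ultimately have "integral {t..t + k} h = 0" by simp
      with d[rule_format, OF conjI[OF k(1,2)]] show ?thesis by simp
    qed
    show ?thesis
      using small[of "norm (h t)"] by auto
  qed (auto simp: h_def)
  have "negligible (N \<union> {b})" using N by auto
  then have "N \<union> {b} \<in> null_sets lebesgue"
    by (simp add: negligible_iff_null_sets)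
  then have "AE t in lebesgue. t \<notin> N \<union> {b}" by (rule AE_not_in)
  then have "AE t in lebesgue. t \<in> {a..b} \<longrightarrow> v t = w t"
  proof eventually_elim
    case (elim t)
    then have "h t = 0" by (rule h0)
    then show ?case unfolding h_def by (metis eq_iff_diff_eq_0)
  qed
  then show ?thesis
    by (simp add: AE_restrict_space_iff)
qed

text \<open>
  Weak convergence in \<open>W\<^sup>1\<^sup>,\<^sup>1\<close>: the norm is that of the pair (function, derivative) in
  \<open>L\<^sup>1 \<times> L\<^sup>1\<close>, so by Hahn--Banach this is weak \<open>L\<^sup>1\<close> convergence of both.
\<close>

definition weak_W11_tendsto ::
    "real \<Rightarrow> real \<Rightarrow> (nat \<Rightarrow> real \<Rightarrow> 'a::euclidean_space) \<Rightarrow> (real \<Rightarrow> 'a) \<Rightarrow> bool" where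
  "weak_W11_tendsto a b x y \<longleftrightarrow> (\<forall>k. x k \<in> W11 a b) \<and> y \<in> W11 a b \<and>
     weak_L1_tendsto (lebesgue_on {a..b}) x y \<and>
     weak_L1_tendsto (lebesgue_on {a..b}) (\<lambda>k. wderiv a b (x k)) (wderiv a b y)"


section \<open>The control problem\<close>

record ('n, 'm, 'mb, 'mg) problem =
  t0 :: real
  t1 :: real
  cost :: "(real^'n) \<times> (real^'n) \<Rightarrow> real"
  dyn :: "real \<Rightarrow> real^'n \<Rightarrow> real^'m \<Rightarrow> real^'n"
  eqc :: "real \<Rightarrow> real^'n \<Rightarrow> real^'m \<Rightarrow> real^'mb"
  ineqc :: "real \<Rightarrow> real^'n \<Rightarrow> real^'m \<Rightarrow> real^'mg"
  ctrl :: "real \<Rightarrow> (real^'m) set"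
  endpts :: "((real^'n) \<times> (real^'n)) set"

definition valid_problem :: "('n::finite, 'm::finite, 'mb::finite, 'mg::finite) problem \<Rightarrow> bool" where
  "valid_problem P \<longleftrightarrow> t0 P < t1 P \<and> (\<forall>t\<in>{t0 P..t1 P}. ctrl P t \<noteq> {})"

abbreviation T_meas :: "('n::finite, 'm::finite, 'mb::finite, 'mg::finite) problem \<Rightarrow> real measure" where
  "T_meas P \<equiv> lebesgue_on {t0 P..t1 P}"

abbreviation W11_of :: "('n::finite, 'm::finite, 'mb::finite, 'mg::finite) problem \<Rightarrow> (real \<Rightarrow> 'a::euclidean_space) set" where
  "W11_of P \<equiv> W11 (t0 P) (t1 P)"

abbreviation dot :: "('n::finite, 'm::finite, 'mb::finite, 'mg::finite) problem \<Rightarrow> (real \<Rightarrow> 'a::euclidean_space) \<Rightarrow> real \<Rightarrow> 'a" where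
  "dot P x \<equiv> wderiv (t0 P) (t1 P) x"

definition is_process ::
    "('n::finite, 'm::finite, 'mb::finite, 'mg::finite) problem \<Rightarrow>
     (real \<Rightarrow> real^'n) \<Rightarrow> (real \<Rightarrow> real^'m) \<Rightarrow> bool" where
  "is_process P x u \<longleftrightarrow> x \<in> W11_of P \<and> integrable (T_meas P) u \<and>
     (AE t in T_meas P. dot P x t = dyn P t (x t) (u t))"

definition feasible_process ::
    "('n::finite, 'm::finite, 'mb::finite, 'mg::finite) problem \<Rightarrow>
     (real \<Rightarrow> real^'n) \<Rightarrow> (real \<Rightarrow> real^'m) \<Rightarrow> bool" where
  "feasible_process P x u \<longleftrightarrow> is_process P x u \<and>
     (AE t in T_meas P. eqc P t (x t) (u t) = 0 \<and> (\<forall>j. ineqc P t (x t) (u t) $ j \<le> 0) \<and>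
        u t \<in> ctrl P t) \<and>
     (x (t0 P), x (t1 P)) \<in> endpts P"

definition Omega_at ::
    "real \<Rightarrow> (real \<Rightarrow> real^'n) \<Rightarrow> (real \<Rightarrow> real^'m) \<Rightarrow> real \<Rightarrow> ((real^'n::finite) \<times> (real^'m::finite)) set" where
  "Omega_at \<delta> xb ub t = {(y, z). norm ((y, z) - (xb t, ub t)) \<le> \<delta>}"

definition Omega ::
    "('n::finite, 'm::finite, 'mb::finite, 'mg::finite) problem \<Rightarrow> real \<Rightarrow>
     (real \<Rightarrow> real^'n) \<Rightarrow> (real \<Rightarrow> real^'m) \<Rightarrow> ((real \<Rightarrow> real^'n) \<times> (real \<Rightarrow> real^'m)) set" where
  "Omega P \<delta> xb ub = {(x, u). x \<in> W11_of P \<and> integrable (T_meas P) u \<and>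
     (AE t in T_meas P. (x t, u t) \<in> Omega_at \<delta> xb ub t)}"

definition U_at ::
    "('n::finite, 'm::finite, 'mb::finite, 'mg::finite) problem \<Rightarrow> real \<Rightarrow>
     (real \<Rightarrow> real^'m) \<Rightarrow> real \<Rightarrow> (real^'m) set" where
  "U_at P \<delta> ub t = cball (ub t) \<delta> \<inter> ctrl P t"

definition nonpos_L1 ::
    "('n::finite, 'm::finite, 'mb::finite, 'mg::finite) problem \<Rightarrow> (real \<Rightarrow> real^'mg) \<Rightarrow> bool" where
  "nonpos_L1 P \<theta> \<longleftrightarrow> (\<forall>j. integrable (T_meas P) (\<lambda>t. \<theta> t $ j) \<and> (AE t in T_meas P. \<theta> t $ j \<le> 0))"

definition weak_local_minimizer ::
    "('n::finite, 'm::finite, 'mb::finite, 'mg::finite) problem \<Rightarrow>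
     (real \<Rightarrow> real^'n) \<Rightarrow> (real \<Rightarrow> real^'m) \<Rightarrow> bool" where
  "weak_local_minimizer P xb ub \<longleftrightarrow> feasible_process P xb ub \<and>
     (\<exists>\<delta>'>0. \<forall>x u. feasible_process P x u \<longrightarrow>
        (AE t in T_meas P. (x t, u t) \<in> Omega_at \<delta>' xb ub t) \<longrightarrow>
        cost P (xb (t0 P), xb (t1 P)) \<le> cost P (x (t0 P), x (t1 P)))"

definition Ham ::
    "('n::finite, 'm::finite, 'mb::finite, 'mg::finite) problem \<Rightarrow> real \<Rightarrow> real^'n \<Rightarrow>
     real^'n \<Rightarrow> real^'mb \<Rightarrow> real^'mg \<Rightarrow> real^'m \<Rightarrow> real" where
  "Ham P t x p q r u = p \<bullet> dyn P t x u + q \<bullet> eqc P t x u + r \<bullet> ineqc P t x u"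

definition subdiff_Ham ::
    "('n::finite, 'm::finite, 'mb::finite, 'mg::finite) problem \<Rightarrow> real \<Rightarrow> real^'n \<Rightarrow>
     real^'n \<Rightarrow> real^'mb \<Rightarrow> real^'mg \<Rightarrow> real^'m \<Rightarrow> ((real^'n) \<times> (real^'m)) set" where
  "subdiff_Ham P t x p q r u = limiting_subdiff (\<lambda>(y, z). Ham P t y p q r z) (x, u)"

definition g_minus ::
    "('n::finite, 'm::finite, 'mb::finite, 'mg::finite) problem \<Rightarrow> 'mg \<Rightarrow> real \<Rightarrow> real^'n \<Rightarrow> real^'m \<Rightarrow> real" where
  "g_minus P j t x u = max (- (ineqc P t x u $ j)) 0"

definition grad_b ::
    "('n::finite, 'm::finite, 'mb::finite, 'mg::finite) problem \<Rightarrow> 'mb \<Rightarrow> real \<Rightarrow> real^'n \<Rightarrow> real^'m \<Rightarrow> (real^'n) \<times> (real^'m)" where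
  "grad_b P i t x u = gradient (\<lambda>(y, z). eqc P t y z $ i) (x, u)"

definition grad_g ::
    "('n::finite, 'm::finite, 'mb::finite, 'mg::finite) problem \<Rightarrow> 'mg \<Rightarrow> real \<Rightarrow> real^'n \<Rightarrow> real^'m \<Rightarrow> (real^'n) \<times> (real^'m)" where
  "grad_g P j t x u = gradient (\<lambda>(y, z). ineqc P t y z $ j) (x, u)"

definition gradx_b ::
    "('n::finite, 'm::finite, 'mb::finite, 'mg::finite) problem \<Rightarrow> 'mb \<Rightarrow> real \<Rightarrow> real^'n \<Rightarrow> real^'m \<Rightarrow> real^'n" where
  "gradx_b P i t x u = gradient (\<lambda>y. eqc P t y u $ i) x"

definition gradx_g ::
    "('n::finite, 'm::finite, 'mb::finite, 'mg::finite) problem \<Rightarrow> 'mg \<Rightarrow> real \<Rightarrow> real^'n \<Rightarrow> real^'m \<Rightarrow> real^'n" where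
  "gradx_g P j t x u = gradient (\<lambda>y. ineqc P t y u $ j) x"

text \<open>\<open>\<lambda> \<partial>\<ell>(a, b) + N\<^sub>C(a, b)\<close> (a Minkowski sum)\<close>

definition transversality_set ::
    "('n::finite, 'm::finite, 'mb::finite, 'mg::finite) problem \<Rightarrow> real \<Rightarrow> (real^'n) \<times> (real^'n) \<Rightarrow> ((real^'n) \<times> (real^'n)) set" where
  "transversality_set P lam e =
     {lam *\<^sub>R s + c | s c. s \<in> limiting_subdiff (cost P) e \<and> c \<in> limiting_normal_cone (endpts P) e}"


section \<open>Hypotheses\<close>

definition H1 ::
    "('n::finite, 'm::finite, 'mb::finite, 'mg::finite) problem \<Rightarrow>
     (real \<Rightarrow> real^'n) \<Rightarrow> (real \<Rightarrow> real^'m) \<Rightarrow> real \<Rightarrow> bool" where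
  "H1 P xb ub \<delta> \<longleftrightarrow>
     (\<forall>x u. (\<lambda>t. dyn P t x u) \<in> borel_measurable (T_meas P)) \<and>
     (\<exists>kf. integrable (T_meas P) kf \<and>
        (AE t in T_meas P. \<forall>(x, u)\<in>Omega_at \<delta> xb ub t. \<forall>(x', u')\<in>Omega_at \<delta> xb ub t.
           norm (dyn P t x u - dyn P t x' u') \<le> kf t * norm ((x, u) - (x', u'))))"

definition H2 ::
    "('n::finite, 'm::finite, 'mb::finite, 'mg::finite) problem \<Rightarrow> (real \<Rightarrow> real^'m) \<Rightarrow> real \<Rightarrow> bool" where
  "H2 P ub \<delta> \<longleftrightarrow>
     {(t, z). t \<in> {t0 P..t1 P} \<and> z \<in> ctrl P t} \<in> sets borel \<and>
     (AE t in T_meas P. closed (U_at P \<delta> ub t) \<and> convex (U_at P \<delta> ub t))"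

definition H3 ::
    "('n::finite, 'm::finite, 'mb::finite, 'mg::finite) problem \<Rightarrow> (real \<Rightarrow> real^'n) \<Rightarrow> bool" where
  "H3 P xb \<longleftrightarrow> closed (endpts P) \<and>
     (\<exists>N. open N \<and> (xb (t0 P), xb (t1 P)) \<in> N \<and>
        (\<forall>e\<in>N. \<exists>\<rho>>0. \<exists>L. L-lipschitz_on (ball e \<rho>) (cost P)))"

definition H4 ::
    "('n::finite, 'm::finite, 'mb::finite, 'mg::finite) problem \<Rightarrow> bool" where
  "H4 P \<longleftrightarrow> (\<forall>x u. (\<lambda>t. (eqc P t x u, ineqc P t x u)) \<in> borel_measurable (T_meas P))"

definition H5 ::
    "('n::finite, 'm::finite, 'mb::finite, 'mg::finite) problem \<Rightarrow>
     (real \<Rightarrow> real^'n) \<Rightarrow> (real \<Rightarrow> real^'m) \<Rightarrow> real \<Rightarrow> bool" where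
  "H5 P xb ub \<delta> \<longleftrightarrow>
     (AE t in T_meas P. \<exists>D :: (real^'n) \<times> (real^'m) \<Rightarrow> ((real^'n) \<times> (real^'m)) \<Rightarrow>\<^sub>L ((real^'mb) \<times> (real^'mg)).
        (\<forall>w\<in>cball (xb t, ub t) \<delta>.
           ((\<lambda>(x, u). (eqc P t x u, ineqc P t x u)) has_derivative blinfun_apply (D w)) (at w)) \<and>
        continuous_on (cball (xb t, ub t) \<delta>) D) \<and>
     (\<exists>kbg. integrable (T_meas P) kbg \<and>
        (AE t in T_meas P. \<forall>(x, u)\<in>Omega_at \<delta> xb ub t. \<forall>(x', u')\<in>Omega_at \<delta> xb ub t.
           norm ((eqc P t x u, ineqc P t x u) - (eqc P t x' u', ineqc P t x' u'))
             \<le> kbg t * norm ((x, u) - (x', u'))))"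

definition H6 ::
    "('n::finite, 'm::finite, 'mb::finite, 'mg::finite) problem \<Rightarrow>
     (real \<Rightarrow> real^'n) \<Rightarrow> (real \<Rightarrow> real^'m) \<Rightarrow> bool" where
  "H6 P xb ub \<longleftrightarrow>
     integrable (T_meas P) (\<lambda>t. norm (dyn P t (xb t) (ub t))) \<and>
     integrable (T_meas P) (\<lambda>t. norm (eqc P t (xb t) (ub t), ineqc P t (xb t) (ub t))) \<and>
     Linf (T_meas P) ub"

definition D_set ::
    "('n::finite, 'm::finite, 'mb::finite, 'mg::finite) problem \<Rightarrow> real \<Rightarrow>
     (real \<Rightarrow> real^'n) \<Rightarrow> (real \<Rightarrow> real^'m) \<Rightarrow> ((real \<Rightarrow> real^'n) \<times> (real \<Rightarrow> real^'m)) set" where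
  "D_set P \<delta> xb ub = {(x, v). x \<in> W11_of P \<and> L2 (T_meas P) v \<and>
     (AE t in T_meas P. (x t, v t) \<in> Omega_at \<delta> xb ub t)}"

definition F_map ::
    "('n::finite, 'm::finite, 'mb::finite, 'mg::finite) problem \<Rightarrow>
     (real \<Rightarrow> real^'n) \<Rightarrow> (real \<Rightarrow> real^'m) \<Rightarrow> real \<Rightarrow> real^'n" where
  "F_map P x v t = (\<integral>s. dyn P s (x s) (v s) \<partial>lebesgue_on {t0 P..t})"

definition penalty_density ::
    "('n::finite, 'm::finite, 'mb::finite, 'mg::finite) problem \<Rightarrow>
     (real \<Rightarrow> real^'n) \<Rightarrow> (real \<Rightarrow> real^'m) \<Rightarrow> real \<Rightarrow> real" where
  "penalty_density P x v t =
     (\<Sum>i\<in>UNIV. (eqc P t (x t) (v t) $ i)\<^sup>2) + (\<Sum>j\<in>UNIV. (max (ineqc P t (x t) (v t) $ j) 0)\<^sup>2)"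

definition P_map ::
    "('n::finite, 'm::finite, 'mb::finite, 'mg::finite) problem \<Rightarrow>
     (real \<Rightarrow> real^'n) \<Rightarrow> (real \<Rightarrow> real^'m) \<Rightarrow> real" where
  "P_map P x v = (\<integral>t. penalty_density P x v t \<partial>T_meas P)"

text \<open>
  Complete continuity: weakly convergent sequences are mapped to norm convergent ones.  The
  integrability clauses state that the two maps are well defined on their domain.
\<close>

definition H7 ::
    "('n::finite, 'm::finite, 'mb::finite, 'mg::finite) problem \<Rightarrow>
     (real \<Rightarrow> real^'n) \<Rightarrow> (real \<Rightarrow> real^'m) \<Rightarrow> real \<Rightarrow> bool" where
  "H7 P xb ub \<delta> \<longleftrightarrow>
     (\<forall>(x, v)\<in>D_set P \<delta> xb ub.
        integrable (T_meas P) (\<lambda>t. dyn P t (x t) (v t)) \<and>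
        integrable (T_meas P) (penalty_density P x v)) \<and>
     (\<forall>xk vk x v. (\<forall>k. (xk k, vk k) \<in> D_set P \<delta> xb ub) \<longrightarrow> (x, v) \<in> D_set P \<delta> xb ub \<longrightarrow>
        weak_W11_tendsto (t0 P) (t1 P) xk x \<longrightarrow> weak_L2_tendsto (T_meas P) vk v \<longrightarrow>
        (\<lambda>k. Linf_norm (T_meas P) (\<lambda>t. F_map P (xk k) (vk k) t - F_map P x v t)) \<longlonglongrightarrow> 0 \<and>
        ereal (P_map P x v) \<le> liminf (\<lambda>k. ereal (P_map P (xk k) (vk k))))"


section \<open>AWMP sequences and AWMP regularity\<close>

text \<open>
  Conditions (i)--(v) for a sequence with parameter \<open>\<delta>\<close> and perturbations \<open>(eps, eta)\<close>; the
  remaining auxiliary sequences are quantified away.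
\<close>

definition AWMP_sequence ::
    "('n::finite, 'm::finite, 'mb::finite, 'mg::finite) problem \<Rightarrow> (real \<Rightarrow> real^'m) \<Rightarrow> real \<Rightarrow>
     (nat \<Rightarrow> real \<Rightarrow> real^'n) \<Rightarrow> (nat \<Rightarrow> real \<Rightarrow> real^'m) \<Rightarrow> (nat \<Rightarrow> real \<Rightarrow> real^'m) \<Rightarrow>
     (nat \<Rightarrow> real \<Rightarrow> real^'n) \<Rightarrow> (nat \<Rightarrow> real \<Rightarrow> real^'mb) \<Rightarrow> (nat \<Rightarrow> real \<Rightarrow> real^'mg) \<Rightarrow>
     (nat \<Rightarrow> real) \<Rightarrow> (nat \<Rightarrow> real \<Rightarrow> real^'n) \<Rightarrow> (nat \<Rightarrow> real \<Rightarrow> real^'m) \<Rightarrow> bool" where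
  "AWMP_sequence P ub \<delta> x u \<zeta> p q r lam eps eta \<longleftrightarrow>
     \<delta> > 0 \<and>
     (\<forall>k. x k \<in> W11_of P \<and> integrable (T_meas P) (u k) \<and> integrable (T_meas P) (\<zeta> k) \<and>
          p k \<in> W11_of P \<and> integrable (T_meas P) (q k) \<and> integrable (T_meas P) (r k) \<and>
          0 \<le> lam k) \<and>
     (\<exists>\<theta> \<upsilon> \<nu>. (\<forall>k. nonpos_L1 P (\<theta> k)) \<and>
        (\<forall>k. ereal (lam k) + Linf_norm (T_meas P) (p k) = 1) \<and>
        (\<forall>k. AE t in T_meas P. (- dot P (p k) t, \<zeta> k t) - (eps k t, eta k t)
                \<in> convex hull (subdiff_Ham P t (x k t) (p k t) (q k t) (r k t) (u k t))) \<and>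
        (\<forall>k. AE t in T_meas P. \<zeta> k t \<in> limiting_normal_cone (U_at P \<delta> ub t) (u k t)) \<and>
        (\<forall>k. AE t in T_meas P. \<forall>j.
                r k t $ j * g_minus P j t (x k t) (u k t) = \<theta> k t $ j \<and> r k t $ j \<le> 0) \<and>
        (\<forall>k. (p k (t0 P), - p k (t1 P)) - (\<upsilon> k, \<nu> k)
                \<in> transversality_set P (lam k) (x k (t0 P), x k (t1 P))) \<and>
        weak_L1_tendsto (T_meas P) eps (\<lambda>_. 0) \<and> weak_L1_tendsto (T_meas P) eta (\<lambda>_. 0) \<and>
        (\<forall>j. AE t in T_meas P. (\<lambda>k. \<theta> k t $ j) \<longlonglongrightarrow> 0) \<and>
        \<upsilon> \<longlonglongrightarrow> 0 \<and> \<nu> \<longlonglongrightarrow> 0)"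

definition converges_to_process ::
    "('n::finite, 'm::finite, 'mb::finite, 'mg::finite) problem \<Rightarrow>
     (nat \<Rightarrow> real \<Rightarrow> real^'n) \<Rightarrow> (nat \<Rightarrow> real \<Rightarrow> real^'m) \<Rightarrow>
     (real \<Rightarrow> real^'n) \<Rightarrow> (real \<Rightarrow> real^'m) \<Rightarrow> bool" where
  "converges_to_process P x u xb ub \<longleftrightarrow>
     uniform_limit {t0 P..t1 P} x xb sequentially \<and> L1_tendsto (T_meas P) u ub"

text \<open>
  The bound \<open>k\<^sub>\<psi>\<close> in the definition of the set \<open>M\<^sub>\<delta>\<close> must not depend on \<open>(x, u, \<theta>)\<close>.  It is
  therefore kept as a parameter \<open>k\<psi>\<close> and quantified outside: once for a whole sequence in the
  weak upper limit.
\<close>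

definition M_set ::
    "('n::finite, 'm::finite, 'mb::finite, 'mg::finite) problem \<Rightarrow>
     (real \<Rightarrow> real^'n) \<Rightarrow> (real \<Rightarrow> real^'m) \<Rightarrow> real \<Rightarrow> (real \<Rightarrow> real) \<Rightarrow>
     (real \<Rightarrow> real^'n) \<Rightarrow> (real \<Rightarrow> real^'m) \<Rightarrow> (real \<Rightarrow> real^'mg) \<Rightarrow>
     ((real \<Rightarrow> real^'n) \<times> (real \<Rightarrow> real^'m) \<times> (real^'n) \<times> (real^'n)) set" where
  "M_set P xb ub \<delta> k\<psi> x u \<theta> = {(\<phi>, \<psi>, \<gamma>, \<xi>).
     (x, u) \<in> Omega P \<delta> xb ub \<and> nonpos_L1 P \<theta> \<and>
     integrable (T_meas P) \<phi> \<and> integrable (T_meas P) \<psi> \<and>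
     (\<exists>q r \<zeta>. integrable (T_meas P) q \<and> integrable (T_meas P) r \<and> integrable (T_meas P) \<zeta> \<and>
        (AE t in T_meas P.
           (\<phi> t, \<psi> t) = (\<Sum>i\<in>UNIV. (q t $ i) *\<^sub>R grad_b P i t (x t) (u t))
                     + (\<Sum>j\<in>UNIV. (r t $ j) *\<^sub>R grad_g P j t (x t) (u t)) + (0, - \<zeta> t) \<and>
           \<zeta> t \<in> limiting_normal_cone (U_at P \<delta> ub t) (u t) \<and>
           (\<forall>j. r t $ j * g_minus P j t (x t) (u t) = \<theta> t $ j \<and> r t $ j \<le> 0) \<and>
           norm (\<psi> t) \<le> k\<psi> t)) \<and>
     (\<gamma>, \<xi>) \<in> limiting_normal_cone (endpts P) (x (t0 P), x (t1 P))}"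

definition M_weak_limsup ::
    "('n::finite, 'm::finite, 'mb::finite, 'mg::finite) problem \<Rightarrow>
     (real \<Rightarrow> real^'n) \<Rightarrow> (real \<Rightarrow> real^'m) \<Rightarrow> real \<Rightarrow>
     ((real \<Rightarrow> real^'n) \<times> (real \<Rightarrow> real^'m) \<times> (real^'n) \<times> (real^'n)) set" where
  "M_weak_limsup P xb ub \<delta> = {(\<phi>, \<psi>, \<gamma>, \<xi>).
     \<exists>k\<psi> x u \<theta> \<phi>k \<psi>k \<gamma>k \<xi>k. integrable (T_meas P) k\<psi> \<and>
       (\<forall>k. (\<phi>k k, \<psi>k k, \<gamma>k k, \<xi>k k) \<in> M_set P xb ub \<delta> k\<psi> (x k) (u k) (\<theta> k)) \<and>
       converges_to_process P x u xb ub \<and>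
       (\<forall>j. AE t in T_meas P. (\<lambda>k. \<theta> k t $ j) \<longlonglongrightarrow> 0) \<and>
       weak_L1_tendsto (T_meas P) \<phi>k \<phi> \<and> weak_L1_tendsto (T_meas P) \<psi>k \<psi> \<and>
       \<gamma>k \<longlonglongrightarrow> \<gamma> \<and> \<xi>k \<longlonglongrightarrow> \<xi>}"

definition AWMP_regular ::
    "('n::finite, 'm::finite, 'mb::finite, 'mg::finite) problem \<Rightarrow>
     (real \<Rightarrow> real^'n) \<Rightarrow> (real \<Rightarrow> real^'m) \<Rightarrow> real \<Rightarrow> bool" where
  "AWMP_regular P xb ub \<delta> \<longleftrightarrow> feasible_process P xb ub \<and> \<delta> > 0 \<and>
     M_weak_limsup P xb ub \<delta>
       \<subseteq> (\<Union>k\<psi>\<in>{k. integrable (T_meas P) k}. M_set P xb ub \<delta> k\<psi> xb ub (\<lambda>_. 0))"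

end

theory Submission
  imports Defs "HOL-Complex_Analysis.Great_Picard"
begin

text \<open>
  The conclusion is the limit of the AWMP conditions along a subsequence. Near the reference process
  the constraints \<open>b\<close> and \<open>g\<close> are continuously differentiable, so the sum rule for limiting
  subdifferentials is exact and each perturbed Hamiltonian inclusion reads
  \<open>(- p\<^sub>k' - \<epsilon>\<^sub>k, \<zeta>\<^sub>k - \<eta>\<^sub>k) = W\<^sub>k + c\<^sub>k\<close>, where \<open>W\<^sub>k\<close> belongs to the convex hull of the
  subdifferential of \<open>p\<^sub>k \<bullet> f\<close> and \<open>c\<^sub>k\<close> is the gradient of \<open>q\<^sub>k \<bullet> b + r\<^sub>k \<bullet> g\<close>. The
  multipliers \<open>q\<^sub>k\<close> and \<open>r\<^sub>k\<close> come without bounds, but the combinations that matter are bounded: since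
  \<open>\<parallel>p\<^sub>k\<parallel> \<le> 1\<close>, the Lipschitz modulus of \<open>f\<close> bounds \<open>W\<^sub>k\<close> (lemma
  \<open>costate_subdiff_norm_le\<close>), the \<open>x\<close>-part of \<open>c\<^sub>k\<close> is dominated by assumption, and the
  \<open>u\<close>-part of \<open>c\<^sub>k\<close> minus \<open>\<zeta>\<^sub>k\<close> equals \<open>- \<eta>\<^sub>k\<close> minus the \<open>u\<close>-part of \<open>W\<^sub>k\<close>.

  All these functions are therefore dominated by one integrable function, and
  \<open>dominated_weak_compactness\<close> extracts weak \<open>L\<^sup>1\<close> limits. The derivatives \<open>p\<^sub>k'\<close> are then weakly
  convergent and equi-integrable, so the costates converge uniformly to some \<open>p\<close>
  (\<open>has_wderiv_uniform_limit\<close>) and the normalisation \<open>\<lambda>\<^sub>k + \<parallel>p\<^sub>k\<parallel> = 1\<close> excludes a trivial limit.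
  The weak limit \<open>W\<close> of \<open>W\<^sub>k\<close> lies pointwise in the closed convex hulls of the tails, hence in the
  convex hull of the subdifferential of \<open>p \<bullet> f\<close> at the reference process
  (\<open>hull_subdiff_upper_semicontinuous\<close>; it rests on \<open>eps_subgradient_approximated\<close>, because the
  functions \<open>p\<^sub>k \<bullet> f\<close> vary with \<open>k\<close>).

  The gradients \<open>c\<^sub>k\<close> need not converge to a gradient, and this is where regularity enters:
  the limits of the \<open>x\<close>-part of \<open>c\<^sub>k\<close>, of its \<open>u\<close>-part minus \<open>\<zeta>\<^sub>k\<close>, and of the endpoint normals
  form an element of the weak upper limit, so AWMP regularity represents them by multipliers
  \<open>q\<close>, \<open>r\<close>, \<open>\<zeta>\<close> at the reference process. The new \<open>\<zeta>\<close> is unrelated to the \<open>\<zeta>\<^sub>k\<close>, but it enters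
  through the same difference, so adding \<open>W\<close> to the gradient with these multipliers returns
  \<open>(- p', \<zeta>)\<close> exactly.
\<close>

section \<open>Weak compactness of dominated sequences\<close>

text \<open>
  Closing a set of functions under midpoints gives just enough of its convex hull for the
  parallelogram identity, and provides induction as the only tool needed to transfer bounds and
  convex constraints from the generators.
\<close>
inductive_set midpoint_closure :: "('t \<Rightarrow> 'a::real_vector) set \<Rightarrow> ('t \<Rightarrow> 'a) set"
  for F :: "('t \<Rightarrow> 'a) set" where
  base: "f \<in> F \<Longrightarrow> f \<in> midpoint_closure F"
| mid: "f \<in> midpoint_closure F \<Longrightarrow> g \<in> midpoint_closure F \<Longrightarrow>
          (\<lambda>t. (1/2) *\<^sub>R (f t + g t)) \<in> midpoint_closure F"

lemma midpoint_closure_mono: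
  assumes "g \<in> midpoint_closure F" "F \<subseteq> G"
  shows "g \<in> midpoint_closure G"
  using assms by induction (auto intro: midpoint_closure.intros)

lemma midpoint_closure_convex:
  assumes "g \<in> midpoint_closure F" and "convex C" and "\<And>f. f \<in> F \<Longrightarrow> f t \<in> C"
  shows "g t \<in> C"
  using assms(1)
proof induction
  case (mid f g)
  then show ?case
    using convexD[OF \<open>convex C\<close>, of "f t" "g t" "1/2" "1/2"] by (simp add: scaleR_add_right)
qed (rule assms(3))

definition dominated_by :: "'t measure \<Rightarrow> ('t \<Rightarrow> real) \<Rightarrow> ('t \<Rightarrow> 'a::euclidean_space) \<Rightarrow> bool" where
  "dominated_by M m f \<longleftrightarrow> f \<in> borel_measurable M \<and> (AE t in M. norm (f t) \<le> m t)"

lemma midpoint_closure_dominated: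
  assumes "g \<in> midpoint_closure F" and "\<And>f. f \<in> F \<Longrightarrow> dominated_by M m f"
  shows "dominated_by M m g"
  using assms(1)
proof induction
  case (mid f g)
  then have [measurable]: "f \<in> borel_measurable M" "g \<in> borel_measurable M"
    by (auto simp: dominated_by_def)
  have "AE t in M. norm (f t) \<le> m t" "AE t in M. norm (g t) \<le> m t"
    using mid by (auto simp: dominated_by_def)
  then have "AE t in M. norm ((1/2) *\<^sub>R (f t + g t)) \<le> m t"
  proof eventually_elim
    case (elim t)
    then show ?case using norm_triangle_ineq[of "f t" "g t"] by simp
  qed
  then show ?case by (simp add: dominated_by_def)
qed (rule assms(2))

lemma dominated_pairing_le:
  assumes "dominated_by M m f" "AE t in M. norm (\<psi> t) \<le> K"
  shows "AE t in M. norm (f t \<bullet> \<psi> t) \<le> m t * K"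
proof -
  have "AE t in M. norm (f t) \<le> m t" using assms(1) by (simp add: dominated_by_def)
  with assms(2) show ?thesis
  proof eventually_elim
    case (elim t)
    have "norm (f t \<bullet> \<psi> t) \<le> norm (f t) * norm (\<psi> t)" using Cauchy_Schwarz_ineq2 by simp
    also have "\<dots> \<le> m t * K" using elim by (intro mult_mono) (auto intro: order_trans[OF norm_ge_zero])
    finally show ?case .
  qed
qed

lemma Linf_pairing_integrable:
  assumes "integrable M m" "dominated_by M m f" "Linf M \<psi>"
  shows "integrable M (\<lambda>t. f t \<bullet> \<psi> t)"
proof -
  obtain K where K: "AE t in M. norm (\<psi> t) \<le> K" using assms(3) by (auto simp: Linf_def)
  have [measurable]: "f \<in> borel_measurable M" "\<psi> \<in> borel_measurable M"
    using assms by (auto simp: dominated_by_def Linf_def)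
  show ?thesis
  proof (rule Bochner_Integration.integrable_bound)
    show "integrable M (\<lambda>t. m t * K)" using assms(1) by simp
    show "AE t in M. norm (f t \<bullet> \<psi> t) \<le> norm (m t * K)"
      using dominated_pairing_le[OF assms(2) K] by eventually_elim auto
  qed simp
qed

lemma midpoint_closure_pairing:
  assumes "g \<in> midpoint_closure F" and "integrable M m" and "Linf M \<psi>" and "convex C"
    and F: "\<And>f. f \<in> F \<Longrightarrow> dominated_by M m f" "\<And>f. f \<in> F \<Longrightarrow> (\<integral>t. f t \<bullet> \<psi> t \<partial>M) \<in> C"
  shows "(\<integral>t. g t \<bullet> \<psi> t \<partial>M) \<in> C"
  using assms(1)
proof induction
  case (mid f g)
  have i: "integrable M (\<lambda>t. f t \<bullet> \<psi> t)" "integrable M (\<lambda>t. g t \<bullet> \<psi> t)"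
    using midpoint_closure_dominated[OF mid(1) F(1)] midpoint_closure_dominated[OF mid(2) F(1)]
    by (auto intro!: Linf_pairing_integrable[OF assms(2) _ assms(3)])
  have "(\<integral>t. (1/2) *\<^sub>R (f t + g t) \<bullet> \<psi> t \<partial>M)
     = (1/2) *\<^sub>R (\<integral>t. f t \<bullet> \<psi> t \<partial>M) + (1/2) *\<^sub>R (\<integral>t. g t \<bullet> \<psi> t \<partial>M)"
    using i by (simp add: inner_add_left add_divide_distrib)
  also have "\<dots> \<in> C"
    by (rule convexD[OF \<open>convex C\<close> mid(3,4)]) auto
  finally show ?case .
qed (rule F)

text \<open>
  An almost everywhere limit of midpoints of later and later members of a sequence inherits
  every limit of \<open>L\<^sup>\<infinity>\<close> pairings: each pairing of a midpoint lies in any ball that contains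
  the pairings of the tail.
\<close>
lemma pairing_tendsto_of_midpoints:
  assumes m: "integrable M m" and \<psi>: "Linf M \<psi>" and f: "\<And>k. dominated_by M m (f k)"
    and g: "\<And>n. g n \<in> midpoint_closure (f ` {n..})"
    and h: "h \<in> borel_measurable M" "AE t in M. (\<lambda>n. g n t) \<longlonglongrightarrow> h t"
    and l: "(\<lambda>k. \<integral>t. f k t \<bullet> \<psi> t \<partial>M) \<longlonglongrightarrow> l"
  shows "(\<integral>t. h t \<bullet> \<psi> t \<partial>M) = l"
proof -
  obtain K where K: "AE t in M. norm (\<psi> t) \<le> K" using \<psi> by (auto simp: Linf_def)
  have dg: "dominated_by M m (g n)" for n
    by (rule midpoint_closure_dominated[OF g]) (use f in auto)
  have [measurable]: "g n \<in> borel_measurable M" "\<psi> \<in> borel_measurable M" "h \<in> borel_measurable M" for n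
    using dg \<psi> h by (auto simp: dominated_by_def Linf_def)
  have "(\<lambda>n. \<integral>t. g n t \<bullet> \<psi> t \<partial>M) \<longlonglongrightarrow> (\<integral>t. h t \<bullet> \<psi> t \<partial>M)"
  proof (rule integral_dominated_convergence)
    show "integrable M (\<lambda>t. m t * K)" using m by simp
    show "AE t in M. (\<lambda>n. g n t \<bullet> \<psi> t) \<longlonglongrightarrow> h t \<bullet> \<psi> t"
      using h(2) by eventually_elim (auto intro: tendsto_intros)
    fix n
    show "AE t in M. norm (g n t \<bullet> \<psi> t) \<le> m t * K" by (rule dominated_pairing_le[OF dg K])
  qed auto
  moreover have "(\<lambda>n. \<integral>t. g n t \<bullet> \<psi> t \<partial>M) \<longlonglongrightarrow> l"
  proof (rule metric_LIMSEQ_I)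
    fix e :: real assume "e > 0"
    then obtain N where N: "\<And>k. k \<ge> N \<Longrightarrow> (\<integral>t. f k t \<bullet> \<psi> t \<partial>M) \<in> ball l e"
      using metric_LIMSEQ_D[OF l] by (auto simp: dist_commute)
    have "(\<integral>t. g n t \<bullet> \<psi> t \<partial>M) \<in> ball l e" if "n \<ge> N" for n
      using g[of n] m \<psi> by (rule midpoint_closure_pairing) (use f N that in auto)
    then show "\<exists>N. \<forall>n\<ge>N. dist (\<integral>t. g n t \<bullet> \<psi> t \<partial>M) l < e"
      by (auto simp: dist_commute)
  qed
  ultimately show ?thesis by (rule LIMSEQ_unique)
qed

lemma weighted_square_integrable:
  assumes m: "integrable M m" "\<And>t. m t > 0" and g: "dominated_by M (\<lambda>t. c * m t) g"
  shows "integrable M (\<lambda>t. (norm (g t))\<^sup>2 / m t)"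
proof (rule Bochner_Integration.integrable_bound)
  have [measurable]: "g \<in> borel_measurable M" "m \<in> borel_measurable M"
    using g m by (auto simp: dominated_by_def)
  show "integrable M (\<lambda>t. c\<^sup>2 * m t)" using m by simp
  have "AE t in M. norm (g t) \<le> c * m t" using g by (auto simp: dominated_by_def)
  then show "AE t in M. norm ((norm (g t))\<^sup>2 / m t) \<le> norm (c\<^sup>2 * m t)"
  proof eventually_elim
    case (elim t)
    have "(norm (g t))\<^sup>2 \<le> (c * m t)\<^sup>2" using elim by (intro power_mono) auto
    then show ?case using m(2)[of t]
      by (simp add: field_simps power2_eq_square abs_mult)
  qed
  show "(\<lambda>t. (norm (g t))\<^sup>2 / m t) \<in> borel_measurable M" by measurable
qed

lemma weighted_square_le:
  assumes m: "integrable M m" "\<And>t. m t > 0" and g: "dominated_by M m g"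
  shows "(\<integral>t. (norm (g t))\<^sup>2 / m t \<partial>M) \<le> (\<integral>t. m t \<partial>M)"
proof (rule integral_mono_AE)
  show "integrable M (\<lambda>t. (norm (g t))\<^sup>2 / m t)"
    using weighted_square_integrable[of M m 1 g] m g by simp
  have "AE t in M. norm (g t) \<le> m t" using g by (auto simp: dominated_by_def)
  then show "AE t in M. (norm (g t))\<^sup>2 / m t \<le> m t"
  proof eventually_elim
    case (elim t)
    have "(norm (g t))\<^sup>2 \<le> (m t)\<^sup>2" using elim by (intro power_mono) auto
    then show ?case using m(2)[of t] by (simp add: field_simps power2_eq_square)
  qed
qed (rule m)

text \<open>
  Control of the \<open>L\<^sup>1\<close> norm by the weighted square integral, pointwise from
  \<open>y \<le> s m + y\<^sup>2 / (s m)\<close>; the free parameter \<open>s\<close> replaces the Cauchy--Schwarz inequality.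
\<close>
lemma L1_norm_le_weighted_square:
  fixes s :: real
  assumes m: "integrable M m" "\<And>t. m t > 0" and g: "dominated_by M (\<lambda>t. c * m t) g" and "s > 0"
  shows "(\<integral>t. norm (g t) \<partial>M) \<le> s * (\<integral>t. m t \<partial>M) + (\<integral>t. (norm (g t))\<^sup>2 / m t \<partial>M) / s"
proof -
  have [measurable]: "g \<in> borel_measurable M" "m \<in> borel_measurable M"
    using g m by (auto simp: dominated_by_def)
  have i: "integrable M (\<lambda>t. (norm (g t))\<^sup>2 / m t)" by (rule weighted_square_integrable[OF m g])
  have ig: "integrable M (\<lambda>t. norm (g t))"
  proof (rule Bochner_Integration.integrable_bound)
    show "integrable M (\<lambda>t. c * m t)" using m by simp
    show "AE t in M. norm (norm (g t)) \<le> norm (c * m t)"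
      using g by (auto simp: dominated_by_def elim: eventually_mono)
  qed simp
  have "(\<integral>t. norm (g t) \<partial>M) \<le> (\<integral>t. s * m t + ((norm (g t))\<^sup>2 / m t) / s \<partial>M)"
  proof (rule integral_mono[OF ig])
    show "integrable M (\<lambda>t. s * m t + ((norm (g t))\<^sup>2 / m t) / s)"
      using m(1) i by (intro Bochner_Integration.integrable_add integrable_mult_right integrable_divide)
    fix t
    have sm: "s * m t > 0" using m(2)[of t] \<open>s > 0\<close> by simp
    show "norm (g t) \<le> s * m t + ((norm (g t))\<^sup>2 / m t) / s"
    proof (cases "norm (g t) \<le> s * m t")
      case True
      moreover have "((norm (g t))\<^sup>2 / m t) / s \<ge> 0" using m(2)[of t] \<open>s > 0\<close> by simp
      ultimately show ?thesis by linarith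
    next
      case False
      then have "norm (g t) * (s * m t) \<le> norm (g t) * norm (g t)" by (intro mult_left_mono) auto
      then have "norm (g t) \<le> ((norm (g t))\<^sup>2 / m t) / s"
        using sm by (simp add: power2_eq_square pos_le_divide_eq mult.commute)
      then show ?thesis using sm by linarith
    qed
  qed
  also have "\<dots> = s * (\<integral>t. m t \<partial>M) + (\<integral>t. (norm (g t))\<^sup>2 / m t \<partial>M) / s"
    using m(1) i by (subst Bochner_Integration.integral_add) (auto simp del: divide_divide_eq_left)
  finally show ?thesis .
qed

text \<open>
  Minimise the square norm with weight \<open>1 / m\<close> over the midpoint closures of the tails. The
  minimal values increase with the tail and are bounded by the integral of \<open>m\<close>, so by the
  parallelogram identity near-minimisers form a Cauchy sequence, first for the weighted square norm,
  then in \<open>L\<^sup>1\<close>, and finally almost everywhere along a subsequence. This is Mazur's lemma with the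
  weak limit constructed on the way.
\<close>
lemma midpoints_converge_AE:
  fixes f :: "nat \<Rightarrow> 't \<Rightarrow> 'a::euclidean_space"
  assumes m: "integrable M m" "\<And>t. m t > 0" and f: "\<And>k. dominated_by M m (f k)"
  obtains g h where "\<And>n. g n \<in> midpoint_closure (f ` {n..})" "dominated_by M m h"
    "AE t in M. (\<lambda>n. g n t) \<longlonglongrightarrow> h t"
proof -
  define \<Phi> where "\<Phi> g = (\<integral>t. (norm (g t))\<^sup>2 / m t \<partial>M)" for g :: "'t \<Rightarrow> 'a"
  define C where "C n = midpoint_closure (f ` {n..})" for n
  define c where "c n = (INF g\<in>C n. \<Phi> g)" for n
  have Cne: "f n \<in> C n" for n unfolding C_def by (auto intro: midpoint_closure.base)
  have Cmono: "C l \<subseteq> C n" if "n \<le> l" for n l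
    unfolding C_def using that by (auto intro!: midpoint_closure_mono[where F = "f ` {l..}"])
  have Cdom: "dominated_by M m g" if "g \<in> C n" for g n
    by (rule midpoint_closure_dominated[OF that[unfolded C_def]]) (use f in auto)
  have \<Phi>0: "\<Phi> g \<ge> 0" for g
    unfolding \<Phi>_def using m(2) by (intro integral_nonneg_AE) (auto simp: less_imp_le)
  have bdd: "bdd_below (\<Phi> ` C n)" for n using \<Phi>0 by (intro bdd_belowI[of _ 0]) auto
  have c_le: "c n \<le> \<Phi> g" if "g \<in> C n" for n g
    unfolding c_def using bdd that by (rule cINF_lower)
  have cmono: "c n \<le> c l" if "n \<le> l" for n l
    unfolding c_def using bdd Cmono[OF that] Cne by (intro cINF_superset_mono) auto
  have cbound: "c n \<le> (\<integral>t. m t \<partial>M)" for n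
    using c_le[OF Cne] weighted_square_le[OF m f] unfolding \<Phi>_def by (rule order_trans)
  have cC: "Cauchy c"
    using incseq_convergent[of c] cmono cbound by (metis LIMSEQ_imp_Cauchy incseq_def)
  have "\<exists>g\<in>C n. \<Phi> g < c n + 1 / real (Suc n)" for n
  proof -
    have "c n < c n + 1 / real (Suc n)" by simp
    then show ?thesis unfolding c_def using cINF_less_iff[OF _ bdd] Cne by blast
  qed
  then obtain g where gC: "\<And>n. g n \<in> C n" and g\<Phi>: "\<And>n. \<Phi> (g n) < c n + 1 / real (Suc n)" by metis
  have [measurable]: "g n \<in> borel_measurable M" for n
    using Cdom[OF gC] by (simp add: dominated_by_def)
  have ddom: "dominated_by M (\<lambda>t. 2 * m t) (\<lambda>t. g n t - g l t)" for n l
  proof -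
    have "AE t in M. norm (g n t) \<le> m t" "AE t in M. norm (g l t) \<le> m t"
      using Cdom[OF gC] by (auto simp: dominated_by_def)
    then have "AE t in M. norm (g n t - g l t) \<le> 2 * m t"
    proof eventually_elim
      case (elim t)
      then show ?case using norm_triangle_ineq4[of "g n t" "g l t"] by simp
    qed
    then show ?thesis by (simp add: dominated_by_def)
  qed
  have int1: "integrable M (\<lambda>t. (norm (h t))\<^sup>2 / m t)" if "dominated_by M m h" for h :: "'t \<Rightarrow> 'a"
    using weighted_square_integrable[OF m, of 1 h] that by simp
  have par: "\<Phi> (\<lambda>t. g n t - g l t) \<le> 2 * (c l - c n) + 4 / real (Suc n)" if "n \<le> l" for n l
  proof -
    define w where "w t = (1/2) *\<^sub>R (g n t + g l t)" for t
    have wC: "w \<in> C n" unfolding w_def using gC[of n] gC[of l] Cmono[OF that]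
      by (auto simp: C_def intro: midpoint_closure.mid)
    have "(norm (g n t - g l t))\<^sup>2 = 2 * (norm (g n t))\<^sup>2 + 2 * (norm (g l t))\<^sup>2 - 4 * (norm (w t))\<^sup>2" for t
      unfolding w_def by (simp add: power2_norm_eq_inner inner_add inner_diff inner_commute algebra_simps)
    then have "\<Phi> (\<lambda>t. g n t - g l t) = (\<integral>t. 2 * ((norm (g n t))\<^sup>2 / m t) + 2 * ((norm (g l t))\<^sup>2 / m t)
        - 4 * ((norm (w t))\<^sup>2 / m t) \<partial>M)"
      unfolding \<Phi>_def by (simp add: add_divide_distrib diff_divide_distrib)
    also have "\<dots> = 2 * \<Phi> (g n) + 2 * \<Phi> (g l) - 4 * \<Phi> w"
    proof -
      have "(\<integral>t. 2 * a t + 2 * b t - 4 * c t \<partial>M)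
          = 2 * (\<integral>t. a t \<partial>M) + 2 * (\<integral>t. b t \<partial>M) - 4 * (\<integral>t. c t \<partial>M)"
        if "integrable M a" "integrable M b" "integrable M c" for a b c :: "'t \<Rightarrow> real"
        using that by simp
      from this[OF int1[OF Cdom[OF gC[of n]]] int1[OF Cdom[OF gC[of l]]] int1[OF Cdom[OF wC]]]
      show ?thesis unfolding \<Phi>_def .
    qed
    also have "\<dots> \<le> 2 * (c n + 1 / real (Suc n)) + 2 * (c l + 1 / real (Suc n)) - 4 * c n"
    proof -
      have "1 / real (Suc l) \<le> 1 / real (Suc n)" using that by (simp add: frac_le)
      moreover define a b where "a = 1 / real (Suc n)" and "b = 1 / real (Suc l)"
      ultimately show ?thesis
        using g\<Phi>[of n] g\<Phi>[of l] c_le[OF wC] unfolding a_def[symmetric] b_def[symmetric] by argo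
    qed
    finally show ?thesis by (simp add: algebra_simps)
  qed
  define A where "A = (\<integral>t. m t \<partial>M)"
  have A0: "A \<ge> 0" unfolding A_def using m(2) by (intro integral_nonneg_AE) (auto simp: less_imp_le)
  have cau: "\<exists>N. \<forall>i\<ge>N. \<forall>j\<ge>N. (\<integral>t. norm (g i t - g j t) \<partial>M) < e" if "e > 0" for e
  proof -
    define s where "s = e / (2 * (A + 1))"
    have s: "s > 0" "s * A < e / 2"
      using that A0 by (auto simp: s_def field_simps add_pos_nonneg)
    have se: "s * e / 8 > 0" using s that by simp
    obtain N1 where N1: "\<And>i j. i \<ge> N1 \<Longrightarrow> j \<ge> N1 \<Longrightarrow> \<bar>c i - c j\<bar> < s * e / 8"
      using cC se unfolding Cauchy_def dist_real_def by blast
    obtain N2 where N2: "1 / real (Suc N2) < s * e / 16" using nat_approx_posE[of "s * e / 16"] se by auto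
    have *: "(\<integral>t. norm (g i t - g j t) \<partial>M) < e" if "i \<ge> max N1 N2" "i \<le> j" for i j
    proof -
      have "1 / real (Suc i) \<le> 1 / real (Suc N2)" using that by (simp add: frac_le)
      then have "4 * (1 / real (Suc i)) < 4 * (s * e / 16)" using N2 by (intro mult_strict_left_mono) auto
      then have "4 / real (Suc i) < s * e / 4" by (simp add: mult.commute)
      moreover have "2 * (c j - c i) < s * e / 4"
      proof -
        have "\<bar>c j - c i\<bar> < s * e / 8" using that by (intro N1) auto
        then have "c j - c i < s * e / 8" by (rule le_less_trans[OF abs_ge_self])
        then have "2 * (c j - c i) < 2 * (s * e / 8)" by (intro mult_strict_left_mono) auto
        also have "2 * (s * e / 8) = s * e / 4" by simp
        finally show ?thesis .
      qed
      ultimately have "\<Phi> (\<lambda>t. g i t - g j t) < s * e / 2" using par[OF that(2)] by linarith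
      then have "\<Phi> (\<lambda>t. g i t - g j t) / s < e / 2" using s by (simp add: field_simps)
      moreover have "(\<integral>t. norm (g i t - g j t) \<partial>M) \<le> s * A + \<Phi> (\<lambda>t. g i t - g j t) / s"
        unfolding A_def \<Phi>_def by (rule L1_norm_le_weighted_square[OF m ddom s(1)])
      ultimately show ?thesis using s(2) by linarith
    qed
    have "(\<integral>t. norm (g i t - g j t) \<partial>M) < e" if "i \<ge> max N1 N2" "j \<ge> max N1 N2" for i j
      using *[of i j] *[of j i] that by (cases "i \<le> j") (auto simp: norm_minus_commute)
    then show ?thesis by blast
  qed
  have "integrable M (g n)" for n
    by (rule Bochner_Integration.integrable_bound[OF m(1)])
      (use Cdom[OF gC[of n]] in \<open>auto simp: dominated_by_def elim!: eventually_mono\<close>)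
  then obtain r where r: "strict_mono r" and rC: "AE t in M. Cauchy (\<lambda>i. g (r i) t)"
    using cauchy_L1_AE_cauchy_subseq[of M g] cau by blast
  define h where "h t = lim (\<lambda>i. g (r i) t)" for t
  have hlim: "AE t in M. (\<lambda>i. g (r i) t) \<longlonglongrightarrow> h t"
    using rC by eventually_elim (simp add: h_def Cauchy_convergent convergent_LIMSEQ_iff[symmetric])
  have [measurable]: "h \<in> borel_measurable M" unfolding h_def by measurable
  have "AE t in M. \<forall>i. norm (g (r i) t) \<le> m t"
    using Cdom[OF gC] by (auto simp: dominated_by_def AE_all_countable)
  with hlim have "AE t in M. norm (h t) \<le> m t"
  proof eventually_elim
    case (elim t)
    then show ?case by (intro Lim_bounded[OF tendsto_norm[OF elim(1)]]) auto
  qed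
  then have "dominated_by M m h" by (simp add: dominated_by_def)
  moreover have "g (r n) \<in> midpoint_closure (f ` {n..})" for n
    using gC[of "r n"] Cmono[of n "r n"] seq_suble[OF r, of n] by (auto simp: C_def)
  ultimately show thesis using hlim that[of "\<lambda>n. g (r n)" h] by blast
qed

text \<open>
  The Dunford--Pettis theorem for dominated sequences, with Mazur's lemma built in. Along a
  diagonal subsequence the weighted inner products with every member \<open>f j\<close> converge. Any limit of
  late midpoints of any further subsequence then has these same inner products, and such a limit is
  itself approximated by midpoints of the \<open>f j\<close>; hence two such limits have difference orthogonal to
  itself and coincide. If some \<open>L\<^sup>\<infinity>\<close> pairing failed to converge to that of this unique limit,
  a further subsequence would produce another one.
\<close>
lemma dominated_weak_compactness:
  fixes f :: "nat \<Rightarrow> 't \<Rightarrow> 'a::euclidean_space"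
  assumes m: "integrable M m" "\<And>t. m t > 0" and f: "\<And>k. dominated_by M m (f k)"
  obtains s h where "strict_mono (s :: nat \<Rightarrow> nat)" "weak_L1_tendsto M (\<lambda>k. f (s k)) h"
    "AE t in M. \<forall>n. h t \<in> closure (convex hull {f (s k) t |k. k \<ge> n})"
proof -
  have fm[measurable]: "f k \<in> borel_measurable M" for k using f by (simp add: dominated_by_def)
  have mm[measurable]: "m \<in> borel_measurable M" using m by auto
  define \<psi> where "\<psi> j t = (1 / m t) *\<^sub>R f j t" for j t
  have \<psi>L: "Linf M (\<psi> j)" for j
  proof -
    have "AE t in M. norm (f j t) \<le> m t" using f by (simp add: dominated_by_def)
    then have "AE t in M. norm (\<psi> j t) \<le> 1"
      by eventually_elim (use m(2) in \<open>simp add: \<psi>_def field_simps abs_of_pos\<close>)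
    moreover have "\<psi> j \<in> borel_measurable M" unfolding \<psi>_def by measurable
    ultimately show ?thesis by (auto simp: Linf_def)
  qed
  have pair_bd: "\<exists>B. \<forall>g. dominated_by M m g \<longrightarrow> norm (\<integral>t. g t \<bullet> \<phi> t \<partial>M) \<le> B" if \<phi>: "Linf M \<phi>"
    for \<phi> :: "'t \<Rightarrow> 'a"
  proof -
    obtain K where K: "AE t in M. norm (\<phi> t) \<le> K" using \<phi> by (auto simp: Linf_def)
    have "norm (\<integral>t. g t \<bullet> \<phi> t \<partial>M) \<le> (\<integral>t. m t * K \<partial>M)" if g: "dominated_by M m g" for g
    proof -
      have "integrable M (\<lambda>t. g t \<bullet> \<phi> t)" by (rule Linf_pairing_integrable[OF m(1) g \<phi>])
      then have "(\<integral>t. norm (g t \<bullet> \<phi> t) \<partial>M) \<le> (\<integral>t. m t * K \<partial>M)"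
        using m(1) dominated_pairing_le[OF g K] by (intro integral_mono_AE) auto
      then show ?thesis using integral_norm_bound[of M "\<lambda>t. g t \<bullet> \<phi> t"] by linarith
    qed
    then show ?thesis by blast
  qed
  have "\<exists>B. \<forall>k. norm (\<integral>t. f k t \<bullet> \<psi> j t \<partial>M) \<le> B" for j
    using pair_bd[OF \<psi>L[of j]] f by blast
  then obtain B where B: "\<And>j k. norm (\<integral>t. f k t \<bullet> \<psi> j t \<partial>M) \<le> B j" by metis
  obtain s where s: "strict_mono s"
    and sl: "\<And>j. \<exists>l. (\<lambda>k. (\<integral>t. f (s k) t \<bullet> \<psi> j t \<partial>M) / (1 + \<bar>B j\<bar>)) \<longlonglongrightarrow> l"
  proof (rule function_convergent_subsequence[of UNIV "\<lambda>k j. (\<integral>t. f k t \<bullet> \<psi> j t \<partial>M) / (1 + \<bar>B j\<bar>)" 1])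
    show "norm ((\<integral>t. f k t \<bullet> \<psi> j t \<partial>M) / (1 + \<bar>B j\<bar>)) \<le> 1" for k j
    proof -
      have "0 < 1 + \<bar>B j\<bar>" "norm (\<integral>t. f k t \<bullet> \<psi> j t \<partial>M) \<le> 1 + \<bar>B j\<bar>" using B[of k j] by auto
      then show ?thesis by (simp only: norm_divide real_norm_def abs_of_pos divide_le_eq) simp
    qed
  qed (auto intro: that)
  have "\<exists>l. (\<lambda>k. \<integral>t. f (s k) t \<bullet> \<psi> j t \<partial>M) \<longlonglongrightarrow> l" for j
  proof -
    obtain l where "(\<lambda>k. (\<integral>t. f (s k) t \<bullet> \<psi> j t \<partial>M) / (1 + \<bar>B j\<bar>)) \<longlonglongrightarrow> l" using sl by blast
    from tendsto_mult_right[OF this, of "1 + \<bar>B j\<bar>"] show ?thesis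
      by (auto simp: add_nonneg_eq_0_iff)
  qed
  then obtain l where l: "\<And>j. (\<lambda>k. \<integral>t. f (s k) t \<bullet> \<psi> j t \<partial>M) \<longlonglongrightarrow> l j" by metis
  obtain g h where g: "\<And>n. g n \<in> midpoint_closure ((\<lambda>k. f (s k)) ` {n..})" and h: "dominated_by M m h"
    and gh: "AE t in M. (\<lambda>n. g n t) \<longlonglongrightarrow> h t"
    by (rule midpoints_converge_AE[OF m, of "\<lambda>k. f (s k)"]) (use f in auto)
  have hm: "h \<in> borel_measurable M" using h by (simp add: dominated_by_def)
  have hl: "(\<integral>t. h t \<bullet> \<psi> j t \<partial>M) = l j" for j
    by (rule pairing_tendsto_of_midpoints[OF m(1) \<psi>L f g hm gh l])
  have unique: "AE t in M. h' t = h t"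
    if \<rho>: "strict_mono \<rho>" and g': "\<And>n. g' n \<in> midpoint_closure ((\<lambda>k. f (s (\<rho> k))) ` {n..})"
      and h': "dominated_by M m h'" and gh': "AE t in M. (\<lambda>n. g' n t) \<longlonglongrightarrow> h' t"
    for \<rho> :: "nat \<Rightarrow> nat" and g' h'
  proof -
    have h'm: "h' \<in> borel_measurable M" using h' by (simp add: dominated_by_def)
    have l': "(\<lambda>k. \<integral>t. f (s (\<rho> k)) t \<bullet> \<psi> j t \<partial>M) \<longlonglongrightarrow> l j" for j
      using LIMSEQ_subseq_LIMSEQ[OF l \<rho>] by (simp add: o_def)
    have h'l: "(\<integral>t. h' t \<bullet> \<psi> j t \<partial>M) = l j" for j
      by (rule pairing_tendsto_of_midpoints[OF m(1) \<psi>L f g' h'm gh' l'])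
    define d where "d t = (1 / m t) *\<^sub>R (h t - h' t)" for t
    have dL: "Linf M d"
    proof -
      have "AE t in M. norm (h t) \<le> m t" "AE t in M. norm (h' t) \<le> m t"
        using h h' by (auto simp: dominated_by_def)
      then have "AE t in M. norm (d t) \<le> 2"
      proof eventually_elim
        case (elim t)
        have "norm (h t - h' t) \<le> 2 * m t" using elim norm_triangle_ineq4[of "h t" "h' t"] by linarith
        then show ?case using m(2)[of t] by (simp add: d_def divide_le_eq)
      qed
      moreover have "d \<in> borel_measurable M" unfolding d_def using hm h'm by measurable
      ultimately show ?thesis by (auto simp: Linf_def)
    qed
    have "(\<integral>t. f j t \<bullet> d t \<partial>M) = 0" for j
    proof -
      have "(\<integral>t. f j t \<bullet> d t \<partial>M) = (\<integral>t. h t \<bullet> \<psi> j t - h' t \<bullet> \<psi> j t \<partial>M)"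
        by (simp add: d_def \<psi>_def inner_commute inner_diff_right diff_divide_distrib)
      also have "\<dots> = 0"
        using hl h'l by (simp add: Linf_pairing_integrable[OF m(1) h \<psi>L] Linf_pairing_integrable[OF m(1) h' \<psi>L])
      finally show ?thesis .
    qed
    then have z: "(\<lambda>k. \<integral>t. f (r k) t \<bullet> d t \<partial>M) \<longlonglongrightarrow> 0" for r by simp
    have hd: "(\<integral>t. h t \<bullet> d t \<partial>M) = 0" "(\<integral>t. h' t \<bullet> d t \<partial>M) = 0"
      using pairing_tendsto_of_midpoints[OF m(1) dL f g hm gh z]
        pairing_tendsto_of_midpoints[OF m(1) dL f g' h'm gh' z] by auto
    have i: "integrable M (\<lambda>t. (h t - h' t) \<bullet> d t)"
      using Linf_pairing_integrable[OF m(1) h dL] Linf_pairing_integrable[OF m(1) h' dL]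
      by (simp add: inner_diff_left)
    have "(\<integral>t. (h t - h' t) \<bullet> d t \<partial>M) = 0"
      using hd Linf_pairing_integrable[OF m(1) h dL] Linf_pairing_integrable[OF m(1) h' dL]
      by (simp add: inner_diff_left)
    moreover have "(h t - h' t) \<bullet> d t = (norm (h t - h' t))\<^sup>2 / m t" for t
      by (simp add: d_def power2_norm_eq_inner)
    ultimately have "AE t in M. (norm (h t - h' t))\<^sup>2 / m t = 0"
      using integral_nonneg_eq_0_iff_AE[of M "\<lambda>t. (norm (h t - h' t))\<^sup>2 / m t"] i m(2)
      by (auto simp: less_imp_le)
    then show ?thesis by eventually_elim (use m(2) in \<open>auto simp: less_imp_neq[symmetric]\<close>)
  qed
  have weak: "(\<lambda>k. \<integral>t. f (s k) t \<bullet> \<phi> t \<partial>M) \<longlonglongrightarrow> (\<integral>t. h t \<bullet> \<phi> t \<partial>M)" if \<phi>: "Linf M \<phi>" for \<phi>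
  proof (rule ccontr)
    define X where "X k = (\<integral>t. f (s k) t \<bullet> \<phi> t \<partial>M)" for k
    define L where "L = (\<integral>t. h t \<bullet> \<phi> t \<partial>M)"
    assume "\<not> ?thesis"
    then have "\<not> X \<longlonglongrightarrow> L" by (simp add: X_def[abs_def] L_def)
    then obtain e where e: "e > 0" "\<And>N. \<exists>n\<ge>N. dist (X n) L \<ge> e"
      unfolding lim_sequentially by (meson not_less)
    then have "\<exists>\<^sub>\<infinity>n. dist (X n) L \<ge> e" by (simp add: INFM_nat_le)
    then have "infinite {n. dist (X n) L \<ge> e}" by (simp add: INFM_iff_infinite)
    then obtain \<rho> :: "nat \<Rightarrow> nat" where \<rho>: "strict_mono \<rho>" "\<And>n. dist (X (\<rho> n)) L \<ge> e"
      using infinite_enumerate by blast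
    obtain K where "\<And>k. norm (X k) \<le> K" using pair_bd[OF \<phi>] f unfolding X_def by blast
    then have "bounded (range (X \<circ> \<rho>))" by (auto simp: bounded_iff)
    then obtain L' \<tau> where \<tau>: "strict_mono (\<tau> :: nat \<Rightarrow> nat)" "(X \<circ> \<rho> \<circ> \<tau>) \<longlonglongrightarrow> L'"
      using bounded_imp_convergent_subsequence by blast
    have \<rho>\<tau>: "strict_mono (\<rho> \<circ> \<tau>)" using \<rho> \<tau> by (simp add: strict_mono_o)
    obtain g' h' where g': "\<And>n. g' n \<in> midpoint_closure ((\<lambda>k. f (s ((\<rho> \<circ> \<tau>) k))) ` {n..})"
      and h': "dominated_by M m h'" and gh': "AE t in M. (\<lambda>n. g' n t) \<longlonglongrightarrow> h' t"
      by (rule midpoints_converge_AE[OF m, of "\<lambda>k. f (s ((\<rho> \<circ> \<tau>) k))"]) (use f in auto)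
    have h'm: "h' \<in> borel_measurable M" using h' by (simp add: dominated_by_def)
    have "(\<lambda>k. \<integral>t. f (s ((\<rho> \<circ> \<tau>) k)) t \<bullet> \<phi> t \<partial>M) \<longlonglongrightarrow> L'"
      using \<tau>(2) by (simp add: X_def o_def)
    then have "(\<integral>t. h' t \<bullet> \<phi> t \<partial>M) = L'"
      by (rule pairing_tendsto_of_midpoints[OF m(1) \<phi> f g' h'm gh'])
    moreover have "(\<integral>t. h' t \<bullet> \<phi> t \<partial>M) = L"
      unfolding L_def using unique[OF \<rho>\<tau> g' h' gh'] hm h'm \<phi>
      by (intro integral_cong_AE) (auto simp: Linf_def elim!: eventually_mono)
    ultimately have "(X \<circ> \<rho> \<circ> \<tau>) \<longlonglongrightarrow> L" using \<tau> by simp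
    then obtain n where "dist (X (\<rho> (\<tau> n))) L < e"
      using metric_LIMSEQ_D[of _ L e] e(1) by fastforce
    with \<rho>(2)[of "\<tau> n"] show False by simp
  qed
  have int: "integrable M w" if "dominated_by M m w" for w :: "'t \<Rightarrow> 'a"
    by (rule Bochner_Integration.integrable_bound[OF m(1)])
      (use that in \<open>auto simp: dominated_by_def elim!: eventually_mono\<close>)
  have "weak_L1_tendsto M (\<lambda>k. f (s k)) h"
    unfolding weak_L1_tendsto_def using weak int f h by auto
  moreover have "AE t in M. \<forall>n. h t \<in> closure (convex hull {f (s k) t |k. k \<ge> n})"
    using gh
  proof eventually_elim
    case (elim t)
    show ?case
    proof
      fix n
      have "g i t \<in> closure (convex hull {f (s k) t |k. k \<ge> n})" if "i \<ge> n" for i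
      proof (rule midpoint_closure_convex[OF g])
        show "convex (closure (convex hull {f (s k) t |k. k \<ge> n}))" by (simp add: convex_closure)
        fix w assume "w \<in> (\<lambda>k. f (s k)) ` {i..}"
        then show "w t \<in> closure (convex hull {f (s k) t |k. k \<ge> n})"
          using that by (auto intro!: subsetD[OF closure_subset] hull_inc)
      qed
      then show "h t \<in> closure (convex hull {f (s k) t |k. k \<ge> n})"
        by (intro Lim_in_closed_set[OF _ _ _ elim]) (auto simp: eventually_sequentially)
    qed
  qed
  ultimately show thesis using s that by blast
qed

section \<open>Stability of limiting subdifferentials\<close>

text \<open>
  A regular subgradient of a perturbed function is a subgradient of the original one only up
  to a fixed error \<open>e\<close>.
\<close>
definition eps_subgradient :: "real \<Rightarrow> ('a::euclidean_space \<Rightarrow> real) \<Rightarrow> 'a \<Rightarrow> 'a \<Rightarrow> bool" where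
  "eps_subgradient e h x v \<longleftrightarrow> (\<forall>\<^sub>F y in at x. h y \<ge> h x + v \<bullet> (y - x) - e * norm (y - x))"

lemma eps_subgradient_eventually_nhds:
  assumes "eps_subgradient e h x v"
  shows "\<forall>\<^sub>F y in nhds x. h y \<ge> h x + v \<bullet> (y - x) - e * norm (y - x)"
  using assms unfolding eps_subgradient_def eventually_at_filter
  by (rule eventually_mono) auto

lemma regular_subdiff_iff_eps:
  "v \<in> regular_subdiff h x \<longleftrightarrow> (\<forall>e>0. eps_subgradient e h x v)"
  by (simp add: regular_subdiff_def eps_subgradient_def)

text \<open>
  The function is a smooth majorant of the distance to \<open>y\<close> that is still 1-Lipschitz.
\<close>
lemma smoothed_norm_has_derivative:
  fixes y z :: "'a::euclidean_space"
  assumes "\<tau> > 0"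
  defines "D \<equiv> (1 / sqrt ((norm (z - y))\<^sup>2 + \<tau>\<^sup>2)) *\<^sub>R (z - y)"
  shows "((\<lambda>w. sqrt ((norm (w - y))\<^sup>2 + \<tau>\<^sup>2)) has_derivative (\<lambda>w. D \<bullet> w)) (at z)" and "norm D \<le> 1"
proof -
  have pos: "(norm (z - y))\<^sup>2 + \<tau>\<^sup>2 > 0" using assms by (simp add: add_nonneg_pos)
  have d: "((\<lambda>w. (norm (w - y))\<^sup>2 + \<tau>\<^sup>2) has_derivative (\<lambda>w. 2 * ((z - y) \<bullet> w))) (at z)"
    unfolding power2_norm_eq_inner by (auto intro!: derivative_eq_intros simp: inner_commute)
  define X where "X = (norm (z - y))\<^sup>2 + \<tau>\<^sup>2"
  have D: "D = (1 / sqrt X) *\<^sub>R (z - y)" by (simp only: D_def X_def)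
  have "(\<lambda>w. 2 * ((z - y) \<bullet> w) * (inverse (sqrt X) / 2)) = (\<lambda>w. D \<bullet> w)"
    unfolding D by (simp only: inner_scaleR_left divide_inverse) (simp add: mult.commute)
  with has_derivative_real_sqrt[OF pos d]
  show "((\<lambda>w. sqrt ((norm (w - y))\<^sup>2 + \<tau>\<^sup>2)) has_derivative (\<lambda>w. D \<bullet> w)) (at z)"
    by (simp only: X_def)
  have "norm (z - y) \<le> sqrt ((norm (z - y))\<^sup>2 + \<tau>\<^sup>2)" by (rule real_le_rsqrt) auto
  then show "norm D \<le> 1" using pos by (simp add: D_def divide_le_eq)
qed

lemma regular_subdiff_at_local_min:
  fixes h :: "'a::euclidean_space \<Rightarrow> real"
  assumes "open S" "x \<in> S" and min: "\<And>y. y \<in> S \<Longrightarrow> h x + \<theta> x \<le> h y + \<theta> y"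
    and d: "(\<theta> has_derivative (\<lambda>w. D \<bullet> w)) (at x)"
  shows "- D \<in> regular_subdiff h x"
  unfolding regular_subdiff_def mem_Collect_eq
proof (intro allI impI)
  fix e :: real assume "e > 0"
  have "\<forall>\<^sub>F y in at x. norm (\<theta> y - \<theta> x - D \<bullet> (y - x)) \<le> e * norm (y - x)"
    using d \<open>e > 0\<close> unfolding has_derivative_within_alt2 by blast
  moreover have "\<forall>\<^sub>F y in at x. y \<in> S" using assms(1,2) by (rule eventually_at_in_open')
  ultimately show "\<forall>\<^sub>F y in at x. h y \<ge> h x + - D \<bullet> (y - x) - e * norm (y - x)"
  proof eventually_elim
    case (elim y)
    then show ?case using min[of y] by (simp add: inner_minus_left)
  qed
qed

text \<open>
  The function \<open>h - v \<bullet> (\<cdot> - y)\<close> decreases away from \<open>y\<close> at rate at most \<open>e\<close>, so adding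
  \<open>2 e\<close> times a smoothed distance forces a minimum over a small ball into its interior. There the
  smooth penalty yields an exact regular subgradient that differs from \<open>v\<close> by the gradient of the
  penalty, of norm at most \<open>2 e\<close>.
\<close>
lemma eps_subgradient_approximated:
  fixes h :: "'a::euclidean_space \<Rightarrow> real"
  assumes v: "eps_subgradient e h y v" and "e > 0" "\<rho> > 0" and cont: "continuous_on (ball y \<rho>) h"
  obtains y' v' where "dist y' y < \<rho>" "v' \<in> regular_subdiff h y'" "norm (v' - v) \<le> 2 * e"
proof -
  obtain \<sigma> where \<sigma>: "\<sigma> > 0" "\<And>w. dist w y < \<sigma> \<Longrightarrow> h w \<ge> h y + v \<bullet> (w - y) - e * norm (w - y)"
    using eps_subgradient_eventually_nhds[OF v] unfolding eventually_nhds_metric by blast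
  define \<kappa> where "\<kappa> = min \<sigma> \<rho> / 2"
  have \<kappa>: "\<kappa> > 0" "\<kappa> < \<sigma>" "\<kappa> < \<rho>" using \<sigma>(1) \<open>\<rho> > 0\<close> by (auto simp: \<kappa>_def)
  define \<tau> where "\<tau> = \<kappa> / 4"
  have \<tau>: "\<tau> > 0" using \<kappa> by (simp add: \<tau>_def)
  define \<theta> where "\<theta> w = 2 * e * sqrt ((norm (w - y))\<^sup>2 + \<tau>\<^sup>2) - v \<bullet> (w - y)" for w
  have sub: "cball y \<kappa> \<subseteq> ball y \<rho>" using \<kappa> by auto
  have "continuous_on (cball y \<kappa>) (\<lambda>w. h w + \<theta> w)"
    unfolding \<theta>_def by (intro continuous_intros continuous_on_subset[OF cont sub])
  then obtain x where x: "x \<in> cball y \<kappa>" "\<And>w. w \<in> cball y \<kappa> \<Longrightarrow> h x + \<theta> x \<le> h w + \<theta> w"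
    using continuous_attains_inf[of "cball y \<kappa>" "\<lambda>w. h w + \<theta> w"] \<kappa> by fastforce
  have "dist x y < \<kappa>"
  proof (rule ccontr)
    assume "\<not> ?thesis"
    then have nx: "norm (x - y) = \<kappa>" using x(1) by (simp add: dist_norm norm_minus_commute)
    have "h x \<ge> h y + v \<bullet> (x - y) - e * \<kappa>" using \<sigma>(2)[of x] nx \<kappa> by (simp add: dist_norm)
    moreover have "\<theta> x \<ge> 2 * e * \<kappa> - v \<bullet> (x - y)"
    proof -
      have "\<kappa> \<le> sqrt ((norm (x - y))\<^sup>2 + \<tau>\<^sup>2)" using nx by (intro real_le_rsqrt) auto
      then have "2 * e * \<kappa> \<le> 2 * e * sqrt ((norm (x - y))\<^sup>2 + \<tau>\<^sup>2)" using \<open>e > 0\<close> by simp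
      then show ?thesis by (simp add: \<theta>_def)
    qed
    moreover have "\<theta> y = e * \<kappa> / 2" using \<tau> by (simp add: \<theta>_def \<tau>_def)
    moreover have "h x + \<theta> x \<le> h y + \<theta> y" using x(2)[of y] \<kappa> by simp
    ultimately have "e * \<kappa> \<le> e * \<kappa> / 2" by linarith
    moreover have "e * \<kappa> > 0" using \<open>e > 0\<close> \<kappa> by simp
    ultimately show False by linarith
  qed
  define D where "D = (1 / sqrt ((norm (x - y))\<^sup>2 + \<tau>\<^sup>2)) *\<^sub>R (x - y)"
  note sn = smoothed_norm_has_derivative[OF \<tau>, where y = y and z = x, folded D_def]
  have "(\<theta> has_derivative (\<lambda>w. ((2 * e) *\<^sub>R D - v) \<bullet> w)) (at x)"
  proof -
    have "((\<lambda>w. v \<bullet> (w - y)) has_derivative (\<lambda>w. v \<bullet> w)) (at x)"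
      by (auto intro!: derivative_eq_intros)
    from has_derivative_diff[OF has_derivative_mult_right[OF sn(1), of "2 * e"] this]
    show ?thesis unfolding \<theta>_def by (rule has_derivative_eq_rhs) (auto simp: inner_diff_left)
  qed
  then have "- ((2 * e) *\<^sub>R D - v) \<in> regular_subdiff h x"
    using \<open>dist x y < \<kappa>\<close> by (intro regular_subdiff_at_local_min[of "ball y \<kappa>" x h \<theta>] x(2)) (auto simp: dist_commute)
  moreover have "norm (- ((2 * e) *\<^sub>R D - v) - v) \<le> 2 * e"
    using sn(2) \<open>e > 0\<close> by (simp add: mult_left_le)
  ultimately show thesis using that[of x] \<open>dist x y < \<kappa>\<close> \<kappa> by auto
qed

text \<open>
  At a point of continuity the convergence of values in the definition of the limiting
  subdifferential is automatic.
\<close>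
lemma limiting_subdiffI:
  fixes h :: "'a::euclidean_space \<Rightarrow> real"
  assumes cont: "isCont h z"
    and ex: "\<And>e. e > 0 \<Longrightarrow> \<exists>y w. dist y z < e \<and> w \<in> regular_subdiff h y \<and> dist w v < e"
  shows "v \<in> limiting_subdiff h z"
proof -
  have "\<exists>y w. dist y z < 1 / real (Suc k) \<and> w \<in> regular_subdiff h y \<and> dist w v < 1 / real (Suc k)" for k
    by (rule ex) simp
  then obtain y w where yw: "\<And>k. dist (y k) z < 1 / real (Suc k)" "\<And>k. w k \<in> regular_subdiff h (y k)"
    "\<And>k. dist (w k) v < 1 / real (Suc k)" by metis
  have lim: "(\<lambda>k. 1 / real (Suc k)) \<longlonglongrightarrow> 0" by (rule lim_1_over_n[THEN LIMSEQ_Suc])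
  have "(\<lambda>k. dist (y k) z) \<longlonglongrightarrow> 0" "(\<lambda>k. dist (w k) v) \<longlonglongrightarrow> 0"
    by (rule real_tendsto_sandwich[OF _ _ tendsto_const lim]; use yw(1,3) in \<open>simp add: less_imp_le\<close>)+
  then have "y \<longlonglongrightarrow> z" "w \<longlonglongrightarrow> v" by (simp_all add: tendsto_dist_iff[symmetric])
  moreover have "(\<lambda>k. h (y k)) \<longlonglongrightarrow> h z"
    by (rule isCont_tendsto_compose[OF cont \<open>y \<longlonglongrightarrow> z\<close>])
  ultimately show ?thesis unfolding limiting_subdiff_def using yw(2) by blast
qed

text \<open>
  Closedness of the graph, also when the function varies: if \<open>hk k - h\<close> has a Lipschitz
  constant tending to zero, regular subgradients of \<open>hk k\<close> are \<open>\<epsilon>\<close>-subgradients of \<open>h\<close>, which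
  are replaced by exact ones nearby.
\<close>
lemma limiting_subdiff_closed_graph:
  fixes h :: "'a::euclidean_space \<Rightarrow> real"
  assumes "\<rho> > 0" and cont: "continuous_on (ball z \<rho>) h"
    and pert: "\<And>k y y'. y \<in> ball z \<rho> \<Longrightarrow> y' \<in> ball z \<rho> \<Longrightarrow>
        \<bar>(hk k y - h y) - (hk k y' - h y')\<bar> \<le> e k * norm (y - y')"
    and e: "e \<longlonglongrightarrow> 0" and z: "zk \<longlonglongrightarrow> z" and v: "vk \<longlonglongrightarrow> v"
    and vk: "\<And>k. vk k \<in> limiting_subdiff (hk k) (zk k)"
  shows "v \<in> limiting_subdiff h z"
proof (rule limiting_subdiffI)
  show "isCont h z" using cont \<open>\<rho> > 0\<close> by (simp add: continuous_on_eq_continuous_at)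
next
  fix d :: real assume "d > 0"
  define c where "c = min d \<rho> / 4"
  have c: "c > 0" "4 * c \<le> d" "4 * c \<le> \<rho>" using \<open>d > 0\<close> \<open>\<rho> > 0\<close> by (auto simp: c_def)
  have "\<forall>\<^sub>F k in sequentially. dist (zk k) z < c \<and> dist (vk k) v < c \<and> e k < c / 4"
    using tendstoD[OF z c(1)] tendstoD[OF v c(1)] order_tendstoD(2)[OF e, of "c / 4"] c(1)
    by (auto intro: eventually_conj)
  then obtain k where k: "dist (zk k) z < c" "dist (vk k) v < c" "e k < c / 4"
    by (auto simp: eventually_sequentially)
  obtain y w where yw: "\<And>i. w i \<in> regular_subdiff (hk k) (y i)" "y \<longlonglongrightarrow> zk k" "w \<longlonglongrightarrow> vk k"
    using vk[of k] unfolding limiting_subdiff_def by blast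
  have "\<forall>\<^sub>F i in sequentially. dist (y i) (zk k) < c \<and> dist (w i) (vk k) < c"
    using tendstoD[OF yw(2) c(1)] tendstoD[OF yw(3) c(1)] by (rule eventually_conj)
  then obtain i where i: "dist (y i) (zk k) < c" "dist (w i) (vk k) < c"
    by (auto simp: eventually_sequentially)
  have yz: "dist (y i) z < 2 * c" using dist_triangle[of "y i" z "zk k"] i k by simp
  have in_ball: "\<forall>\<^sub>F x in at (y i). x \<in> ball z \<rho>"
    using yz c by (intro eventually_at_in_open') (auto simp: dist_commute)
  have yb: "y i \<in> ball z \<rho>" using yz c by (simp add: dist_commute)
  have "eps_subgradient (c / 4) (hk k) (y i) (w i)"
    using yw(1)[of i] c(1) by (simp add: regular_subdiff_iff_eps)
  then have "eps_subgradient (c / 2) h (y i) (w i)"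
    unfolding eps_subgradient_def using in_ball
  proof eventually_elim
    case (elim x)
    have "(hk k x - h x) - (hk k (y i) - h (y i)) \<le> e k * norm (x - y i)"
      using pert[OF elim(2) yb, of k] by linarith
    also have "\<dots> \<le> c / 4 * norm (x - y i)" using k(3) by (intro mult_right_mono) auto
    finally show ?case using elim(1) by (simp add: field_simps)
  qed
  moreover have "continuous_on (ball (y i) c) h"
  proof (rule continuous_on_subset[OF cont])
    show "ball (y i) c \<subseteq> ball z \<rho>"
    proof
      fix x assume "x \<in> ball (y i) c"
      then show "x \<in> ball z \<rho>" using yz c dist_triangle[of x z "y i"] by (auto simp: dist_commute)
    qed
  qed
  ultimately obtain y' v' where y': "dist y' (y i) < c" "v' \<in> regular_subdiff h y'" "norm (v' - w i) \<le> 2 * (c / 2)"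
    using c(1) eps_subgradient_approximated[of "c / 2" h "y i" "w i" c] by auto
  have "dist y' z < d" using dist_triangle[of y' z "y i"] y'(1) yz c by linarith
  moreover have "dist v' v < d"
    using dist_triangle[of v' v "w i"] dist_triangle[of "w i" v "vk k"] y'(3) i(2) k(2) c
    by (simp add: dist_norm)
  ultimately show "\<exists>y w. dist y z < d \<and> w \<in> regular_subdiff h y \<and> dist w v < d" using y'(2) by blast
qed

text \<open>
  Move from \<open>x\<close> a short way in the direction of \<open>v\<close> itself.
\<close>
lemma regular_subdiff_norm_le:
  fixes h :: "'a::euclidean_space \<Rightarrow> real"
  assumes "open S" "x \<in> S" and lip: "\<And>y y'. y \<in> S \<Longrightarrow> y' \<in> S \<Longrightarrow> \<bar>h y - h y'\<bar> \<le> L * norm (y - y')"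
    and v: "v \<in> regular_subdiff h x"
  shows "norm v \<le> L"
proof (cases "v = 0")
  case True
  have "\<forall>\<^sub>F y in at x. y \<in> S" using assms(1,2) by (rule eventually_at_in_open')
  then have "\<exists>y. y \<noteq> x \<and> y \<in> S"
    using eventually_happens'[OF at_neq_bot, of "\<lambda>y. y \<noteq> x \<and> y \<in> S" x]
    by (auto simp: eventually_at_filter elim: eventually_mono)
  then obtain y where "y \<noteq> x" "y \<in> S" by blast
  then have "0 \<le> L * norm (y - x)" using lip[of y x] assms(2) by (meson abs_ge_zero order_trans)
  then show ?thesis using True \<open>y \<noteq> x\<close> by (simp add: zero_le_mult_iff)
next
  case False
  show ?thesis
  proof (rule field_le_epsilon)
    fix e :: real assume "e > 0"
    have "eps_subgradient e h x v" using v \<open>e > 0\<close> by (simp add: regular_subdiff_iff_eps)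
    then have "\<forall>\<^sub>F y in nhds x. h y \<ge> h x + v \<bullet> (y - x) - e * norm (y - x)"
      by (rule eps_subgradient_eventually_nhds)
    moreover have "\<forall>\<^sub>F y in nhds x. y \<in> S" using assms(1,2) by (rule eventually_nhds_in_open)
    ultimately have "\<forall>\<^sub>F y in nhds x. y \<in> S \<and> h y \<ge> h x + v \<bullet> (y - x) - e * norm (y - x)"
      by eventually_elim auto
    then obtain \<sigma> where \<sigma>: "\<sigma> > 0"
      "\<And>y. dist y x < \<sigma> \<Longrightarrow> y \<in> S \<and> h y \<ge> h x + v \<bullet> (y - x) - e * norm (y - x)"
      unfolding eventually_nhds_metric by blast
    define s where "s = \<sigma> / (2 * norm v)"
    have s: "s > 0" using \<sigma>(1) False by (simp add: s_def)
    define y where "y = x + s *\<^sub>R v"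
    have "dist y x < \<sigma>" using \<sigma>(1) False by (simp add: y_def dist_norm s_def)
    from \<sigma>(2)[OF this] have y: "y \<in> S" "h y \<ge> h x + v \<bullet> (y - x) - e * norm (y - x)" by auto
    have "v \<bullet> (y - x) = (s * norm v) * norm v" "norm (y - x) = s * norm v"
      using s by (auto simp: y_def power2_norm_eq_inner[symmetric] power2_eq_square)
    moreover have "h y - h x \<le> L * norm (y - x)" using lip[OF y(1) assms(2)] by linarith
    ultimately have "(s * norm v) * norm v \<le> (s * norm v) * (L + e)"
      using y(2) by (simp add: algebra_simps)
    moreover have "s * norm v > 0" using s False by simp
    ultimately show "norm v \<le> L + e" by (simp only: mult_le_cancel_left_pos)
  qed
qed

lemma limiting_subdiff_norm_le:
  fixes h :: "'a::euclidean_space \<Rightarrow> real"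
  assumes "open S" "x \<in> S" and lip: "\<And>y y'. y \<in> S \<Longrightarrow> y' \<in> S \<Longrightarrow> \<bar>h y - h y'\<bar> \<le> L * norm (y - y')"
    and v: "v \<in> limiting_subdiff h x"
  shows "norm v \<le> L"
proof -
  obtain y w where yw: "\<And>i. w i \<in> regular_subdiff h (y i)" "y \<longlonglongrightarrow> x" "w \<longlonglongrightarrow> v"
    using v unfolding limiting_subdiff_def by blast
  have "\<forall>\<^sub>F i in sequentially. y i \<in> S" using topological_tendstoD[OF yw(2) assms(1,2)] .
  then have "\<forall>\<^sub>F i in sequentially. norm (w i) \<le> L"
    by eventually_elim (rule regular_subdiff_norm_le[OF assms(1) _ lip yw(1)])
  then show ?thesis
    by (intro tendsto_upperbound[OF tendsto_norm[OF yw(3)]]) auto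
qed

text \<open>
  By boundedness and the closed graph, the subdifferentials of \<open>hk k\<close> at \<open>zk k\<close> eventually lie in any
  ball neighbourhood of the convex hull of the limiting one. Such a neighbourhood of a compact convex
  set is closed and convex, so it captures the closed convex hulls of the tails of \<open>vk\<close>; letting its
  radius tend to zero leaves the hull itself.
\<close>
lemma hull_subdiff_upper_semicontinuous:
  fixes h :: "'a::euclidean_space \<Rightarrow> real"
  assumes \<rho>: "\<rho> > 0" and cont: "continuous_on (ball z \<rho>) h"
    and pert: "\<And>k y y'. y \<in> ball z \<rho> \<Longrightarrow> y' \<in> ball z \<rho> \<Longrightarrow>
        \<bar>(hk k y - h y) - (hk k y' - h y')\<bar> \<le> e k * norm (y - y')"
    and e: "e \<longlonglongrightarrow> 0" and z: "zk \<longlonglongrightarrow> z"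
    and bd: "\<And>k v. v \<in> limiting_subdiff (hk k) (zk k) \<Longrightarrow> norm v \<le> R"
      "\<And>v. v \<in> limiting_subdiff h z \<Longrightarrow> norm v \<le> R"
    and vk: "\<And>k. vk k \<in> convex hull (limiting_subdiff (hk k) (zk k))"
    and v: "\<And>n. v \<in> closure (convex hull {vk k |k. k \<ge> n})"
  shows "v \<in> convex hull (limiting_subdiff h z)"
proof -
  define K where "K = limiting_subdiff h z"
  have "closed K"
    unfolding closed_sequential_limits K_def
  proof (intro allI impI, elim conjE)
    fix w l assume w: "\<forall>n. w n \<in> limiting_subdiff h z" and l: "w \<longlonglongrightarrow> l"
    show "l \<in> limiting_subdiff h z"
      by (rule limiting_subdiff_closed_graph[OF \<rho> cont, of "\<lambda>_. h" "\<lambda>_. 0" "\<lambda>_. z" w]) (use w l in auto)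
  qed
  moreover have "bounded K" unfolding bounded_iff K_def using bd(2) by blast
  ultimately have "compact K" by (simp add: compact_eq_bounded_closed)
  then have cK: "compact (convex hull K)" by (rule compact_convex_hull)
  have near: "\<exists>x\<in>convex hull K. dist x v \<le> d" if "d > 0" for d
  proof -
    define Kd where "Kd = {x + y |x y. x \<in> convex hull K \<and> y \<in> cball 0 d}"
    have convKd: "convex Kd" and closKd: "closed Kd"
    proof -
      have eq: "Kd = (\<Union>x\<in>convex hull K. \<Union>y\<in>cball 0 d. {x + y})" unfolding Kd_def by blast
      show "convex Kd" unfolding eq by (rule convex_sums) auto
      show "closed Kd" unfolding Kd_def using cK by (intro compact_imp_closed compact_sums) auto
    qed
    have "\<exists>n. \<forall>k\<ge>n. limiting_subdiff (hk k) (zk k) \<subseteq> Kd"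
    proof (rule ccontr)
      assume "\<not> ?thesis"
      then have "infinite {k. \<not> limiting_subdiff (hk k) (zk k) \<subseteq> Kd}"
        by (auto simp: INFM_iff_infinite[symmetric] INFM_nat_le)
      then obtain r :: "nat \<Rightarrow> nat" where r: "strict_mono r" "\<And>k. \<not> limiting_subdiff (hk (r k)) (zk (r k)) \<subseteq> Kd"
        using infinite_enumerate by blast
      then have "\<exists>w. w \<in> limiting_subdiff (hk (r k)) (zk (r k)) \<and> w \<notin> Kd" for k by blast
      then obtain w where w: "\<And>k. w k \<in> limiting_subdiff (hk (r k)) (zk (r k))" "\<And>k. w k \<notin> Kd" by metis
      have "bounded (range w)" using bd(1) w(1) by (auto simp: bounded_iff)
      then obtain l q where q: "strict_mono (q :: nat \<Rightarrow> nat)" "(w \<circ> q) \<longlonglongrightarrow> l"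
        using bounded_imp_convergent_subsequence by blast
      have rq: "strict_mono (r \<circ> q)" using r(1) q(1) by (rule strict_mono_o)
      have "l \<in> K" unfolding K_def
      proof (rule limiting_subdiff_closed_graph[OF \<rho> cont])
        show "(e \<circ> (r \<circ> q)) \<longlonglongrightarrow> 0" "(zk \<circ> (r \<circ> q)) \<longlonglongrightarrow> z"
          using rq e z by (auto intro: LIMSEQ_subseq_LIMSEQ)
        show "(w \<circ> q) \<longlonglongrightarrow> l" by (rule q)
        show "(w \<circ> q) k \<in> limiting_subdiff ((hk \<circ> (r \<circ> q)) k) ((zk \<circ> (r \<circ> q)) k)" for k
          using w(1) by simp
        fix k y y' assume "y \<in> ball z \<rho>" "y' \<in> ball z \<rho>"
        then show "\<bar>((hk \<circ> (r \<circ> q)) k y - h y) - ((hk \<circ> (r \<circ> q)) k y' - h y')\<bar> \<le> (e \<circ> (r \<circ> q)) k * norm (y - y')"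
          using pert by simp
      qed
      moreover obtain k where "dist (w (q k)) l < d"
        using metric_LIMSEQ_D[OF q(2) \<open>d > 0\<close>] by (auto simp: o_def)
      ultimately have "w (q k) \<in> Kd" unfolding Kd_def
        by (intro CollectI exI[of _ l] exI[of _ "w (q k) - l"]) (auto simp: dist_norm norm_minus_commute intro: hull_inc)
      with w(2) show False by blast
    qed
    then obtain n where n: "\<And>k. k \<ge> n \<Longrightarrow> limiting_subdiff (hk k) (zk k) \<subseteq> Kd" by blast
    have "vk k \<in> Kd" if "k \<ge> n" for k
      using vk[of k] hull_minimal[of _ Kd convex, OF n[OF that]] convKd by blast
    then have "closure (convex hull {vk k |k. k \<ge> n}) \<subseteq> Kd"
      using convKd closKd by (intro closure_minimal hull_minimal) auto
    then have "v \<in> Kd" using v by blast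
    then obtain x y where "v = x + y" "x \<in> convex hull K" "norm y \<le> d" by (auto simp: Kd_def)
    then show ?thesis by (intro bexI[of _ x]) (simp_all add: dist_norm)
  qed
  have "v \<in> closure (convex hull K)"
    unfolding closure_approachable
  proof (intro allI impI)
    fix d :: real assume "d > 0"
    then show "\<exists>y\<in>convex hull K. dist y v < d" using near[of "d / 2"] by force
  qed
  then show ?thesis using compact_imp_closed[OF cK] by (simp add: K_def closure_closed)
qed

section \<open>Smooth perturbations and measurability of gradients\<close>

lemma gradient_eqI:
  assumes "GDERIV h z :> D"
  shows "gradient h z = D"
  unfolding gradient_def
proof (rule the_equality[of "\<lambda>D. GDERIV h z :> D", OF assms])
  fix E assume "GDERIV h z :> E"
  with assms have "(\<lambda>w. w \<bullet> E) = (\<lambda>w. w \<bullet> D)"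
    unfolding gderiv_def by (rule has_derivative_unique[rotated])
  then have "w \<bullet> E = w \<bullet> D" for w by (rule fun_cong)
  then show "E = D" by (metis inner_commute vector_eq_ldot)
qed

lemma GDERIV_gradient:
  fixes h :: "'a::euclidean_space \<Rightarrow> real"
  assumes "(h has_derivative L) (at z)"
  shows "GDERIV h z :> gradient h z" and "w \<bullet> gradient h z = L w"
proof -
  define D where "D = (\<Sum>b\<in>Basis. L b *\<^sub>R b)"
  interpret L: bounded_linear L using assms by (rule has_derivative_bounded_linear)
  have D: "w \<bullet> D = L w" for w
  proof -
    have "L w = L (\<Sum>b\<in>Basis. (w \<bullet> b) *\<^sub>R b)" by (simp add: euclidean_representation)
    also have "\<dots> = (\<Sum>b\<in>Basis. (w \<bullet> b) * L b)" by (simp add: L.sum L.scaleR)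
    also have "\<dots> = w \<bullet> D" by (simp add: D_def inner_sum_right mult.commute)
    finally show ?thesis by simp
  qed
  then have "(\<lambda>w. w \<bullet> D) = L" by auto
  then have g: "GDERIV h z :> D" using assms by (simp add: gderiv_def)
  then have "gradient h z = D" by (rule gradient_eqI)
  with g D show "GDERIV h z :> gradient h z" "w \<bullet> gradient h z = L w" by auto
qed

lemma regular_subdiff_add_smooth:
  fixes h s :: "'a::euclidean_space \<Rightarrow> real"
  assumes v: "v \<in> regular_subdiff (\<lambda>w. h w + s w) y" and s: "GDERIV s y :> D"
  shows "v - D \<in> regular_subdiff h y"
  unfolding regular_subdiff_def mem_Collect_eq
proof (intro allI impI)
  fix e :: real assume "e > 0"
  then have "\<forall>\<^sub>F x in at y. norm (s x - s y - (x - y) \<bullet> D) \<le> e / 2 * norm (x - y)"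
    using s half_gt_zero[OF \<open>e > 0\<close>] unfolding gderiv_def has_derivative_within_alt2 by blast
  moreover have "\<forall>\<^sub>F x in at y. h x + s x \<ge> h y + s y + v \<bullet> (x - y) - e / 2 * norm (x - y)"
    using v half_gt_zero[OF \<open>e > 0\<close>] unfolding regular_subdiff_def by blast
  ultimately show "\<forall>\<^sub>F x in at y. h x \<ge> h y + (v - D) \<bullet> (x - y) - e * norm (x - y)"
  proof eventually_elim
    case (elim x)
    then show ?case using abs_ge_self[of "s x - s y - (x - y) \<bullet> D"]
      by (simp add: inner_diff_left inner_commute)
  qed
qed

text \<open>
  Sum rule: the gradient may be subtracted at each nearby point, and it converges because
  it is continuous.
\<close>
lemma limiting_subdiff_add_smooth:
  fixes h s :: "'a::euclidean_space \<Rightarrow> real"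
  assumes S: "open S" "z \<in> S" and h: "isCont h z"
    and s: "\<And>w. w \<in> S \<Longrightarrow> GDERIV s w :> G w" and G: "isCont G z"
    and v: "v \<in> limiting_subdiff (\<lambda>w. h w + s w) z"
  shows "v - G z \<in> limiting_subdiff h z"
proof -
  obtain y w where yw: "\<And>i. w i \<in> regular_subdiff (\<lambda>w. h w + s w) (y i)" "y \<longlonglongrightarrow> z" "w \<longlonglongrightarrow> v"
    using v unfolding limiting_subdiff_def by blast
  have "\<forall>\<^sub>F i in sequentially. y i \<in> S" using topological_tendstoD[OF yw(2) S] .
  then obtain N where N: "\<And>i. i \<ge> N \<Longrightarrow> y i \<in> S" by (auto simp: eventually_sequentially)
  have "w (i + N) - G (y (i + N)) \<in> regular_subdiff h (y (i + N))" for i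
    by (rule regular_subdiff_add_smooth[OF yw(1) s[OF N]]) simp
  moreover have yN: "(\<lambda>i. y (i + N)) \<longlonglongrightarrow> z" "(\<lambda>i. w (i + N)) \<longlonglongrightarrow> v"
    using yw(2,3) by (auto intro: LIMSEQ_ignore_initial_segment)
  moreover have "(\<lambda>i. w (i + N) - G (y (i + N))) \<longlonglongrightarrow> v - G z"
    by (intro tendsto_diff yN(2) isCont_tendsto_compose[OF G yN(1)])
  moreover have "(\<lambda>i. h (y (i + N))) \<longlonglongrightarrow> h z" by (rule isCont_tendsto_compose[OF h yN(1)])
  ultimately show ?thesis unfolding limiting_subdiff_def mem_Collect_eq
    by (intro exI[of _ "\<lambda>i. y (i + N)"] exI[of _ "\<lambda>i. w (i + N) - G (y (i + N))"]) auto
qed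

text \<open>
  The inclusion for a sum with a smooth function is an equality, as the smooth function can
  be subtracted again.
\<close>
lemma hull_limiting_subdiff_add_smooth:
  fixes h s :: "'a::euclidean_space \<Rightarrow> real"
  assumes S: "open S" "z \<in> S" and h: "isCont h z"
    and s: "\<And>w. w \<in> S \<Longrightarrow> GDERIV s w :> G w" and G: "isCont G z"
  shows "v \<in> convex hull (limiting_subdiff (\<lambda>w. h w + s w) z)
     \<longleftrightarrow> v - G z \<in> convex hull (limiting_subdiff h z)"
proof -
  have "isCont s z" using s[OF S(2)] unfolding gderiv_def by (rule has_derivative_continuous)
  then have hs: "isCont (\<lambda>w. h w + s w) z" using h by (intro continuous_intros)
  have "limiting_subdiff (\<lambda>w. h w + s w) z = (\<lambda>x. G z + x) ` limiting_subdiff h z"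
  proof (intro subset_antisym subsetI)
    fix x assume "x \<in> limiting_subdiff (\<lambda>w. h w + s w) z"
    then have "x - G z \<in> limiting_subdiff h z"
      by (intro limiting_subdiff_add_smooth[OF S h s G])
    then show "x \<in> (\<lambda>x. G z + x) ` limiting_subdiff h z" by (auto intro!: image_eqI[of _ _ "x - G z"])
  next
    fix x assume "x \<in> (\<lambda>x. G z + x) ` limiting_subdiff h z"
    then obtain x' where x': "x = G z + x'" "x' \<in> limiting_subdiff (\<lambda>w. (h w + s w) + - s w) z" by auto
    have "x' - (- G z) \<in> limiting_subdiff (\<lambda>w. h w + s w) z"
    proof (rule limiting_subdiff_add_smooth[OF S hs _ _ x'(2)])
      show "GDERIV (\<lambda>w. - s w) w :> - G w" if "w \<in> S" for w by (rule GDERIV_minus[OF s[OF that]])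
      show "isCont (\<lambda>w. - G w) z" using G by (intro continuous_intros)
    qed
    then show "x \<in> limiting_subdiff (\<lambda>w. h w + s w) z" by (simp add: x'(1) add.commute)
  qed
  then have "convex hull (limiting_subdiff (\<lambda>w. h w + s w) z) = (\<lambda>x. G z + x) ` (convex hull (limiting_subdiff h z))"
    by (simp add: convex_hull_translation)
  then show ?thesis by (force intro!: image_eqI[of _ _ "v - G z"])
qed

lemma (in complete_measure) borel_measurable_AE_eq:
  fixes f g :: "'a \<Rightarrow> 'b::topological_space"
  assumes f: "f \<in> borel_measurable M" and eq: "AE t in M. f t = g t"
  shows "g \<in> borel_measurable M"
proof (rule measurableI)
  fix A :: "'b set" assume "A \<in> sets borel"
  then have fA: "f -` A \<inter> space M \<in> sets M" using f by (rule measurable_sets[rotated])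
  have "AE t in M. t \<in> f -` A \<inter> space M \<longleftrightarrow> t \<in> g -` A \<inter> space M"
    using eq by eventually_elim auto
  then show "g -` A \<inter> space M \<in> sets M" by (rule in_sets_AE[OF _ fA]) auto
qed simp

lemma complete_measure_lebesgue_on:
  assumes S: "S \<in> sets lebesgue"
  shows "complete_measure (lebesgue_on S)"
proof
  fix A B assume "B \<subseteq> A" and "A \<in> null_sets (lebesgue_on S)"
  then have "A \<in> null_sets lebesgue" "A \<subseteq> S" using S by (auto simp: null_sets_restrict_space)
  with \<open>B \<subseteq> A\<close> have "B \<in> sets lebesgue" "B \<subseteq> S"
    by (auto dest: completion.complete)
  then show "B \<in> sets (lebesgue_on S)" using S by (auto simp: sets_restrict_space_iff)
qed

text \<open>
  Approximating \<open>w\<close> by simple functions only uses continuity of \<open>F t\<close> at the single point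
  \<open>w t\<close>. This covers functions that are continuous only in a tube moving with \<open>t\<close>.
\<close>
lemma (in complete_measure) caratheodory_composition_measurable:
  fixes F :: "'a \<Rightarrow> 'b::euclidean_space \<Rightarrow> 'c::euclidean_space"
  assumes F: "\<And>w. (\<lambda>t. F t w) \<in> borel_measurable M" and w: "w \<in> borel_measurable M"
    and cont: "AE t in M. isCont (F t) (w t)"
  shows "(\<lambda>t. F t (w t)) \<in> borel_measurable M"
proof -
  obtain W where W: "\<And>i::nat. simple_function M (W i)" "\<And>t. t \<in> space M \<Longrightarrow> (\<lambda>i. W i t) \<longlonglongrightarrow> w t"
    using borel_measurable_implies_sequence_metric[OF w, of 0] by auto
  have [measurable]: "(\<lambda>t. F t (W i t)) \<in> borel_measurable M" for i
  proof (rule measurable_compose_countable'[where I = "W i ` space M"])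
    show "(\<lambda>t. F t x) \<in> borel_measurable M" for x by (rule F)
    show "W i \<in> measurable M (count_space (W i ` space M))"
      using W(1)[of i] by (auto simp: measurable_count_space_eq2 simple_function_def)
    show "countable (W i ` space M)"
      using W(1)[of i] by (auto simp: simple_function_def countable_finite)
  qed
  have "(\<lambda>t. lim (\<lambda>i. F t (W i t))) \<in> borel_measurable M" by measurable
  moreover have "AE t in M. lim (\<lambda>i. F t (W i t)) = F t (w t)"
    using cont AE_space
  proof eventually_elim
    case (elim t)
    show ?case by (rule limI[OF isCont_tendsto_compose[OF elim(1) W(2)[OF elim(2)]]])
  qed
  ultimately show ?thesis by (rule borel_measurable_AE_eq)
qed

text \<open>
  Partial derivatives are limits of difference quotients; a quotient whose increment leaves
  the tube is replaced by zero, since outside the tube \<open>h t\<close> need not be continuous.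
\<close>
lemma (in complete_measure) gradient_composition_measurable:
  fixes h :: "'a \<Rightarrow> 'b::euclidean_space \<Rightarrow> real"
  assumes h: "\<And>w. (\<lambda>t. h t w) \<in> borel_measurable M"
    and w: "w \<in> borel_measurable M" and c: "c \<in> borel_measurable M"
    and in_ball: "AE t in M. w t \<in> ball (c t) \<delta>"
    and diff: "AE t in M. \<forall>z\<in>ball (c t) \<delta>. \<exists>L. (h t has_derivative L) (at z)"
  shows "(\<lambda>t. gradient (h t) (w t)) \<in> borel_measurable M"
proof (rule borel_measurable_euclidean_space[THEN iffD2, rule_format])
  fix e :: 'b assume "e \<in> Basis"
  note [measurable] = w c
  define W where "W n t = (if dist (c t) (w t + (1 / real (Suc n)) *\<^sub>R e) < \<delta> then w t + (1 / real (Suc n)) *\<^sub>R e else w t)" for n t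
  have [measurable]: "W n \<in> borel_measurable M" for n unfolding W_def by measurable
  have isC: "AE t in M. isCont (h t) (w t)" "AE t in M. isCont (h t) (W n t)" for n
  proof -
    have "AE t in M. W n t \<in> ball (c t) \<delta>"
      using in_ball by eventually_elim (auto simp: W_def)
    with diff show "AE t in M. isCont (h t) (W n t)"
      by eventually_elim (blast intro: has_derivative_continuous)
    from diff in_ball show "AE t in M. isCont (h t) (w t)"
      by eventually_elim (blast intro: has_derivative_continuous)
  qed
  have [measurable]: "(\<lambda>t. h t (w t)) \<in> borel_measurable M" "(\<lambda>t. h t (W n t)) \<in> borel_measurable M" for n
    by (rule caratheodory_composition_measurable[OF h w isC(1)])
      (rule caratheodory_composition_measurable[OF h _ isC(2)]; measurable)
  define Q where "Q n t = real (Suc n) * (h t (W n t) - h t (w t))" for n t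
  have [measurable]: "Q n \<in> borel_measurable M" for n unfolding Q_def by measurable
  have "(\<lambda>t. lim (\<lambda>n. Q n t)) \<in> borel_measurable M" by measurable
  moreover have "AE t in M. lim (\<lambda>n. Q n t) = gradient (h t) (w t) \<bullet> e"
    using diff in_ball
  proof eventually_elim
    case (elim t)
    then obtain L where L: "(h t has_derivative L) (at (w t))" by blast
    have lim: "(\<lambda>n. 1 / real (Suc n)) \<longlonglongrightarrow> 0" by (rule lim_1_over_n[THEN LIMSEQ_Suc])
    have lim0: "filterlim (\<lambda>n. 1 / real (Suc n)) (at 0) sequentially"
      unfolding filterlim_at by (intro conjI lim always_eventually) simp
    have "((\<lambda>s. h t (w t + s *\<^sub>R e)) has_derivative (\<lambda>s. L (s *\<^sub>R e))) (at 0)"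
      by (rule has_derivative_compose[of "\<lambda>s. w t + s *\<^sub>R e" _ _ _ "h t" L]) (auto intro!: derivative_eq_intros L)
    moreover have "L (s *\<^sub>R e) = s * L e" for s
      using linear_scale[OF bounded_linear.linear[OF has_derivative_bounded_linear[OF L]]] by simp
    ultimately have "DERIV (\<lambda>s. h t (w t + s *\<^sub>R e)) 0 :> L e"
      by (simp add: has_field_derivative_def mult_commute_abs)
    then have "((\<lambda>s. (h t (w t + s *\<^sub>R e) - h t (w t)) / s) \<longlongrightarrow> L e) (at 0)"
      by (simp add: DERIV_def)
    then have 1: "(\<lambda>n. (h t (w t + (1 / real (Suc n)) *\<^sub>R e) - h t (w t)) / (1 / real (Suc n))) \<longlonglongrightarrow> L e"
      by (rule filterlim_compose[OF _ lim0])
    have "(\<lambda>n. w t + (1 / real (Suc n)) *\<^sub>R e) \<longlonglongrightarrow> w t + 0 *\<^sub>R e"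
      by (intro tendsto_intros lim)
    then have "\<forall>\<^sub>F n in sequentially. w t + (1 / real (Suc n)) *\<^sub>R e \<in> ball (c t) \<delta>"
      using elim(2) by (intro topological_tendstoD) auto
    then have "\<forall>\<^sub>F n in sequentially. (h t (w t + (1 / real (Suc n)) *\<^sub>R e) - h t (w t)) / (1 / real (Suc n)) = Q n t"
      by eventually_elim (simp add: Q_def W_def mult.commute)
    with 1 have "(\<lambda>n. Q n t) \<longlonglongrightarrow> L e" by (rule Lim_transform_eventually)
    then show ?case using GDERIV_gradient(2)[OF L, of e] by (simp add: limI inner_commute)
  qed
  ultimately show "(\<lambda>t. gradient (h t) (w t) \<bullet> e) \<in> borel_measurable M" by (rule borel_measurable_AE_eq)
qed

section \<open>Weak convergence and absolutely continuous functions\<close>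

text \<open>
  The adjoint carries the linear map over to the test function.
\<close>
lemma weak_L1_tendsto_linear:
  fixes A :: "'a::euclidean_space \<Rightarrow> 'b::euclidean_space"
  assumes A: "linear A" and v: "weak_L1_tendsto M v w"
  shows "weak_L1_tendsto M (\<lambda>k t. A (v k t)) (\<lambda>t. A (w t))"
proof -
  have bA: "bounded_linear A" using A by (simp add: linear_conv_bounded_linear)
  have int: "integrable M (\<lambda>t. A (f t))" if "integrable M f" for f
    by (rule integrable_bounded_linear[OF bA that])
  have "(\<lambda>k. \<integral>t. A (v k t) \<bullet> \<phi> t \<partial>M) \<longlonglongrightarrow> (\<integral>t. A (w t) \<bullet> \<phi> t \<partial>M)" if \<phi>: "Linf M \<phi>" for \<phi>
  proof -
    have bB: "bounded_linear (adjoint A)"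
      using adjoint_linear[OF A] by (simp add: linear_conv_bounded_linear)
    obtain K where K: "AE t in M. norm (\<phi> t) \<le> K" using \<phi> by (auto simp: Linf_def)
    obtain B where B: "\<And>x. norm (adjoint A x) \<le> norm x * B" "B > 0"
      using bounded_linear.pos_bounded[OF bB] by blast
    have "AE t in M. norm (adjoint A (\<phi> t)) \<le> K * B"
      using K
    proof eventually_elim
      case (elim t)
      have "norm (\<phi> t) * B \<le> K * B" using elim B(2) by (intro mult_right_mono) auto
      then show ?case using B(1)[of "\<phi> t"] by linarith
    qed
    moreover have "(\<lambda>t. adjoint A (\<phi> t)) \<in> borel_measurable M"
      using \<phi> by (auto simp: Linf_def intro: borel_measurable_continuous_on linear_continuous_on[OF bB])
    ultimately have "Linf M (\<lambda>t. adjoint A (\<phi> t))" by (auto simp: Linf_def)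
    then have "(\<lambda>k. \<integral>t. v k t \<bullet> adjoint A (\<phi> t) \<partial>M) \<longlonglongrightarrow> (\<integral>t. w t \<bullet> adjoint A (\<phi> t) \<partial>M)"
      using v by (auto simp: weak_L1_tendsto_def)
    then show ?thesis by (simp add: adjoint_works[OF A])
  qed
  then show ?thesis using v int by (auto simp: weak_L1_tendsto_def)
qed

lemma integrable_Linf_pairing:
  assumes "integrable M v" "Linf M \<phi>"
  shows "integrable M (\<lambda>t. v t \<bullet> \<phi> t)"
  by (rule Linf_pairing_integrable[OF integrable_norm[OF assms(1)] _ assms(2)])
    (use assms(1) in \<open>auto simp: dominated_by_def\<close>)

lemma weak_L1_tendsto_add:
  assumes "weak_L1_tendsto M v w" "weak_L1_tendsto M v' w'"
  shows "weak_L1_tendsto M (\<lambda>k t. v k t + v' k t) (\<lambda>t. w t + w' t)"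
  using assms unfolding weak_L1_tendsto_def
  by (auto simp: inner_add_left integrable_Linf_pairing intro!: tendsto_add)

lemma weak_L1_tendsto_subseq:
  assumes "weak_L1_tendsto M v w" "strict_mono s"
  shows "weak_L1_tendsto M (\<lambda>k. v (s k)) w"
  using assms LIMSEQ_subseq_LIMSEQ[OF _ assms(2)] unfolding weak_L1_tendsto_def by (fastforce simp: o_def)

lemma has_wderiv_indicator:
  fixes x :: "real \<Rightarrow> 'a::euclidean_space"
  assumes "has_wderiv a b x v" "t \<in> {a..b}"
  shows "x t = x a + (\<integral>s. indicator {a..t} s *\<^sub>R v s \<partial>lebesgue_on {a..b})"
proof -
  have "(\<integral>s. v s \<partial>lebesgue_on {a..t}) = (\<integral>s. indicator {a..t} s *\<^sub>R v s \<partial>lebesgue)"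
    by (subst integral_restrict_space) auto
  also have "\<dots> = (\<integral>s. indicator {a..b} s *\<^sub>R indicator {a..t} s *\<^sub>R v s \<partial>lebesgue)"
    using assms(2) by (intro Bochner_Integration.integral_cong) (auto simp: indicator_def)
  also have "\<dots> = (\<integral>s. indicator {a..t} s *\<^sub>R v s \<partial>lebesgue_on {a..b})"
    by (subst integral_restrict_space) auto
  finally have "(\<integral>s. v s \<partial>lebesgue_on {a..t}) = (\<integral>s. indicator {a..t} s *\<^sub>R v s \<partial>lebesgue_on {a..b})" .
  moreover have "x t = x a + (\<integral>s. v s \<partial>lebesgue_on {a..t})"
    using assms unfolding has_wderiv_def by blast
  ultimately show ?thesis by (simp only:)
qed

lemma has_wderiv_continuous:
  fixes x :: "real \<Rightarrow> 'a::euclidean_space"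
  assumes "has_wderiv a b x v"
  shows "continuous_on {a..b} x"
proof -
  have v: "integrable (lebesgue_on {a..b}) v" using assms by (simp add: has_wderiv_def)
  have "v integrable_on {a..b}" by (rule integrable_on_lebesgue_on[OF v]) auto
  then have "continuous_on {a..b} (\<lambda>t. x a + integral {a..t} v)"
    by (intro continuous_intros indefinite_integral_continuous_1)
  moreover have "x a + integral {a..t} v = x t" if "t \<in> {a..b}" for t
  proof -
    have "integrable (lebesgue_on {a..t}) v"
      using that by (intro integrable_subinterval[OF v]) auto
    then have "(\<integral>s. v s \<partial>lebesgue_on {a..t}) = integral {a..t} v"
      by (intro lebesgue_integral_eq_integral) auto
    moreover have "x t = x a + (\<integral>s. v s \<partial>lebesgue_on {a..t})"
      using assms that unfolding has_wderiv_def by blast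
    ultimately show ?thesis by (simp only:)
  qed
  ultimately show ?thesis by (rule continuous_on_eq)
qed

lemma W11_measurable:
  assumes "x \<in> W11 a b"
  shows "x \<in> borel_measurable (lebesgue_on {a..b})"
  using has_wderiv_continuous[OF has_wderiv_wderiv[OF assms]]
  by (rule continuous_imp_measurable_on_sets_lebesgue) auto

lemma has_wderiv_primitive:
  fixes v :: "real \<Rightarrow> 'a::euclidean_space"
  assumes v: "integrable (lebesgue_on {a..b}) v" and "a \<le> b"
  shows "has_wderiv a b (\<lambda>t. c + (\<integral>s. v s \<partial>lebesgue_on {a..t})) v"
proof -
  have "integrable (lebesgue_on {a..a}) v"
    by (rule integrable_subinterval[OF v]) (use assms in auto)
  then have "(\<integral>s. v s \<partial>lebesgue_on {a..a}) = integral {a..a} v"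
    by (intro lebesgue_integral_eq_integral) auto
  then show ?thesis using v by (simp add: has_wderiv_def)
qed

lemma integrable_indicator_scaleR:
  fixes v :: "real \<Rightarrow> 'a::euclidean_space"
  assumes "integrable (lebesgue_on {a..b}) v" "t \<le> b"
  shows "integrable (lebesgue_on {a..b}) (\<lambda>s. indicator {a..t} s *\<^sub>R v s)"
  using assms
  by (intro integrable_mult_indicator) (auto simp: sets_restrict_space_iff)

lemma has_wderiv_increment_le:
  fixes x :: "real \<Rightarrow> 'a::euclidean_space"
  assumes x: "has_wderiv a b x v" and G: "has_wderiv a b G m"
    and vm: "AE t in lebesgue_on {a..b}. norm (v t) \<le> m t"
    and st: "s \<in> {a..b}" "t \<in> {a..b}"
  shows "norm (x t - x s) \<le> \<bar>G t - G s\<bar>"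
proof -
  have *: "norm (x t - x s) \<le> G t - G s" if "s \<in> {a..b}" "t \<in> {a..b}" "s \<le> t" for s t
  proof -
    let ?M = "lebesgue_on {a..b}"
    have v: "integrable ?M v" and m: "integrable ?M m" using x G by (auto simp: has_wderiv_def)
    have i: "integrable ?M (\<lambda>r. indicator {a..t'} r *\<^sub>R v r)" "integrable ?M (\<lambda>r. indicator {a..t'} r *\<^sub>R m r)"
      if "t' \<in> {a..b}" for t' using that by (auto intro!: integrable_indicator_scaleR v m simp del: real_scaleR_def)
    have "x t - x s = (\<integral>r. indicator {a..t} r *\<^sub>R v r - indicator {a..s} r *\<^sub>R v r \<partial>?M)"
      using i[OF that(1)] i[OF that(2)] has_wderiv_indicator[OF x that(1)] has_wderiv_indicator[OF x that(2)] by simp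
    also have "norm \<dots> \<le> (\<integral>r. norm (indicator {a..t} r *\<^sub>R v r - indicator {a..s} r *\<^sub>R v r) \<partial>?M)"
      by (rule integral_norm_bound)
    also have "\<dots> \<le> (\<integral>r. indicator {a..t} r *\<^sub>R m r - indicator {a..s} r *\<^sub>R m r \<partial>?M)"
    proof (rule integral_mono_AE)
      show "AE r in ?M. norm (indicator {a..t} r *\<^sub>R v r - indicator {a..s} r *\<^sub>R v r)
          \<le> indicator {a..t} r *\<^sub>R m r - indicator {a..s} r *\<^sub>R m r"
        using vm by eventually_elim (use that in \<open>auto simp: indicator_def\<close>)
    qed (use i[OF that(1)] i[OF that(2)] in auto)
    also have "\<dots> = G t - G s"
      using i[OF that(1)] i[OF that(2)] has_wderiv_indicator[OF G that(1)] has_wderiv_indicator[OF G that(2)] by simp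
    finally show ?thesis .
  qed
  show ?thesis using *[OF st(1,2)] *[OF st(2,1)] by (cases "s \<le> t") (auto simp: norm_minus_commute)
qed

text \<open>
  The common modulus of continuity reduces uniform convergence to convergence on a finite net.
\<close>
lemma equicontinuous_pointwise_imp_uniform_limit:
  fixes x :: "nat \<Rightarrow> real \<Rightarrow> 'a::real_normed_vector" and G :: "real \<Rightarrow> real"
  assumes G: "continuous_on {a..b} G"
    and eq: "\<And>k s t. s \<in> {a..b} \<Longrightarrow> t \<in> {a..b} \<Longrightarrow> norm (x k t - x k s) \<le> \<bar>G t - G s\<bar>"
    and lim: "\<And>t. t \<in> {a..b} \<Longrightarrow> (\<lambda>k. x k t) \<longlonglongrightarrow> y t"
  shows "uniform_limit {a..b} x y sequentially"
  unfolding uniform_limit_iff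
proof (intro allI impI)
  fix e :: real assume "e > 0"
  have eqy: "norm (y t - y s) \<le> \<bar>G t - G s\<bar>" if "s \<in> {a..b}" "t \<in> {a..b}" for s t
    using tendsto_norm[OF tendsto_diff[OF lim[OF that(2)] lim[OF that(1)]]]
    by (rule Lim_bounded) (use eq that in auto)
  have "uniformly_continuous_on {a..b} G" using G by (intro compact_uniformly_continuous) auto
  then obtain d where d: "d > 0" "\<And>s t. s \<in> {a..b} \<Longrightarrow> t \<in> {a..b} \<Longrightarrow> dist t s < d \<Longrightarrow> dist (G t) (G s) < e / 3"
    unfolding uniformly_continuous_on_def using \<open>e > 0\<close> by (metis divide_pos_pos zero_less_numeral)
  obtain F where F: "finite F" "F \<subseteq> {a..b}" "{a..b} \<subseteq> (\<Union>s\<in>F. ball s d)"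
    using seq_compact_imp_totally_bounded[of "{a..b}"] compact_Icc[of a b] d(1)
    by (meson compact_imp_seq_compact)
  have "\<forall>\<^sub>F k in sequentially. \<forall>s\<in>F. dist (x k s) (y s) < e / 3"
    using F(1,2) \<open>e > 0\<close> by (intro eventually_ball_finite ballI tendstoD lim) auto
  then show "\<forall>\<^sub>F k in sequentially. \<forall>t\<in>{a..b}. dist (x k t) (y t) < e"
  proof eventually_elim
    case (elim k)
    show ?case
    proof
      fix t assume t: "t \<in> {a..b}"
      then obtain s where s: "s \<in> F" "dist t s < d" using F(3) by (auto simp: dist_commute)
      then have s': "s \<in> {a..b}" using F by auto
      have "\<bar>G t - G s\<bar> < e / 3" using d(2)[OF s' t s(2)] by (simp add: dist_real_def)
      then have "dist (x k t) (x k s) < e / 3" "dist (y s) (y t) < e / 3"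
        using eq[OF s' t, of k] eqy[OF s' t] by (auto simp: dist_norm norm_minus_commute)
      then show "dist (x k t) (y t) < e"
        using elim s(1) dist_triangle[of "x k t" "y t" "x k s"] dist_triangle[of "x k s" "y t" "y s"] by fastforce
    qed
  qed
qed

text \<open>
  Weak convergence of the derivatives, tested with indicators of the intervals \<open>{a..t}\<close>,
  gives pointwise convergence; domination of the derivatives gives equicontinuity.
\<close>
lemma has_wderiv_uniform_limit:
  fixes x :: "nat \<Rightarrow> real \<Rightarrow> 'a::euclidean_space"
  assumes x: "\<And>k. has_wderiv a b (x k) (v k)" and y: "has_wderiv a b y w"
    and m: "integrable (lebesgue_on {a..b}) m"
    and vm: "\<And>k. AE t in lebesgue_on {a..b}. norm (v k t) \<le> m t"
    and init: "(\<lambda>k. x k a) \<longlonglongrightarrow> y a" and weak: "weak_L1_tendsto (lebesgue_on {a..b}) v w" and "a \<le> b"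
  shows "uniform_limit {a..b} x y sequentially"
proof -
  define G where "G t = (0::real) + (\<integral>s. m s \<partial>lebesgue_on {a..t})" for t
  have G: "has_wderiv a b G m" unfolding G_def by (rule has_wderiv_primitive[OF m \<open>a \<le> b\<close>])
  show ?thesis
  proof (rule equicontinuous_pointwise_imp_uniform_limit[OF has_wderiv_continuous[OF G]])
    show "norm (x k t - x k s) \<le> \<bar>G t - G s\<bar>" if "s \<in> {a..b}" "t \<in> {a..b}" for k s t
      by (rule has_wderiv_increment_le[OF x G vm that])
  next
    fix t assume t: "t \<in> {a..b}"
    have "(\<lambda>k. x k t \<bullet> e) \<longlonglongrightarrow> y t \<bullet> e" if "e \<in> Basis" for e
    proof -
      let ?\<phi> = "\<lambda>s. indicator {a..t} s *\<^sub>R e"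
      have "Linf (lebesgue_on {a..b}) ?\<phi>" unfolding Linf_def
      proof
        show "?\<phi> \<in> borel_measurable (lebesgue_on {a..b})"
          by (intro borel_measurable_scaleR borel_measurable_indicator) (use t in \<open>auto simp: sets_restrict_space_iff\<close>)
        show "\<exists>K. AE s in lebesgue_on {a..b}. norm (?\<phi> s) \<le> K"
          by (rule exI[of _ 1]) (use that in \<open>auto simp: indicator_def\<close>)
      qed
      then have "(\<lambda>k. \<integral>s. v k s \<bullet> ?\<phi> s \<partial>lebesgue_on {a..b}) \<longlonglongrightarrow> (\<integral>s. w s \<bullet> ?\<phi> s \<partial>lebesgue_on {a..b})"
        using weak by (simp only: weak_L1_tendsto_def)
      moreover have rep: "z t \<bullet> e = z a \<bullet> e + (\<integral>s. u s \<bullet> ?\<phi> s \<partial>lebesgue_on {a..b})"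
        if z: "has_wderiv a b z u" for z u
      proof -
        have "integrable (lebesgue_on {a..b}) (\<lambda>s. indicator {a..t} s *\<^sub>R u s)"
          using z t by (intro integrable_indicator_scaleR) (auto simp: has_wderiv_def)
        then have "(\<integral>s. (indicator {a..t} s *\<^sub>R u s) \<bullet> e \<partial>lebesgue_on {a..b})
            = (\<integral>s. indicator {a..t} s *\<^sub>R u s \<partial>lebesgue_on {a..b}) \<bullet> e"
          by (rule integral_inner_left[rotated]) 
        then show ?thesis by (subst has_wderiv_indicator[OF z t]) (simp add: inner_add_left)
      qed
      ultimately show ?thesis
        unfolding rep[OF x] rep[OF y]
        by (intro tendsto_add tendsto_inner init tendsto_const)
    qed
    then show "(\<lambda>k. x k t) \<longlonglongrightarrow> y t" by (rule tendsto_componentwise_iff[THEN iffD2, rule_format])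
  qed
qed

lemma AE_interval_ex:
  assumes "AE t in lebesgue_on {a..b::real}. Q t" "a < b"
  obtains t where "t \<in> {a..b}" "Q t"
proof (rule ccontr)
  assume "\<not> thesis"
  with that have "\<And>t. t \<in> {a..b} \<Longrightarrow> \<not> Q t" by blast
  with assms(1) have "AE t in lebesgue. t \<notin> {a..b}" by (auto simp: AE_restrict_space_iff elim!: eventually_mono)
  then have "{a..b} \<in> null_sets lebesgue" by (simp add: AE_iff_null_sets)
  then have "emeasure lebesgue {a..b} = 0" by auto
  then show False using assms(2) by simp
qed

text \<open>
  Normal cones are local, and \<open>x\<close> is interior to the ball.
\<close>
lemma limiting_normal_cone_inter_cball:
  fixes S :: "'a::euclidean_space set"
  assumes "\<delta> > 0" and v: "v \<in> limiting_normal_cone (cball x \<delta> \<inter> S) x"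
  shows "v \<in> limiting_normal_cone S x"
proof -
  obtain y w where yw: "\<And>k. y k \<in> cball x \<delta> \<inter> S" "\<And>k. w k \<in> regular_normal_cone (cball x \<delta> \<inter> S) (y k)"
    "y \<longlonglongrightarrow> x" "w \<longlonglongrightarrow> v" and "x \<in> S" using v unfolding limiting_normal_cone_def by auto
  have "\<forall>\<^sub>F k in sequentially. y k \<in> ball x \<delta>"
    using yw(3) \<open>\<delta> > 0\<close> by (intro topological_tendstoD) auto
  then obtain N where N: "\<And>k. k \<ge> N \<Longrightarrow> y k \<in> ball x \<delta>" by (auto simp: eventually_sequentially)
  have "w (k + N) \<in> regular_normal_cone S (y (k + N))" for k
  proof -
    have "at (y (k + N)) within (cball x \<delta> \<inter> S) = at (y (k + N)) within S"
      by (rule at_within_nhd[of _ "ball x \<delta>"]) (use N[of "k + N"] in auto)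
    then show ?thesis using yw(2)[of "k + N"] by (simp add: regular_normal_cone_def)
  qed
  moreover have "(\<lambda>k. y (k + N)) \<longlonglongrightarrow> x" "(\<lambda>k. w (k + N)) \<longlonglongrightarrow> v"
    using yw(3,4) by (auto intro: LIMSEQ_ignore_initial_segment)
  ultimately show ?thesis using \<open>x \<in> S\<close> yw(1) unfolding limiting_normal_cone_def mem_Collect_eq
    by (intro conjI exI[of _ "\<lambda>k. y (k + N)"] exI[of _ "\<lambda>k. w (k + N)"]) auto
qed

section \<open>The Hamiltonian inclusion and the costates\<close>

text \<open>
  The gradient in \<open>(x, u)\<close> of the constraint part \<open>q \<bullet> b + r \<bullet> g\<close> of the Hamiltonian.
\<close>
definition constraint_gradient ::
    "('n::finite, 'm::finite, 'mb::finite, 'mg::finite) problem \<Rightarrow> real^'mb \<Rightarrow> real^'mg \<Rightarrow> real \<Rightarrow>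
     real^'n \<Rightarrow> real^'m \<Rightarrow> (real^'n) \<times> (real^'m)" where
  "constraint_gradient P q r t x u =
     (\<Sum>i\<in>UNIV. (q $ i) *\<^sub>R grad_b P i t x u) + (\<Sum>j\<in>UNIV. (r $ j) *\<^sub>R grad_g P j t x u)"

definition C1_constraints_at ::
    "('n::finite, 'm::finite, 'mb::finite, 'mg::finite) problem \<Rightarrow> real \<Rightarrow> (real^'n) \<times> (real^'m) \<Rightarrow> real \<Rightarrow> bool" where
  "C1_constraints_at P t c \<delta> \<longleftrightarrow>
     (\<exists>D :: (real^'n) \<times> (real^'m) \<Rightarrow> ((real^'n) \<times> (real^'m)) \<Rightarrow>\<^sub>L ((real^'mb) \<times> (real^'mg)).
        (\<forall>w\<in>cball c \<delta>.
           ((\<lambda>(x, u). (eqc P t x u, ineqc P t x u)) has_derivative blinfun_apply (D w)) (at w)) \<and>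
        continuous_on (cball c \<delta>) D)"

lemma C1_constraints_at_differentiable:
  assumes "C1_constraints_at P t c \<delta>" "w \<in> ball c \<delta>"
  obtains L where "((\<lambda>(x, u). (eqc P t x u, ineqc P t x u)) has_derivative L) (at w)"
proof -
  have "w \<in> cball c \<delta>" using assms(2) by simp
  with assms(1) that show thesis unfolding C1_constraints_at_def by blast
qed

lemma constraint_components_has_derivative:
  assumes "((\<lambda>(x, u). (eqc P t x u, ineqc P t x u)) has_derivative L) (at w)"
  shows "((\<lambda>(y, z). eqc P t y z $ i) has_derivative (\<lambda>v. fst (L v) $ i)) (at w)"
    and "((\<lambda>(y, z). ineqc P t y z $ j) has_derivative (\<lambda>v. snd (L v) $ j)) (at w)"
proof -
  have "((\<lambda>w. fst (case w of (x, u) \<Rightarrow> (eqc P t x u, ineqc P t x u)) $ i) has_derivative (\<lambda>v. fst (L v) $ i)) (at w)"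
    by (intro bounded_linear.has_derivative[OF bounded_linear_vec_nth] has_derivative_fst assms)
  then show "((\<lambda>(y, z). eqc P t y z $ i) has_derivative (\<lambda>v. fst (L v) $ i)) (at w)"
    by (simp add: case_prod_unfold)
  have "((\<lambda>w. snd (case w of (x, u) \<Rightarrow> (eqc P t x u, ineqc P t x u)) $ j) has_derivative (\<lambda>v. snd (L v) $ j)) (at w)"
    by (intro bounded_linear.has_derivative[OF bounded_linear_vec_nth] has_derivative_snd assms)
  then show "((\<lambda>(y, z). ineqc P t y z $ j) has_derivative (\<lambda>v. snd (L v) $ j)) (at w)"
    by (simp add: case_prod_unfold)
qed

lemma inner_constraint_gradient:
  assumes "((\<lambda>(x, u). (eqc P t x u, ineqc P t x u)) has_derivative L) (at w)"
  shows "v \<bullet> constraint_gradient P q r t (fst w) (snd w) = q \<bullet> fst (L v) + r \<bullet> snd (L v)"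
  unfolding constraint_gradient_def grad_b_def grad_g_def
  using GDERIV_gradient(2)[OF constraint_components_has_derivative(1)[OF assms], of v]
    GDERIV_gradient(2)[OF constraint_components_has_derivative(2)[OF assms], of v]
  by (simp add: inner_add_right inner_sum_right inner_vec_def)

lemma constraint_gradient_GDERIV:
  assumes L: "((\<lambda>(x, u). (eqc P t x u, ineqc P t x u)) has_derivative L) (at w)"
  shows "GDERIV (\<lambda>(y, z). q \<bullet> eqc P t y z + r \<bullet> ineqc P t y z) w :> constraint_gradient P q r t (fst w) (snd w)"
  unfolding gderiv_def
proof -
  let ?F = "\<lambda>w. case w of (x, u) \<Rightarrow> (eqc P t x u, ineqc P t x u)"
  have "((\<lambda>w. q \<bullet> fst (?F w) + r \<bullet> snd (?F w)) has_derivative (\<lambda>v. q \<bullet> fst (L v) + r \<bullet> snd (L v))) (at w)"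
    by (intro has_derivative_add has_derivative_inner_right has_derivative_fst has_derivative_snd L)
  then show "((\<lambda>(y, z). q \<bullet> eqc P t y z + r \<bullet> ineqc P t y z) has_derivative
      (\<lambda>v. v \<bullet> constraint_gradient P q r t (fst w) (snd w))) (at w)"
    unfolding inner_constraint_gradient[OF L] by (simp add: case_prod_unfold)
qed

lemma constraint_gradient_isCont:
  assumes C1: "C1_constraints_at P t c \<delta>" and w: "w \<in> ball c \<delta>"
  shows "isCont (\<lambda>w. constraint_gradient P q r t (fst w) (snd w)) w"
proof -
  obtain D where D: "\<And>w. w \<in> cball c \<delta> \<Longrightarrow>
      ((\<lambda>(x, u). (eqc P t x u, ineqc P t x u)) has_derivative blinfun_apply (D w)) (at w)"
    and cD: "continuous_on (cball c \<delta>) D" using C1 unfolding C1_constraints_at_def by blast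
  have "continuous_on (ball c \<delta>) D" by (rule continuous_on_subset[OF cD]) auto
  then have c: "continuous_on (ball c \<delta>) (\<lambda>w. q \<bullet> fst (blinfun_apply (D w) e) + r \<bullet> snd (blinfun_apply (D w) e))" for e
    by (intro continuous_intros)
  have "continuous_on (ball c \<delta>) (\<lambda>w. constraint_gradient P q r t (fst w) (snd w))"
  proof (subst continuous_on_componentwise, rule ballI)
    fix e :: "(real^'a) \<times> (real^'b)" assume "e \<in> Basis"
    show "continuous_on (ball c \<delta>) (\<lambda>w. constraint_gradient P q r t (fst w) (snd w) \<bullet> e)"
    proof (rule continuous_on_eq[OF c[of e]])
      fix w assume "w \<in> ball c \<delta>"
      then have "w \<in> cball c \<delta>" by simp
      from inner_constraint_gradient[OF D[OF this], of e q r]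
      show "q \<bullet> fst (blinfun_apply (D w) e) + r \<bullet> snd (blinfun_apply (D w) e)
          = constraint_gradient P q r t (fst w) (snd w) \<bullet> e"
        by (simp add: inner_commute)
    qed
  qed
  then show ?thesis using w by (simp add: continuous_on_eq_continuous_at)
qed

text \<open>
  Only the costate term \<open>p \<bullet> f\<close> is nonsmooth.
\<close>
lemma hull_subdiff_Ham_iff:
  assumes C1: "C1_constraints_at P t c \<delta>" and w: "(x, u) \<in> ball c \<delta>"
    and f: "isCont (\<lambda>(y, z). p \<bullet> dyn P t y z) (x, u)"
  shows "v \<in> convex hull (subdiff_Ham P t x p q r u) \<longleftrightarrow>
    v - constraint_gradient P q r t x u \<in> convex hull (limiting_subdiff (\<lambda>(y, z). p \<bullet> dyn P t y z) (x, u))"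
proof -
  have split: "(\<lambda>(y, z). Ham P t y p q r z) =
      (\<lambda>w. (case w of (y, z) \<Rightarrow> p \<bullet> dyn P t y z) + (case w of (y, z) \<Rightarrow> q \<bullet> eqc P t y z + r \<bullet> ineqc P t y z))"
    by (auto simp: Ham_def fun_eq_iff)
  have "GDERIV (\<lambda>(y, z). q \<bullet> eqc P t y z + r \<bullet> ineqc P t y z) w :> constraint_gradient P q r t (fst w) (snd w)"
    if w': "w \<in> ball c \<delta>" for w
  proof -
    obtain L where "((\<lambda>(x, u). (eqc P t x u, ineqc P t x u)) has_derivative L) (at w)"
      by (rule C1_constraints_at_differentiable[OF C1 w'])
    then show ?thesis by (rule constraint_gradient_GDERIV)
  qed
  from hull_limiting_subdiff_add_smooth[OF open_ball w f this constraint_gradient_isCont[OF C1 w]]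
  show ?thesis unfolding subdiff_Ham_def split by simp
qed

lemma gradient_fst:
  fixes h :: "'a::euclidean_space \<times> 'b::euclidean_space \<Rightarrow> real"
  assumes "(h has_derivative L) (at (x, u))"
  shows "gradient (\<lambda>y. h (y, u)) x = fst (gradient h (x, u))"
proof (rule gradient_eqI)
  have "(h has_derivative (\<lambda>v. v \<bullet> gradient h (x, u))) (at (x, u))"
    using GDERIV_gradient(1)[OF assms] by (simp add: gderiv_def)
  then have "((\<lambda>y. h (y, u)) has_derivative (\<lambda>v. (v, 0) \<bullet> gradient h (x, u))) (at x)"
    by (intro has_derivative_compose[of "\<lambda>y. (y, u)" "\<lambda>v. (v, 0)" x UNIV h]) (auto intro!: derivative_eq_intros)
  then show "GDERIV (\<lambda>y. h (y, u)) x :> fst (gradient h (x, u))"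
    by (simp add: gderiv_def inner_prod_def)
qed

lemma fst_constraint_gradient:
  assumes C1: "C1_constraints_at P t c \<delta>" and w: "(x, u) \<in> ball c \<delta>"
  shows "fst (constraint_gradient P q r t x u)
    = (\<Sum>i\<in>UNIV. (q $ i) *\<^sub>R gradx_b P i t x u) + (\<Sum>j\<in>UNIV. (r $ j) *\<^sub>R gradx_g P j t x u)"
proof -
  obtain L where L: "((\<lambda>(x, u). (eqc P t x u, ineqc P t x u)) has_derivative L) (at (x, u))"
    by (rule C1_constraints_at_differentiable[OF C1 w])
  have "gradx_b P i t x u = fst (grad_b P i t x u)" for i
    using gradient_fst[OF constraint_components_has_derivative(1)[OF L, of i]] by (simp add: gradx_b_def grad_b_def)
  moreover have "gradx_g P j t x u = fst (grad_g P j t x u)" for j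
    using gradient_fst[OF constraint_components_has_derivative(2)[OF L, of j]] by (simp add: gradx_g_def grad_g_def)
  ultimately show ?thesis by (simp add: constraint_gradient_def fst_sum)
qed

lemma constraint_gradient_measurable:
  fixes P :: "('n::finite, 'm::finite, 'mb::finite, 'mg::finite) problem"
  assumes H4: "H4 P" and C1: "AE t in T_meas P. C1_constraints_at P t (xb t, ub t) \<delta>"
    and [measurable]: "xb \<in> borel_measurable (T_meas P)" "ub \<in> borel_measurable (T_meas P)"
      "x \<in> borel_measurable (T_meas P)" "u \<in> borel_measurable (T_meas P)"
      "q \<in> borel_measurable (T_meas P)" "r \<in> borel_measurable (T_meas P)"
    and tube: "AE t in T_meas P. (x t, u t) \<in> ball (xb t, ub t) \<delta>"
  shows "(\<lambda>t. constraint_gradient P (q t) (r t) t (x t) (u t)) \<in> borel_measurable (T_meas P)"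
proof -
  interpret complete_measure "T_meas P" by (rule complete_measure_lebesgue_on) auto
  have m: "(\<lambda>t. (eqc P t y z, ineqc P t y z)) \<in> borel_measurable (T_meas P)" for y z
    using H4 by (simp add: H4_def)
  have nth: "(\<lambda>t. f t $ i) \<in> borel_measurable (T_meas P)" if "f \<in> borel_measurable (T_meas P)"
    for f :: "real \<Rightarrow> real^'k::finite" and i
    using borel_measurable_continuous_on[OF linear_continuous_on[OF bounded_linear_vec_nth] that] .
  have [measurable]: "(\<lambda>t. eqc P t y z $ i) \<in> borel_measurable (T_meas P)"
    "(\<lambda>t. ineqc P t y z $ j) \<in> borel_measurable (T_meas P)" for y z i j
    using borel_measurable_continuous_on[OF continuous_on_fst[OF continuous_on_id] m]
      borel_measurable_continuous_on[OF continuous_on_snd[OF continuous_on_id] m]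
    by (auto intro!: nth)
  have [measurable]: "(\<lambda>t. grad_b P i t (x t) (u t)) \<in> borel_measurable (T_meas P)" for i
    unfolding grad_b_def
  proof (rule gradient_composition_measurable[OF _ _ _ tube])
    show "AE t in T_meas P. \<forall>w\<in>ball (xb t, ub t) \<delta>. \<exists>L. ((\<lambda>(y, z). eqc P t y z $ i) has_derivative L) (at w)"
      using C1
    proof eventually_elim
      case (elim t)
      then show ?case
        by (blast elim: C1_constraints_at_differentiable intro: constraint_components_has_derivative(1))
    qed
  qed (auto simp: case_prod_beta)
  have [measurable]: "(\<lambda>t. grad_g P j t (x t) (u t)) \<in> borel_measurable (T_meas P)" for j
    unfolding grad_g_def
  proof (rule gradient_composition_measurable[OF _ _ _ tube])
    show "AE t in T_meas P. \<forall>w\<in>ball (xb t, ub t) \<delta>. \<exists>L. ((\<lambda>(y, z). ineqc P t y z $ j) has_derivative L) (at w)"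
      using C1
    proof eventually_elim
      case (elim t)
      then show ?case
        by (blast elim: C1_constraints_at_differentiable intro: constraint_components_has_derivative(2))
    qed
  qed (auto simp: case_prod_beta)
  show ?thesis unfolding constraint_gradient_def
    by (intro borel_measurable_add borel_measurable_sum borel_measurable_scaleR nth) auto
qed

definition Lipschitz_dynamics_at ::
    "('n::finite, 'm::finite, 'mb::finite, 'mg::finite) problem \<Rightarrow> real \<Rightarrow> (real^'n) \<times> (real^'m) \<Rightarrow> real \<Rightarrow> real \<Rightarrow> bool" where
  "Lipschitz_dynamics_at P t c \<delta> L \<longleftrightarrow> (\<forall>w\<in>cball c \<delta>. \<forall>w'\<in>cball c \<delta>.
      norm (dyn P t (fst w) (snd w) - dyn P t (fst w') (snd w')) \<le> L * norm (w - w'))"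

lemma costate_dynamics_Lipschitz:
  assumes L: "Lipschitz_dynamics_at P t c \<delta> L" and w: "w \<in> ball c \<delta>" "w' \<in> ball c \<delta>"
  shows "\<bar>(case w of (y, z) \<Rightarrow> p \<bullet> dyn P t y z) - (case w' of (y, z) \<Rightarrow> p \<bullet> dyn P t y z)\<bar> \<le> norm p * L * norm (w - w')"
proof -
  have "\<bar>p \<bullet> (dyn P t (fst w) (snd w) - dyn P t (fst w') (snd w'))\<bar>
      \<le> norm p * norm (dyn P t (fst w) (snd w) - dyn P t (fst w') (snd w'))"
    by (rule Cauchy_Schwarz_ineq2)
  also have "\<dots> \<le> norm p * (L * norm (w - w'))"
    using L w unfolding Lipschitz_dynamics_at_def by (intro mult_left_mono) auto
  finally show ?thesis by (simp add: case_prod_beta inner_diff_right mult.assoc)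
qed

lemma costate_dynamics_continuous:
  assumes L: "Lipschitz_dynamics_at P t c \<delta> L"
  shows "continuous_on (ball c \<delta>) (\<lambda>(y, z). p \<bullet> dyn P t y z)"
proof (rule lipschitz_on_continuous_on)
  show "(norm p * \<bar>L\<bar>)-lipschitz_on (ball c \<delta>) (\<lambda>(y, z). p \<bullet> dyn P t y z)"
  proof (rule lipschitz_onI)
    fix w w' assume "w \<in> ball c \<delta>" "w' \<in> ball c \<delta>"
    from costate_dynamics_Lipschitz[OF L this, of p]
    have "dist (case w of (y, z) \<Rightarrow> p \<bullet> dyn P t y z) (case w' of (y, z) \<Rightarrow> p \<bullet> dyn P t y z) \<le> norm p * L * dist w w'"
      by (simp add: dist_norm)
    also have "\<dots> \<le> norm p * \<bar>L\<bar> * dist w w'" by (intro mult_right_mono mult_left_mono) auto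
    finally show "dist (case w of (y, z) \<Rightarrow> p \<bullet> dyn P t y z) (case w' of (y, z) \<Rightarrow> p \<bullet> dyn P t y z) \<le> norm p * \<bar>L\<bar> * dist w w'" .
  qed simp
qed

text \<open>
  This bound, with an \<open>L\<close> that does not involve the multipliers \<open>q\<close> and \<open>r\<close>, is what makes
  the nonsmooth part of the adjoint inclusion weakly compact.
\<close>
lemma costate_subdiff_norm_le:
  assumes L: "Lipschitz_dynamics_at P t c \<delta> L" "L \<ge> 0" and w: "w \<in> ball c \<delta>" and p: "norm p \<le> 1"
    and v: "v \<in> convex hull (limiting_subdiff (\<lambda>(y, z). p \<bullet> dyn P t y z) w)"
  shows "norm v \<le> L"
proof -
  have "norm x \<le> norm p * L" if "x \<in> limiting_subdiff (\<lambda>(y, z). p \<bullet> dyn P t y z) w" for x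
    by (rule limiting_subdiff_norm_le[OF open_ball w costate_dynamics_Lipschitz[OF L(1)] that])
  moreover have "norm p * L \<le> L" using p L(2) by (simp add: mult_left_le_one_le)
  ultimately have "limiting_subdiff (\<lambda>(y, z). p \<bullet> dyn P t y z) w \<subseteq> cball 0 L" by force
  then have "convex hull (limiting_subdiff (\<lambda>(y, z). p \<bullet> dyn P t y z) w) \<subseteq> cball 0 L"
    by (rule hull_minimal) simp
  then show ?thesis using v by auto
qed

lemma costate_subdiff_limit:
  assumes L: "Lipschitz_dynamics_at P t c \<delta> L" "L \<ge> 0" and "\<delta> > 0"
    and w: "\<And>k. wk k \<in> ball c \<delta>" "wk \<longlonglongrightarrow> c" and p: "\<And>k. norm (pk k) \<le> 1" "pk \<longlonglongrightarrow> p"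
    and vk: "\<And>k. vk k \<in> convex hull (limiting_subdiff (\<lambda>(y, z). pk k \<bullet> dyn P t y z) (wk k))"
    and v: "\<And>n. v \<in> closure (convex hull {vk k |k. k \<ge> n})"
  shows "v \<in> convex hull (limiting_subdiff (\<lambda>(y, z). p \<bullet> dyn P t y z) c)"
proof (rule hull_subdiff_upper_semicontinuous[OF \<open>\<delta> > 0\<close> costate_dynamics_continuous[OF L(1)] _ _ w(2) _ _ vk v])
  have p1: "norm p \<le> 1" by (rule Lim_bounded[OF tendsto_norm[OF p(2)]]) (use p(1) in auto)
  show "norm x \<le> L" if "x \<in> limiting_subdiff (\<lambda>(y, z). pk k \<bullet> dyn P t y z) (wk k)" for k x
    by (rule costate_subdiff_norm_le[OF L w(1) p(1) hull_inc[OF that]])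
  show "norm x \<le> L" if "x \<in> limiting_subdiff (\<lambda>(y, z). p \<bullet> dyn P t y z) c" for x
    by (rule costate_subdiff_norm_le[OF L _ p1 hull_inc[OF that]]) (use \<open>\<delta> > 0\<close> in simp)
  have "(\<lambda>k. norm (pk k - p) * L) \<longlonglongrightarrow> norm (p - p) * L" by (intro tendsto_intros p(2))
  then show "(\<lambda>k. norm (pk k - p) * L) \<longlonglongrightarrow> 0" by simp
  fix k y y' assume "y \<in> ball c \<delta>" "y' \<in> ball c \<delta>"
  from costate_dynamics_Lipschitz[OF L(1) this, of "pk k - p"]
  show "\<bar>(case y of (y, z) \<Rightarrow> pk k \<bullet> dyn P t y z) - (case y of (y, z) \<Rightarrow> p \<bullet> dyn P t y z)
      - ((case y' of (y, z) \<Rightarrow> pk k \<bullet> dyn P t y z) - (case y' of (y, z) \<Rightarrow> p \<bullet> dyn P t y z))\<bar>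
      \<le> norm (pk k - p) * L * norm (y - y')"
    by (simp add: case_prod_beta inner_diff_left algebra_simps)
qed

lemma Linf_norm_sum_eq_one:
  fixes p :: "real \<Rightarrow> 'a::euclidean_space"
  assumes "a < b" "lam \<ge> 0" "ereal lam + Linf_norm (lebesgue_on {a..b}) p = 1"
  shows "lam \<le> 1" and "AE t in lebesgue_on {a..b}. norm (p t) \<le> 1"
proof -
  have AE: "AE t in lebesgue_on {a..b}. ereal (norm (p t)) \<le> Linf_norm (lebesgue_on {a..b}) p"
    unfolding Linf_norm_def by (rule esssup_AE)
  then obtain t where "ereal (norm (p t)) \<le> Linf_norm (lebesgue_on {a..b}) p"
    by (rule AE_interval_ex[OF _ \<open>a < b\<close>])
  then have "0 \<le> Linf_norm (lebesgue_on {a..b}) p" by (rule order_trans[rotated]) simp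
  then obtain \<rho> where \<rho>: "Linf_norm (lebesgue_on {a..b}) p = ereal \<rho>" "\<rho> \<ge> 0" "lam + \<rho> = 1"
    using assms(3) by (cases "Linf_norm (lebesgue_on {a..b}) p") auto
  show "lam \<le> 1" using \<rho> by simp
  show "AE t in lebesgue_on {a..b}. norm (p t) \<le> 1"
    using AE by eventually_elim (use \<rho> assms(2) in auto)
qed

text \<open>
  The normalisation passes to the limit because the costates converge uniformly; weak
  convergence would not suffice.
\<close>
lemma Linf_norm_limit_nonzero:
  fixes p :: "real \<Rightarrow> 'a::euclidean_space"
  assumes "a < b" and pm: "\<And>k. pk k \<in> borel_measurable (lebesgue_on {a..b})"
    and lam0: "lam \<ge> 0"
    and one: "\<And>k. ereal (lamk k) + Linf_norm (lebesgue_on {a..b}) (pk k) = 1"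
    and lam: "lamk \<longlonglongrightarrow> lam" and p: "uniform_limit {a..b} pk p sequentially"
  shows "ereal lam + Linf_norm (lebesgue_on {a..b}) p \<noteq> 0"
proof
  assume "ereal lam + Linf_norm (lebesgue_on {a..b}) p = 0"
  then have eq: "Linf_norm (lebesgue_on {a..b}) p = ereal (- lam)"
    by (cases "Linf_norm (lebesgue_on {a..b}) p") auto
  have AE: "AE t in lebesgue_on {a..b}. ereal (norm (p t)) \<le> Linf_norm (lebesgue_on {a..b}) p"
    unfolding Linf_norm_def by (rule esssup_AE)
  then obtain t where "norm (p t) \<le> - lam" using AE_interval_ex[OF AE \<open>a < b\<close>] unfolding eq by auto
  then have "lam = 0" using lam0 norm_ge_zero[of "p t"] by linarith
  then have p0: "AE t in lebesgue_on {a..b}. p t = 0" using AE unfolding eq by auto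
  have "\<forall>\<^sub>F k in sequentially. (\<forall>t\<in>{a..b}. dist (pk k t) (p t) < 1/2) \<and> lamk k < 1/2"
    using uniform_limitD[OF p, of "1/2"] order_tendstoD(2)[OF lam, of "1/2"] \<open>lam = 0\<close>
    by (auto intro: eventually_conj)
  then obtain k where k: "\<forall>t\<in>{a..b}. dist (pk k t) (p t) < 1/2" "lamk k < 1/2"
    by (auto simp: eventually_sequentially)
  have "AE t in lebesgue_on {a..b}. ereal (norm (pk k t)) \<le> ereal (1/2)"
    using p0 AE_space by eventually_elim (use k(1) in \<open>force simp: dist_norm\<close>)
  then have "Linf_norm (lebesgue_on {a..b}) (pk k) \<le> ereal (1/2)"
    unfolding Linf_norm_def using pm by (intro esssup_I) auto
  then have "ereal (lamk k) + Linf_norm (lebesgue_on {a..b}) (pk k) \<le> ereal (lamk k + 1/2)"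
    using add_left_mono[of "Linf_norm (lebesgue_on {a..b}) (pk k)" "ereal (1/2)" "ereal (lamk k)"] by simp
  with one[of k] k(2) show False by (simp add: one_ereal_def)
qed

section \<open>The weak maximum principle\<close>

theorem theorem3p7:
  fixes P :: "('n::finite, 'm::finite, 'mb::finite, 'mg::finite) problem"
    and xb :: "real \<Rightarrow> real^'n" and ub :: "real \<Rightarrow> real^'m" and \<delta> :: real
    and xk :: "nat \<Rightarrow> real \<Rightarrow> real^'n" and uk \<zeta>k :: "nat \<Rightarrow> real \<Rightarrow> real^'m"
    and pk :: "nat \<Rightarrow> real \<Rightarrow> real^'n" and qk :: "nat \<Rightarrow> real \<Rightarrow> real^'mb"
    and rk :: "nat \<Rightarrow> real \<Rightarrow> real^'mg" and lamk :: "nat \<Rightarrow> real"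
    and eps :: "nat \<Rightarrow> real \<Rightarrow> real^'n" and eta :: "nat \<Rightarrow> real \<Rightarrow> real^'m"
  assumes "valid_problem P"
    and "weak_local_minimizer P xb ub"
    and "\<delta> > 0"
    and "H1 P xb ub \<delta>" and "H2 P ub \<delta>" and "H3 P xb" and "H4 P"
    and "H5 P xb ub \<delta>" and "H6 P xb ub" and "H7 P xb ub \<delta>"
    and "AWMP_sequence P ub \<delta> xk uk \<zeta>k pk qk rk lamk eps eta"
    and "converges_to_process P xk uk xb ub"
    and in_tube: "\<forall>\<^sub>F k in sequentially. AE t in T_meas P. (xk k t, uk k t) \<in> interior (Omega_at \<delta> xb ub t)"
    and H8: "\<exists>c_eps c_eta. integrable (T_meas P) c_eps \<and> integrable (T_meas P) c_eta \<and>
      (\<forall>k. AE t in T_meas P. norm (eps k t) \<le> c_eps t \<and> norm (eta k t) \<le> c_eta t)"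
    and H9: "\<exists>c_phi. integrable (T_meas P) c_phi \<and>
      (\<forall>k. AE t in T_meas P.
         norm ((\<Sum>i\<in>UNIV. (qk k t $ i) *\<^sub>R gradx_b P i t (xk k t) (uk k t)) +
               (\<Sum>j\<in>UNIV. (rk k t $ j) *\<^sub>R gradx_g P j t (xk k t) (uk k t))) \<le> c_phi t)"
    and "AWMP_regular P xb ub \<delta>"
  shows "\<exists>(lam::real) (p :: real \<Rightarrow> real^'n) (q :: real \<Rightarrow> real^'mb) (r :: real \<Rightarrow> real^'mg)
            (\<zeta> :: real \<Rightarrow> real^'m).
     lam \<ge> 0 \<and> p \<in> W11_of P \<and> integrable (T_meas P) q \<and> integrable (T_meas P) r \<and>
     integrable (T_meas P) \<zeta> \<and>
     ereal lam + Linf_norm (T_meas P) p \<noteq> 0 \<and>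
     (AE t in T_meas P. (- dot P p t, \<zeta> t)
        \<in> convex hull (subdiff_Ham P t (xb t) (p t) (q t) (r t) (ub t))) \<and>
     (AE t in T_meas P. \<zeta> t \<in> convex hull (limiting_normal_cone (ctrl P t) (ub t))) \<and>
     (AE t in T_meas P. r t \<bullet> ineqc P t (xb t) (ub t) = 0 \<and> (\<forall>j. r t $ j \<le> 0)) \<and>
     (p (t0 P), - p (t1 P)) \<in> transversality_set P lam (xb (t0 P), xb (t1 P))"
proof -
  define a b where "a = t0 P" and "b = t1 P"
  have ab: "a < b" using \<open>valid_problem P\<close> by (simp add: valid_problem_def a_def b_def)
  define M where "M = T_meas P"
  have M: "M = lebesgue_on {a..b}" by (simp add: M_def a_def b_def)
  note fold = a_def[symmetric] b_def[symmetric] M[symmetric]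
  have fin: "finite_measure M" unfolding M by (rule finite_measure_lebesgue_on) auto
  have feas: "feasible_process P xb ub"
    using \<open>weak_local_minimizer P xb ub\<close> by (simp add: weak_local_minimizer_def)
  have xbW: "xb \<in> W11 a b" and ubi: "integrable M ub"
    using feas unfolding feasible_process_def is_process_def fold by auto
  have xbm: "xb \<in> borel_measurable M" unfolding M by (rule W11_measurable[OF xbW])
  have ubm: "ub \<in> borel_measurable M" using ubi by auto

  have Omega: "Omega_at \<delta> xb ub t = cball (xb t, ub t) \<delta>" for t
  proof (rule set_eqI)
    fix w show "w \<in> Omega_at \<delta> xb ub t \<longleftrightarrow> w \<in> cball (xb t, ub t) \<delta>"
      by (cases w) (simp only: Omega_at_def mem_Collect_eq prod.case mem_cball
          dist_norm[of "(xb t, ub t)"] norm_minus_commute[of "(xb t, ub t)"])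
  qed
  obtain kf where kf: "integrable M kf" and kfL: "AE t in M. Lipschitz_dynamics_at P t (xb t, ub t) \<delta> (kf t)"
  proof -
    obtain kf where kf: "integrable M kf" and L: "AE t in M.
        \<forall>(x, u)\<in>Omega_at \<delta> xb ub t. \<forall>(x', u')\<in>Omega_at \<delta> xb ub t.
           norm (dyn P t x u - dyn P t x' u') \<le> kf t * norm ((x, u) - (x', u'))"
      using \<open>H1 P xb ub \<delta>\<close> unfolding H1_def fold by blast
    have "AE t in M. Lipschitz_dynamics_at P t (xb t, ub t) \<delta> (kf t)"
      using L
    proof eventually_elim
      case (elim t)
      show ?case unfolding Lipschitz_dynamics_at_def
      proof (intro ballI)
        fix w w' assume w: "w \<in> cball (xb t, ub t) \<delta>" and w': "w' \<in> cball (xb t, ub t) \<delta>"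
        from bspec[OF bspec[OF elim[unfolded Omega case_prod_unfold prod.collapse] w] w']
        show "norm (dyn P t (fst w) (snd w) - dyn P t (fst w') (snd w')) \<le> kf t * norm (w - w')" .
      qed
    qed
    with kf show thesis by (rule that)
  qed
  \<comment> \<open>The modulus \<open>kf\<close> may be negative on a null set.\<close>
  define L where "L t = \<bar>kf t\<bar>" for t
  have Li: "integrable M L" unfolding L_def using kf by simp
  have LL: "AE t in M. Lipschitz_dynamics_at P t (xb t, ub t) \<delta> (L t)"
    using kfL
  proof eventually_elim
    case (elim t)
    have "kf t * norm (w - w') \<le> L t * norm (w - w')" for w w' :: "(real^'n) \<times> (real^'m)"
      unfolding L_def by (intro mult_right_mono) auto
    with elim show ?case unfolding Lipschitz_dynamics_at_def by (meson order_trans)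
  qed
  have C1: "AE t in M. C1_constraints_at P t (xb t, ub t) \<delta>"
    using \<open>H5 P xb ub \<delta>\<close> unfolding H5_def C1_constraints_at_def fold by blast

  obtain \<theta> \<upsilon> \<nu> where
    xkW: "\<And>k. xk k \<in> W11 a b" and uki: "\<And>k. integrable M (uk k)" and \<zeta>ki: "\<And>k. integrable M (\<zeta>k k)"
    and pkW: "\<And>k. pk k \<in> W11 a b" and qki: "\<And>k. integrable M (qk k)" and rki: "\<And>k. integrable M (rk k)"
    and lam0: "\<And>k. 0 \<le> lamk k" and \<theta>: "\<And>k. nonpos_L1 P (\<theta> k)"
    and one: "\<And>k. ereal (lamk k) + Linf_norm M (pk k) = 1"
    and incl: "\<And>k. AE t in M. (- wderiv a b (pk k) t, \<zeta>k k t) - (eps k t, eta k t)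
        \<in> convex hull (subdiff_Ham P t (xk k t) (pk k t) (qk k t) (rk k t) (uk k t))"
    and normal: "\<And>k. AE t in M. \<zeta>k k t \<in> limiting_normal_cone (U_at P \<delta> ub t) (uk k t)"
    and compl: "\<And>k. AE t in M. \<forall>j. rk k t $ j * g_minus P j t (xk k t) (uk k t) = \<theta> k t $ j \<and> rk k t $ j \<le> 0"
    and trans: "\<And>k. (pk k a, - pk k b) - (\<upsilon> k, \<nu> k) \<in> transversality_set P (lamk k) (xk k a, xk k b)"
    and eps: "weak_L1_tendsto M eps (\<lambda>_. 0)" and eta: "weak_L1_tendsto M eta (\<lambda>_. 0)"
    and \<theta>0: "\<And>j. AE t in M. (\<lambda>k. \<theta> k t $ j) \<longlonglongrightarrow> 0" and \<upsilon>: "\<upsilon> \<longlonglongrightarrow> 0" and \<nu>: "\<nu> \<longlonglongrightarrow> 0"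
    using \<open>AWMP_sequence P ub \<delta> xk uk \<zeta>k pk qk rk lamk eps eta\<close> unfolding AWMP_sequence_def fold by blast
  have xlim: "uniform_limit {a..b} xk xb sequentially" and ulim: "L1_tendsto M uk ub"
    using \<open>converges_to_process P xk uk xb ub\<close> unfolding converges_to_process_def fold by auto
  obtain ce ct where ce: "integrable M ce" and ct: "integrable M ct"
    and ebd: "\<And>k. AE t in M. norm (eps k t) \<le> ce t \<and> norm (eta k t) \<le> ct t"
    using H8 unfolding fold by blast
  obtain cp where cp: "integrable M cp" and cpbd: "\<And>k. AE t in M.
      norm ((\<Sum>i\<in>UNIV. (qk k t $ i) *\<^sub>R gradx_b P i t (xk k t) (uk k t)) +
            (\<Sum>j\<in>UNIV. (rk k t $ j) *\<^sub>R gradx_g P j t (xk k t) (uk k t))) \<le> cp t"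
    using H9 unfolding fold by blast
  have lam1: "lamk k \<le> 1" and p1: "AE t in M. norm (pk k t) \<le> 1" for k
    using Linf_norm_sum_eq_one[OF ab lam0[of k] one[of k, unfolded M]] unfolding M by auto
  have pkm: "pk k \<in> borel_measurable M" and xkm: "xk k \<in> borel_measurable M" for k
    unfolding M by (rule W11_measurable[OF pkW], rule W11_measurable[OF xkW])
  obtain N1 where N1: "\<And>k. k \<ge> N1 \<Longrightarrow> AE t in M. (xk k t, uk k t) \<in> ball (xb t, ub t) \<delta>"
    using in_tube unfolding fold Omega interior_cball eventually_sequentially by blast

  \<comment> \<open>\<open>W k\<close> is what remains of the inclusion once the perturbation and the smooth part are removed.\<close>
  define dp where "dp k = wderiv a b (pk k)" for k
  have dp: "has_wderiv a b (pk k) (dp k)" for k unfolding dp_def by (rule has_wderiv_wderiv[OF pkW])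
  define cg where "cg k t = constraint_gradient P (qk k t) (rk k t) t (xk k t) (uk k t)" for k t
  define W where "W k t = (- dp k t, \<zeta>k k t) - (eps k t, eta k t) - cg k t" for k t
  have Wsub: "AE t in M. W k t \<in> convex hull (limiting_subdiff (\<lambda>(y, z). pk k t \<bullet> dyn P t y z) (xk k t, uk k t))"
    if "k \<ge> N1" for k
    using incl[of k] N1[OF that] C1 LL
  proof eventually_elim
    case (elim t)
    have "isCont (\<lambda>(y, z). pk k t \<bullet> dyn P t y z) (xk k t, uk k t)"
      using costate_dynamics_continuous[OF elim(4), of "pk k t"] elim(2)
      by (simp add: continuous_on_eq_continuous_at)
    from hull_subdiff_Ham_iff[OF elim(3,2) this] elim(1) show ?case
      by (simp add: W_def cg_def dp_def)
  qed
  have Wbd: "AE t in M. norm (W k t) \<le> L t" if "k \<ge> N1" for k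
    using Wsub[OF that] N1[OF that] LL p1[of k]
    by eventually_elim (rule costate_subdiff_norm_le; simp add: L_def)
  have cgbd: "AE t in M. norm (fst (cg k t)) \<le> cp t" if "k \<ge> N1" for k
    using cpbd[of k] C1 N1[OF that]
    by eventually_elim (simp add: cg_def fst_constraint_gradient)
  have cgm: "cg k \<in> borel_measurable M" if "k \<ge> N1" for k
    unfolding cg_def M_def
    by (rule constraint_gradient_measurable[OF \<open>H4 P\<close> C1[unfolded M_def] _ _ _ _ _ _ N1[OF that, unfolded M_def]])
      (use xbm ubm xkm uki qki rki in \<open>auto simp: M_def\<close>)
  have int: "integrable M (dp k)" "integrable M (eps k)" "integrable M (eta k)" for k
    using dp[of k] eps eta by (auto simp: has_wderiv_def M weak_L1_tendsto_def)
  have Wm: "W k \<in> borel_measurable M" if "k \<ge> N1" for k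
    unfolding W_def using cgm[OF that] int[of k] \<zeta>ki[of k] by auto
  have dp_split: "dp k t = - (eps k t + (fst (W k t) + fst (cg k t)))" for k t
    by (simp add: W_def)
  have dpbd: "AE t in M. norm (dp k t) \<le> ce t + L t + cp t" if "k \<ge> N1" for k
    using ebd[of k] Wbd[OF that] cgbd[OF that]
  proof eventually_elim
    case (elim t)
    have "norm (dp k t) \<le> norm (eps k t) + (norm (fst (W k t)) + norm (fst (cg k t)))"
      unfolding dp_split norm_minus_cancel by (intro norm_triangle_le add_left_mono norm_triangle_ineq order_refl)
    then show ?case using elim norm_fst_le[of "fst (W k t)" "snd (W k t)"] unfolding prod.collapse by linarith
  qed

  define ek where "ek k = (xk k a, xk k b)" for k
  define eb where "eb = (xb a, xb b)"
  have eklim: "ek \<longlonglongrightarrow> eb"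
    unfolding ek_def eb_def using ab by (intro tendsto_Pair tendsto_uniform_limitI[OF xlim]) auto
  have "\<exists>s c. (pk k a, - pk k b) - (\<upsilon> k, \<nu> k) = lamk k *\<^sub>R s + c \<and> s \<in> limiting_subdiff (cost P) (ek k)
      \<and> c \<in> limiting_normal_cone (endpts P) (ek k)" for k
    using trans[of k] unfolding transversality_set_def ek_def by blast
  then obtain sk ck where sk: "\<And>k. (pk k a, - pk k b) - (\<upsilon> k, \<nu> k) = lamk k *\<^sub>R sk k + ck k"
    and sksub: "\<And>k. sk k \<in> limiting_subdiff (cost P) (ek k)"
    and cknorm: "\<And>k. ck k \<in> limiting_normal_cone (endpts P) (ek k)" by metis
  obtain \<rho> K where \<rho>: "\<rho> > 0" and K: "K-lipschitz_on (ball eb \<rho>) (cost P)"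
    using \<open>H3 P xb\<close> unfolding H3_def fold eb_def by blast
  have costcont: "continuous_on (ball eb \<rho>) (cost P)" by (rule lipschitz_on_continuous_on[OF K])
  obtain N2 where N2: "\<And>k. k \<ge> N2 \<Longrightarrow> ek k \<in> ball eb \<rho>"
    using topological_tendstoD[OF eklim open_ball, of eb \<rho>] \<rho> by (auto simp: eventually_sequentially)
  have skbd: "norm (sk k) \<le> K" if "k \<ge> N2" for k
    by (rule limiting_subdiff_norm_le[OF open_ball N2[OF that] _ sksub])
      (use lipschitz_onD[OF K] in \<open>simp add: dist_norm\<close>)
  define N where "N = max N1 N2"

  define mm where "mm t = ce t + L t + cp t" for t
  have mm: "integrable M mm" unfolding mm_def using ce Li cp by simp
  define G where "G t = (0::real) + (\<integral>s. mm s \<partial>lebesgue_on {a..t})" for t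
  have G: "has_wderiv a b G mm" unfolding G_def
    by (rule has_wderiv_primitive) (use mm ab in \<open>auto simp: M\<close>)
  have "\<exists>KG. \<forall>t\<in>{a..b}. \<bar>G t\<bar> \<le> KG"
    using compact_imp_bounded[OF compact_continuous_image[OF has_wderiv_continuous[OF G] compact_Icc]]
    by (simp add: bounded_iff)
  then obtain KG where KG: "\<And>t. t \<in> {a..b} \<Longrightarrow> \<bar>G t\<bar> \<le> KG" by blast
  \<comment> \<open>The normalisation bounds \<open>pk\<close> only almost everywhere; the increment bound through \<open>G\<close>
     transports it to the endpoint \<open>a\<close>.\<close>
  have pkabd: "norm (pk k a) \<le> 1 + 2 * KG" if "k \<ge> N1" for k
  proof -
    obtain t where t: "t \<in> {a..b}" "norm (pk k t) \<le> 1"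
      by (rule AE_interval_ex[OF p1[of k, unfolded M] ab])
    have "norm (pk k a - pk k t) \<le> \<bar>G a - G t\<bar>"
      by (rule has_wderiv_increment_le[OF dp G _ t(1)]) (use dpbd[OF that, unfolded M] ab in \<open>auto simp: mm_def\<close>)
    moreover have "\<bar>G a\<bar> \<le> KG" "\<bar>G t\<bar> \<le> KG" using KG t(1) ab by auto
    ultimately have "norm (pk k a - pk k t) \<le> 2 * KG" by linarith
    then show ?thesis using t(2) norm_triangle_ineq[of "pk k a - pk k t" "pk k t"] by simp
  qed
  \<comment> \<open>The shift by \<open>N\<close> discards the indices at which the process may leave the tube or the
     neighbourhood where the cost is Lipschitz.\<close>
  define zz where "zz k = (lamk (k + N), pk (k + N) a, sk (k + N))" for k
  have "bounded (range zz)"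
  proof (rule boundedI)
    fix z assume "z \<in> range zz"
    then obtain k where z: "z = zz k" by blast
    have "norm (zz k) \<le> norm (lamk (k + N)) + (norm (pk (k + N) a) + norm (sk (k + N)))"
      unfolding zz_def by (intro norm_Pair_le[THEN order_trans] add_left_mono norm_Pair_le)
    also have "\<dots> \<le> 1 + ((1 + 2 * KG) + K)"
      using lam0[of "k + N"] lam1[of "k + N"] pkabd[of "k + N"] skbd[of "k + N"]
      by (intro add_mono) (auto simp: N_def)
    finally show "norm z \<le> 1 + ((1 + 2 * KG) + K)" by (simp add: z)
  qed
  then obtain zl \<tau>1 where \<tau>1: "strict_mono (\<tau>1 :: nat \<Rightarrow> nat)" and zl: "(zz \<circ> \<tau>1) \<longlonglongrightarrow> zl"
    using bounded_imp_convergent_subsequence by blast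
  obtain lam pa s where zl_eq: "zl = (lam, pa, s)" by (cases zl)
  have l1: "(\<lambda>k. lamk (\<tau>1 k + N)) \<longlonglongrightarrow> lam" "(\<lambda>k. pk (\<tau>1 k + N) a) \<longlonglongrightarrow> pa" "(\<lambda>k. sk (\<tau>1 k + N)) \<longlonglongrightarrow> s"
    using tendsto_fst[OF zl] tendsto_fst[OF tendsto_snd[OF zl]] tendsto_snd[OF tendsto_snd[OF zl]]
    by (auto simp: zz_def o_def zl_eq)
  have \<tau>1N: "strict_mono (\<lambda>k. \<tau>1 k + N)" using \<tau>1 by (auto simp: strict_mono_def)
  have "(\<lambda>k. \<integral>t. norm (uk k t - ub t) \<partial>M) \<longlonglongrightarrow> 0" using ulim by (simp add: L1_tendsto_def)
  from LIMSEQ_subseq_LIMSEQ[OF this \<tau>1N]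
  have "(\<lambda>k. \<integral>t. norm (uk (\<tau>1 k + N) t - ub t) \<partial>M) \<longlonglongrightarrow> 0" by (simp add: o_def)
  then obtain \<tau>2 :: "nat \<Rightarrow> nat" where \<tau>2: "strict_mono \<tau>2"
    and u0: "AE t in M. (\<lambda>k. uk (\<tau>1 (\<tau>2 k) + N) t - ub t) \<longlonglongrightarrow> 0"
    using tendsto_L1_AE_subseq[of M "\<lambda>k t. uk (\<tau>1 k + N) t - ub t"] uki ubi by auto
  define \<sigma>0 where "\<sigma>0 k = \<tau>1 (\<tau>2 k) + N" for k
  have \<sigma>0N: "\<sigma>0 k \<ge> N1" for k by (simp add: \<sigma>0_def N_def)
  \<comment> \<open>The nonsmooth part and the \<open>x\<close>-gradient are extracted jointly, so that one subsequence serves both.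
     The summand 1 in \<open>m\<close> makes the weight positive.\<close>
  define F where "F k t = (W (\<sigma>0 k) t, fst (cg (\<sigma>0 k) t))" for k t
  define m where "m t = L t + \<bar>cp t\<bar> + 1" for t
  have mi: "integrable M m"
    unfolding m_def using Li cp finite_measure.integrable_const[OF fin, of "1::real"]
    by (intro Bochner_Integration.integrable_add integrable_abs)
  have Fdom: "dominated_by M m (F k)" for k
    unfolding dominated_by_def
  proof
    show "F k \<in> borel_measurable M"
      unfolding F_def using Wm[OF \<sigma>0N] borel_measurable_continuous_on[OF continuous_on_fst[OF continuous_on_id] cgm[OF \<sigma>0N]]
      by (intro borel_measurable_Pair)
    show "AE t in M. norm (F k t) \<le> m t"
      using Wbd[OF \<sigma>0N[of k]] cgbd[OF \<sigma>0N[of k]]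
    proof eventually_elim
      case (elim t)
      then show ?case
        using norm_Pair_le[of "W (\<sigma>0 k) t" "fst (cg (\<sigma>0 k) t)"] abs_ge_self[of "cp t"] by (simp add: F_def m_def)
    qed
  qed
  obtain \<tau>3 h where \<tau>3: "strict_mono (\<tau>3 :: nat \<Rightarrow> nat)" and Fweak: "weak_L1_tendsto M (\<lambda>k. F (\<tau>3 k)) h"
    and Fcl: "AE t in M. \<forall>n. h t \<in> closure (convex hull {F (\<tau>3 k) t |k. k \<ge> n})"
    by (rule dominated_weak_compactness[OF mi _ Fdom]) (auto simp: m_def L_def add_pos_nonneg add_nonneg_pos)
  define \<sigma> where "\<sigma> k = \<sigma>0 (\<tau>3 k)" for k
  have \<sigma>: "strict_mono \<sigma>" using \<tau>1 \<tau>2 \<tau>3 by (auto simp: \<sigma>_def \<sigma>0_def strict_mono_def)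
  have \<sigma>N: "\<sigma> k \<ge> N1" for k by (simp add: \<sigma>_def \<sigma>0N)
  have \<tau>23: "strict_mono (\<lambda>k. \<tau>2 (\<tau>3 k))" using \<tau>2 \<tau>3 by (auto simp: strict_mono_def)
  have l2: "(\<lambda>k. lamk (\<sigma> k)) \<longlonglongrightarrow> lam" "(\<lambda>k. pk (\<sigma> k) a) \<longlonglongrightarrow> pa" "(\<lambda>k. sk (\<sigma> k)) \<longlonglongrightarrow> s"
    using l1[THEN LIMSEQ_subseq_LIMSEQ, OF \<tau>23] by (auto simp: o_def \<sigma>_def \<sigma>0_def)
  have ul: "AE t in M. (\<lambda>k. uk (\<sigma> k) t) \<longlonglongrightarrow> ub t"
    using u0
  proof eventually_elim
    case (elim t)
    from LIMSEQ_subseq_LIMSEQ[OF elim \<tau>3] show ?case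
      by (simp add: o_def \<sigma>_def \<sigma>0_def LIM_zero_iff)
  qed

  define W' where "W' t = fst (h t)" for t
  define \<phi>' where "\<phi>' t = snd (h t)" for t
  define v where "v t = - (fst (W' t) + \<phi>' t)" for t
  have linA: "linear (\<lambda>z :: (((real^'n) \<times> (real^'m)) \<times> (real^'n)). - (fst (fst z) + snd z))"
    "linear (\<lambda>z :: (((real^'n) \<times> (real^'m)) \<times> (real^'n)). - snd (fst z))"
    "linear (snd :: (((real^'n) \<times> (real^'m)) \<times> (real^'n)) \<Rightarrow> real^'n)"
    "linear (fst :: (((real^'n) \<times> (real^'m)) \<times> (real^'n)) \<Rightarrow> (real^'n) \<times> (real^'m))"
    "linear (\<lambda>z :: real^'n. - z)" "linear (\<lambda>z :: real^'m. - z)"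
    by (auto intro!: linearI simp: algebra_simps)
  have dpweak: "weak_L1_tendsto M (\<lambda>k. dp (\<sigma> k)) v"
    using weak_L1_tendsto_add[OF weak_L1_tendsto_linear[OF linA(5) weak_L1_tendsto_subseq[OF eps \<sigma>]]
        weak_L1_tendsto_linear[OF linA(1) Fweak]]
  proof -
    have "(\<lambda>k t. - eps (\<sigma> k) t + - (fst (fst (F (\<tau>3 k) t)) + snd (F (\<tau>3 k) t))) = (\<lambda>k. dp (\<sigma> k))"
      by (simp add: fun_eq_iff dp_split F_def \<sigma>_def)
    moreover have "(\<lambda>t. - 0 + - (fst (fst (h t)) + snd (h t))) = v"
      by (simp add: fun_eq_iff v_def W'_def \<phi>'_def)
    ultimately show "weak_L1_tendsto M (\<lambda>k t. - eps (\<sigma> k) t + - (fst (fst (F (\<tau>3 k) t)) + snd (F (\<tau>3 k) t)))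
        (\<lambda>t. - 0 + - (fst (fst (h t)) + snd (h t))) \<Longrightarrow> ?thesis" by (simp only:)
  qed
  have vi: "integrable M v" using dpweak by (simp add: weak_L1_tendsto_def)
  define p where "p t = pa + (\<integral>s. v s \<partial>lebesgue_on {a..t})" for t
  have pv: "has_wderiv a b p v"
    unfolding p_def by (rule has_wderiv_primitive) (use vi ab in \<open>auto simp: M\<close>)
  have pW: "p \<in> W11 a b" using pv by (auto simp: W11_def)
  have pa: "p a = pa"
  proof -
    have "p b = p a + (\<integral>s. v s \<partial>lebesgue_on {a..b})"
      using pv ab unfolding has_wderiv_def by (meson atLeastAtMost_iff less_imp_le order_refl)
    moreover have "p b = pa + (\<integral>s. v s \<partial>lebesgue_on {a..b})" by (simp only: p_def)
    ultimately show ?thesis by simp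
  qed
  have pu: "uniform_limit {a..b} (\<lambda>k. pk (\<sigma> k)) p sequentially"
  proof (rule has_wderiv_uniform_limit[OF dp pv])
    show "integrable (lebesgue_on {a..b}) mm" using mm by (simp add: M)
    show "AE t in lebesgue_on {a..b}. norm (dp (\<sigma> k) t) \<le> mm t" for k
      using dpbd[OF \<sigma>N, unfolded M] by (simp add: mm_def)
    show "weak_L1_tendsto (lebesgue_on {a..b}) (\<lambda>k. dp (\<sigma> k)) v" using dpweak by (simp add: M)
  qed (use l2 pa ab in auto)
  have plim: "(\<lambda>k. pk (\<sigma> k) t) \<longlonglongrightarrow> p t" if "t \<in> {a..b}" for t
    by (rule tendsto_uniform_limitI[OF pu that])
  have W'sub: "AE t in M. W' t \<in> convex hull (limiting_subdiff (\<lambda>(y, z). p t \<bullet> dyn P t y z) (xb t, ub t))"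
  proof -
    have "AE t in M. \<forall>k. W (\<sigma> k) t \<in> convex hull (limiting_subdiff (\<lambda>(y, z). pk (\<sigma> k) t \<bullet> dyn P t y z) (xk (\<sigma> k) t, uk (\<sigma> k) t))"
      "AE t in M. \<forall>k. (xk (\<sigma> k) t, uk (\<sigma> k) t) \<in> ball (xb t, ub t) \<delta>"
      "AE t in M. \<forall>k. norm (pk (\<sigma> k) t) \<le> 1"
      using Wsub[OF \<sigma>N] N1[OF \<sigma>N] p1 by (auto simp: AE_all_countable)
    then show ?thesis using ul LL Fcl AE_space
    proof eventually_elim
      case (elim t)
      have t: "t \<in> {a..b}" using elim(7) by (simp add: M)
      show ?case
      proof (rule costate_subdiff_limit[OF elim(5)])
        show "0 \<le> L t" by (simp add: L_def)
        show "0 < \<delta>" by fact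
        show "(xk (\<sigma> k) t, uk (\<sigma> k) t) \<in> ball (xb t, ub t) \<delta>" for k using elim(2) by blast
        have "(\<lambda>k. xk (\<sigma> k) t) \<longlonglongrightarrow> xb t"
          using LIMSEQ_subseq_LIMSEQ[OF tendsto_uniform_limitI[OF xlim t] \<sigma>] by (simp add: o_def)
        then show "(\<lambda>k. (xk (\<sigma> k) t, uk (\<sigma> k) t)) \<longlonglongrightarrow> (xb t, ub t)"
          using elim(4) by (intro tendsto_Pair)
        show "norm (pk (\<sigma> k) t) \<le> 1" for k using elim(3) by blast
        show "(\<lambda>k. pk (\<sigma> k) t) \<longlonglongrightarrow> p t" by (rule plim[OF t])
        show "W (\<sigma> k) t \<in> convex hull (limiting_subdiff (\<lambda>(y, z). pk (\<sigma> k) t \<bullet> dyn P t y z) (xk (\<sigma> k) t, uk (\<sigma> k) t))" for k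
          using elim(1) by blast
        fix n
        have "W' t \<in> fst ` closure (convex hull {F (\<tau>3 k) t |k. k \<ge> n})"
          using elim(6) by (auto simp: W'_def)
        also have "\<dots> \<subseteq> closure (fst ` (convex hull {F (\<tau>3 k) t |k. k \<ge> n}))"
          by (rule closure_linear_image_subset[OF linA(4)])
        also have "fst ` (convex hull {F (\<tau>3 k) t |k. k \<ge> n}) = convex hull (fst ` {F (\<tau>3 k) t |k. k \<ge> n})"
          by (rule convex_hull_linear_image[OF linA(4)])
        also have "fst ` {F (\<tau>3 k) t |k. k \<ge> n} = {W (\<sigma> k) t |k. k \<ge> n}"
          by (force simp: F_def \<sigma>_def)
        finally show "W' t \<in> closure (convex hull {W (\<sigma> k) t |k. k \<ge> n})" .
      qed
    qed
  qed

  \<comment> \<open>Neither \<open>\<zeta>k\<close> nor the \<open>u\<close>-gradient has a bound uniform in \<open>k\<close>; by the Hamiltonian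
     inclusion their difference does.\<close>
  define \<psi> where "\<psi> k t = snd (cg k t) - \<zeta>k k t" for k t
  have \<psi>_split: "\<psi> k t = - eta k t + - snd (W k t)" for k t
    by (simp add: \<psi>_def W_def)
  have \<psi>weak: "weak_L1_tendsto M (\<lambda>k. \<psi> (\<sigma> k)) (\<lambda>t. - snd (W' t))"
    using weak_L1_tendsto_add[OF weak_L1_tendsto_linear[OF linA(6) weak_L1_tendsto_subseq[OF eta \<sigma>]]
        weak_L1_tendsto_linear[OF linA(2) Fweak]]
    by (simp add: F_def \<psi>_split[abs_def] \<sigma>_def W'_def)
  have \<phi>weak: "weak_L1_tendsto M (\<lambda>k t. fst (cg (\<sigma> k) t)) \<phi>'"
    using weak_L1_tendsto_linear[OF linA(3) Fweak]
    by (simp add: F_def \<sigma>_def \<phi>'_def[abs_def])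
  \<comment> \<open>Since the bounded cost subgradients \<open>sk\<close> converge along \<open>\<sigma>\<close>, so do the normals \<open>ck\<close>.\<close>
  define c where "c = (p a, - p b) - lam *\<^sub>R s"
  have cklim: "(\<lambda>k. ck (\<sigma> k)) \<longlonglongrightarrow> c"
  proof -
    have "ck k = (pk k a, - pk k b) - (\<upsilon> k, \<nu> k) - lamk k *\<^sub>R sk k" for k using sk[of k] by simp
    moreover have "(\<lambda>k. (pk (\<sigma> k) a, - pk (\<sigma> k) b) - (\<upsilon> (\<sigma> k), \<nu> (\<sigma> k)) - lamk (\<sigma> k) *\<^sub>R sk (\<sigma> k))
        \<longlonglongrightarrow> (p a, - p b) - (0, 0) - lam *\<^sub>R s"
      using LIMSEQ_subseq_LIMSEQ[OF \<upsilon> \<sigma>] LIMSEQ_subseq_LIMSEQ[OF \<nu> \<sigma>] ab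
      by (intro tendsto_diff tendsto_Pair tendsto_minus tendsto_scaleR l2 plim) (auto simp: o_def)
    ultimately show ?thesis by (simp add: c_def zero_prod_def[symmetric])
  qed
  have ssub: "s \<in> limiting_subdiff (cost P) eb"
  proof (rule limiting_subdiff_closed_graph[OF \<rho> costcont, of "\<lambda>_. cost P" "\<lambda>_. 0"])
    show "(\<lambda>k. ek (\<sigma> k)) \<longlonglongrightarrow> eb" using LIMSEQ_subseq_LIMSEQ[OF eklim \<sigma>] by (simp add: o_def)
  qed (use l2 sksub in auto)
  have "(\<phi>', (\<lambda>t. - snd (W' t)), fst c, snd c) \<in> M_weak_limsup P xb ub \<delta>"
  proof -
    have kpsi: "integrable M (\<lambda>t. L t + ct t)" using Li ct by simp
    have memb: "((\<lambda>t. fst (cg (\<sigma> k) t)), \<psi> (\<sigma> k), fst (ck (\<sigma> k)), snd (ck (\<sigma> k)))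
        \<in> M_set P xb ub \<delta> (\<lambda>t. L t + ct t) (xk (\<sigma> k)) (uk (\<sigma> k)) (\<theta> (\<sigma> k))" for k
    proof -
      have "(xk (\<sigma> k), uk (\<sigma> k)) \<in> Omega P \<delta> xb ub"
        unfolding Omega_def fold Omega mem_Collect_eq prod.case using xkW uki N1[OF \<sigma>N[of k]] by auto
      moreover have "integrable M (\<lambda>t. fst (cg (\<sigma> k) t))" "integrable M (\<psi> (\<sigma> k))"
        using \<phi>weak \<psi>weak by (simp_all add: weak_L1_tendsto_def)
      moreover have "AE t in M.
           (fst (cg (\<sigma> k) t), \<psi> (\<sigma> k) t) = (\<Sum>i\<in>UNIV. (qk (\<sigma> k) t $ i) *\<^sub>R grad_b P i t (xk (\<sigma> k) t) (uk (\<sigma> k) t))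
                     + (\<Sum>j\<in>UNIV. (rk (\<sigma> k) t $ j) *\<^sub>R grad_g P j t (xk (\<sigma> k) t) (uk (\<sigma> k) t)) + (0, - \<zeta>k (\<sigma> k) t) \<and>
           \<zeta>k (\<sigma> k) t \<in> limiting_normal_cone (U_at P \<delta> ub t) (uk (\<sigma> k) t) \<and>
           (\<forall>j. rk (\<sigma> k) t $ j * g_minus P j t (xk (\<sigma> k) t) (uk (\<sigma> k) t) = \<theta> (\<sigma> k) t $ j \<and> rk (\<sigma> k) t $ j \<le> 0) \<and>
           norm (\<psi> (\<sigma> k) t) \<le> L t + ct t"
        using normal[of "\<sigma> k"] compl[of "\<sigma> k"] ebd[of "\<sigma> k"] Wbd[OF \<sigma>N[of k]]
      proof eventually_elim
        case (elim t)
        have "norm (\<psi> (\<sigma> k) t) \<le> norm (eta (\<sigma> k) t) + norm (snd (W (\<sigma> k) t))"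
          unfolding \<psi>_split using norm_triangle_ineq4[of "- eta (\<sigma> k) t" "snd (W (\<sigma> k) t)"] by simp
        also have "\<dots> \<le> L t + ct t" using elim norm_snd_le[of "snd (W (\<sigma> k) t)" "fst (W (\<sigma> k) t)"]
          unfolding prod.collapse by linarith
        finally have "norm (\<psi> (\<sigma> k) t) \<le> L t + ct t" .
        moreover have "(fst (cg (\<sigma> k) t), \<psi> (\<sigma> k) t) = cg (\<sigma> k) t + (0, - \<zeta>k (\<sigma> k) t)"
          by (simp add: \<psi>_def prod_eq_iff)
        ultimately show ?case using elim unfolding cg_def constraint_gradient_def by blast
      qed
      moreover have "(fst (ck (\<sigma> k)), snd (ck (\<sigma> k))) \<in> limiting_normal_cone (endpts P) (xk (\<sigma> k) a, xk (\<sigma> k) b)"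
        using cknorm[of "\<sigma> k"] by (simp add: ek_def)
      ultimately show ?thesis
        unfolding M_set_def fold mem_Collect_eq prod.case using \<theta>[of "\<sigma> k"] qki[of "\<sigma> k"] rki[of "\<sigma> k"] \<zeta>ki[of "\<sigma> k"]
        by blast
    qed
    have conv: "converges_to_process P (\<lambda>k. xk (\<sigma> k)) (\<lambda>k. uk (\<sigma> k)) xb ub"
      unfolding converges_to_process_def fold
    proof
      show "uniform_limit {a..b} (\<lambda>k. xk (\<sigma> k)) xb sequentially"
        using filterlim_compose[OF xlim filterlim_subseq[OF \<sigma>]] .
      show "L1_tendsto M (\<lambda>k. uk (\<sigma> k)) ub"
        using ulim LIMSEQ_subseq_LIMSEQ[OF _ \<sigma>, of "\<lambda>k. \<integral>t. norm (uk k t - ub t) \<partial>M"]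
        unfolding L1_tendsto_def by (auto simp: o_def)
    qed
    have th: "\<forall>j. AE t in M. (\<lambda>k. \<theta> (\<sigma> k) t $ j) \<longlonglongrightarrow> 0"
    proof
      fix j
      show "AE t in M. (\<lambda>k. \<theta> (\<sigma> k) t $ j) \<longlonglongrightarrow> 0"
        using \<theta>0[of j]
      proof eventually_elim
        case (elim t)
        from LIMSEQ_subseq_LIMSEQ[OF elim \<sigma>] show ?case by (simp add: o_def)
      qed
    qed
    show ?thesis unfolding M_weak_limsup_def fold mem_Collect_eq prod.case
      by (rule exI[of _ "\<lambda>t. L t + ct t"], rule exI[of _ "\<lambda>k. xk (\<sigma> k)"], rule exI[of _ "\<lambda>k. uk (\<sigma> k)"],
          rule exI[of _ "\<lambda>k. \<theta> (\<sigma> k)"], rule exI[of _ "\<lambda>k t. fst (cg (\<sigma> k) t)"], rule exI[of _ "\<lambda>k. \<psi> (\<sigma> k)"],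
          rule exI[of _ "\<lambda>k. fst (ck (\<sigma> k))"], rule exI[of _ "\<lambda>k. snd (ck (\<sigma> k))"])
        (intro conjI allI kpsi memb conv th[rule_format] \<phi>weak \<psi>weak tendsto_fst tendsto_snd cklim)
  qed
  then obtain k\<psi> where "(\<phi>', (\<lambda>t. - snd (W' t)), fst c, snd c) \<in> M_set P xb ub \<delta> k\<psi> xb ub (\<lambda>_. 0)"
    using \<open>AWMP_regular P xb ub \<delta>\<close> unfolding AWMP_regular_def by blast
  then obtain q r \<zeta> where qi: "integrable M q" and ri: "integrable M r" and \<zeta>i: "integrable M \<zeta>"
    and mult: "AE t in M.
           (\<phi>' t, - snd (W' t)) = (\<Sum>i\<in>UNIV. (q t $ i) *\<^sub>R grad_b P i t (xb t) (ub t))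
                     + (\<Sum>j\<in>UNIV. (r t $ j) *\<^sub>R grad_g P j t (xb t) (ub t)) + (0, - \<zeta> t) \<and>
           \<zeta> t \<in> limiting_normal_cone (U_at P \<delta> ub t) (ub t) \<and>
           (\<forall>j. r t $ j * g_minus P j t (xb t) (ub t) = (0::real^'mg) $ j \<and> r t $ j \<le> 0)"
    and cN: "(fst c, snd c) \<in> limiting_normal_cone (endpts P) (xb a, xb b)"
    unfolding M_set_def fold by (auto elim!: eventually_mono)

  have dotp: "AE t in M. wderiv a b p t = v t"
    unfolding M by (rule has_wderiv_unique[OF has_wderiv_wderiv[OF pW] pv])
  have "lam \<ge> 0" by (rule LIMSEQ_le_const[OF l2(1)]) (use lam0 in auto)
  moreover have "ereal lam + Linf_norm M p \<noteq> 0"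
    unfolding M
    by (rule Linf_norm_limit_nonzero[OF ab _ \<open>lam \<ge> 0\<close> _ l2(1) pu, OF pkm[unfolded M] one[unfolded M]])
  moreover have "AE t in M. (- wderiv a b p t, \<zeta> t) \<in> convex hull (subdiff_Ham P t (xb t) (p t) (q t) (r t) (ub t))"
    using dotp W'sub mult C1 LL
  proof eventually_elim
    case (elim t)
    have inb: "(xb t, ub t) \<in> ball (xb t, ub t) \<delta>" using \<open>\<delta> > 0\<close> by simp
    have cont: "isCont (\<lambda>(y, z). p t \<bullet> dyn P t y z) (xb t, ub t)"
      using costate_dynamics_continuous[OF elim(5), of "p t"] inb
      by (simp add: continuous_on_eq_continuous_at)
    have "(\<phi>' t, - snd (W' t)) = constraint_gradient P (q t) (r t) t (xb t) (ub t) + (0, - \<zeta> t)"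
      using elim(3) unfolding constraint_gradient_def by blast
    then have "\<phi>' t = fst (constraint_gradient P (q t) (r t) t (xb t) (ub t))"
      and "- snd (W' t) = - (\<zeta> t - snd (constraint_gradient P (q t) (r t) t (xb t) (ub t)))"
      by (simp_all add: prod_eq_iff)
    then have "(- wderiv a b p t, \<zeta> t) - constraint_gradient P (q t) (r t) t (xb t) (ub t) = W' t"
      unfolding neg_equal_iff_equal using elim(1) by (simp add: prod_eq_iff v_def)
    then show ?case unfolding hull_subdiff_Ham_iff[OF elim(4) inb cont] using elim(2) by simp
  qed
  moreover have "AE t in M. \<zeta> t \<in> convex hull (limiting_normal_cone (ctrl P t) (ub t))"
    using mult
  proof eventually_elim
    case (elim t)
    have "\<zeta> t \<in> limiting_normal_cone (cball (ub t) \<delta> \<inter> ctrl P t) (ub t)"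
      using elim unfolding U_at_def by blast
    then show ?case by (rule hull_inc[OF limiting_normal_cone_inter_cball[OF \<open>\<delta> > 0\<close>]])
  qed
  moreover have "AE t in M. r t \<bullet> ineqc P t (xb t) (ub t) = 0 \<and> (\<forall>j. r t $ j \<le> 0)"
  proof -
    have "AE t in M. \<forall>j. ineqc P t (xb t) (ub t) $ j \<le> 0"
      using feas unfolding feasible_process_def fold by (auto elim: eventually_mono)
    with mult show ?thesis
    proof eventually_elim
      case (elim t)
      have "r t $ j * ineqc P t (xb t) (ub t) $ j = 0" for j
      proof -
        have "r t $ j * g_minus P j t (xb t) (ub t) = 0" using elim(1) by simp
        moreover have "g_minus P j t (xb t) (ub t) = - (ineqc P t (xb t) (ub t) $ j)"
          using elim(2) by (simp add: g_minus_def)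
        ultimately show ?thesis by simp
      qed
      then have "r t \<bullet> ineqc P t (xb t) (ub t) = 0"
        unfolding inner_vec_def inner_real_def by (intro sum.neutral ballI)
      then show ?case using elim(1) by simp
    qed
  qed
  moreover have "(p a, - p b) \<in> transversality_set P lam (xb a, xb b)"
  proof -
    have "(p a, - p b) = lam *\<^sub>R s + c" by (simp add: c_def)
    moreover have "c \<in> limiting_normal_cone (endpts P) (xb a, xb b)" using cN by simp
    ultimately show ?thesis
      using ssub unfolding transversality_set_def eb_def mem_Collect_eq by (intro exI[of _ s] exI[of _ c] conjI)
  qed
  ultimately show ?thesis unfolding fold using pW qi ri \<zeta>i by blast
qed

end
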